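(* Let $\nu\in\mathbb{N}^*$, $h\in(0,1/2)$, $H=L^2([0,1]^\nu,\lambda)$, let $(H,E,\mu)$ be an abstract Wiener space such that $E$ is a separable Hilbert space and the embedding $H\subset E$ is Hilbert–Schmidt, and let $\Delta=\Delta_{4h}$ be the Lévy measure on $E$ described in the context. Let $\mathbb{B}$ be a complex Gaussian white noise on the Borel sets of $E$, with control measure $\Delta$, and define the stochastic process $\{\mathscr{B}(\xi),\ \xi\in E^*\}$ by $$\mathscr{B}(\xi)=\int_E\left(1-e^{i\langle\xi,x\rangle}\right)\,\mathrm{d}\mathbb{B}_x,\qquad \xi\in E^*.$$ Then the definition of $\mathscr{B}$ extends to $H$, and the process $\{\mathscr{B}(\mathbf{1}_{[0,t]}),\ t\in[0,1]^\nu\}$ is a centred Gaussian process with covariance $$k^{(\nu)}(s,t)=\tfrac12\left(\lambda([0,s])^{2h}+\lambda([0,t])^{2h}-\lambda([0,s]\bigtriangleup[0,t])^{2h}\right),\qquad s,t\in[0,1]^\nu,$$ i.e. it is a multiparameter fractional Brownian motion.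
   Context: $\lambda$ is Lebesgue measure on $\mathbb{R}^\nu$; for $t\in\mathbb{R}_+^\nu$, $[0,t]$ is the rectangle with vertices at $0$ and $t$; $\bigtriangleup$ is the symmetric difference of sets. A multiparameter fractional Brownian motion of Hurst parameter $h$ is a centred Gaussian process with covariance $k^{(\nu)}$. Abstract Wiener space $(H,E,\mu)$: $E$ is a separable Banach space, $\mu$ a centred Gaussian measure on $E$ with covariance operator $S\xi=\int_E x\,\langle\xi,x\rangle\,\mu(\mathrm{d}x)$, $\xi\in E^*$, and $H$ is a Hilbert space densely and continuously embedded in $E$, which is the completion of $S(E^* )$ for the scalar product $(S\xi,S\xi')_H=\int_E\langle\xi,x\rangle\langle\xi',x\rangle\,\mu(\mathrm{d}x)$. Here $E$ is moreover a Hilbert space and the embedding $H\subset E$ is Hilbert–Schmidt (for any separable Hilbert space $H$ such $E$ and $\mu$ exist). The Paley–Wiener map $\mathcal{I}:H\to L^2(\mu)$ is the isometric extension of $S\xi\mapsto\langle\xi,\cdot\rangle$, $\xi\in E^*$. Lévy measure $\Delta$: under these conditions, $\xi\in E^*\mapsto\exp(-\frac12\|S\xi\|_H^{4h})$ is the Fourier transform of a symmetric strictly stable measure $\Gamma$ on $E$ of index $4h\in(0,2)$, and $\Delta=\Delta_{4h}$ denotes the Lévy measure of $\Gamma$. It is symmetric, non-trivial, satisfies $\Delta(\{0\})=0$, $\int_E(1\wedge\|x\|_E^2)\,\Delta(\mathrm{d}x)<\infty$, and $$\|S\xi\|_H^{4h}=2\int_E(1-\cos\langle\xi,x\rangle)\,\Delta(\mathrm{d}x),\qquad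 \xi\in E^*.$$ Complex Gaussian white noise on $E$ with control measure $\Delta$: a centred Gaussian complex-valued random measure with $\mathbb{E}[\mathbb{B}(A)\overline{\mathbb{B}(A')}]=\Delta(A\cap A')$ for Borel sets $A,A'$ of finite $\Delta$-measure; $\int_E f\,\mathrm{d}\mathbb{B}$, for complex $f\in L^2(E,\Delta)$, is the associated Wiener integral, satisfying $\mathbb{E}[\int_E f\,\mathrm{d}\mathbb{B}\,\overline{\int_E g\,\mathrm{d}\mathbb{B}}]=\int_E f\bar g\,\mathrm{d}\Delta$. Extension to $H$: $\xi\in E^*$ is identified with $S\xi\in H$; by density of $S(E^* )$ in $H$, the identity above extends through the Paley–Wiener map to $\|\varphi\|_H^{4h}=2\int_E(1-\cos\langle\mathcal{I}(\varphi),x\rangle)\,\Delta(\mathrm{d}x)$, $\varphi\in H$, and $\mathscr{B}(\varphi)=\int_E(1-e^{i\langle\mathcal{I}(\varphi),x\rangle})\,\mathrm{d}\mathbb{B}_x$ is the resulting isometric ($L^2$-limit) extension of $\mathscr{B}$ to $\varphi\in H$. *)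

theory Defs
  imports "HOL-Probability.Probability"
begin

section \<open>The Hilbert space of square-integrable functions on the unit cube\<close>

definition cube_measure :: "(real ^ 'n) measure" where
  "cube_measure = restrict_space lborel (cbox 0 1)"

definition cube_sq_integrable :: "(real ^ 'n \<Rightarrow> real) \<Rightarrow> bool" where
  "cube_sq_integrable f \<longleftrightarrow>
     f \<in> borel_measurable cube_measure \<and> integrable cube_measure (\<lambda>x. (f x)\<^sup>2)"

definition cube_L2_rel :: "(real ^ 'n \<Rightarrow> real) \<Rightarrow> (real ^ 'n \<Rightarrow> real) \<Rightarrow> bool" where
  "cube_L2_rel f g \<longleftrightarrow>
     cube_sq_integrable f \<and> cube_sq_integrable g \<and> (AE x in cube_measure. f x = g x)"

lemma cube_sq_integrable_0: "cube_sq_integrable (\<lambda>x. 0)"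
  by (simp add: cube_sq_integrable_def)

lemma part_equivp_cube_L2_rel: "part_equivp cube_L2_rel"
proof (rule part_equivpI)
  show "\<exists>f :: real ^ 'n \<Rightarrow> real. cube_L2_rel f f"
    by (rule exI[of _ "\<lambda>x. 0"]) (simp add: cube_L2_rel_def cube_sq_integrable_0)
  show "symp (cube_L2_rel :: (real ^ 'n \<Rightarrow> real) \<Rightarrow> _)"
    by (rule sympI) (auto simp: cube_L2_rel_def)
  show "transp (cube_L2_rel :: (real ^ 'n \<Rightarrow> real) \<Rightarrow> _)"
    by (rule transpI) (auto simp: cube_L2_rel_def)
qed

quotient_type 'n cube_L2 = "real ^ 'n \<Rightarrow> real" / partial: cube_L2_rel
  morphisms rep_cube_L2 abs_cube_L2
  by (rule part_equivp_cube_L2_rel)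

lemma finite_measure_cube: "finite_measure (cube_measure :: (real ^ 'n) measure)"
proof (rule finite_measureI)
  have "emeasure lborel (cbox 0 (1 :: real ^ 'n)) < \<infinity>"
    by (rule emeasure_lborel_cbox_finite)
  then show "emeasure (cube_measure :: (real ^ 'n) measure) (space cube_measure) \<noteq> \<infinity>"
    by (simp add: cube_measure_def emeasure_restrict_space space_restrict_space)
qed

lemma cube_sq_integrable_mult:
  assumes "cube_sq_integrable f" "cube_sq_integrable g"
  shows "integrable cube_measure (\<lambda>x. f x * g x)"
proof (rule Bochner_Integration.integrable_bound)
  show "integrable cube_measure (\<lambda>x. (f x)\<^sup>2 + (g x)\<^sup>2)"
    using assms by (auto simp: cube_sq_integrable_def)
  show "(\<lambda>x. f x * g x) \<in> borel_measurable cube_measure"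
    using assms by (auto simp: cube_sq_integrable_def)
  have "\<bar>a * b\<bar> \<le> \<bar>a\<^sup>2 + b\<^sup>2\<bar>" for a b :: real
  proof -
    have "0 \<le> (\<bar>a\<bar> - \<bar>b\<bar>)\<^sup>2" by simp
    then have "2 * \<bar>a * b\<bar> \<le> a\<^sup>2 + b\<^sup>2"
      by (simp add: power2_diff abs_mult)
    then show ?thesis
      using zero_le_power2[of a] zero_le_power2[of b] abs_ge_zero[of "a * b"] by linarith
  qed
  then show "AE x in cube_measure. norm (f x * g x) \<le> norm ((f x)\<^sup>2 + (g x)\<^sup>2)"
    by simp
qed

lemma cube_sq_integrable_add:
  assumes "cube_sq_integrable f" "cube_sq_integrable g"
  shows "cube_sq_integrable (\<lambda>x. f x + g x)"
  using assms cube_sq_integrable_mult[OF assms]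
  by (auto simp: cube_sq_integrable_def power2_sum mult.assoc)

lemma cube_sq_integrable_scale:
  assumes "cube_sq_integrable f"
  shows "cube_sq_integrable (\<lambda>x. c * f x)"
  using assms by (auto simp: cube_sq_integrable_def power_mult_distrib)

lemma cube_sq_integrable_diff:
  assumes "cube_sq_integrable f" "cube_sq_integrable g"
  shows "cube_sq_integrable (\<lambda>x. f x - g x)"
  using cube_sq_integrable_add[OF assms(1) cube_sq_integrable_scale[OF assms(2), of "-1"]]
  by simp

instantiation cube_L2 :: (finite) real_vector
begin

lift_definition zero_cube_L2 :: "'a cube_L2" is "\<lambda>x. 0"
  by (simp add: cube_L2_rel_def cube_sq_integrable_0)

lift_definition plus_cube_L2 :: "'a cube_L2 \<Rightarrow> 'a cube_L2 \<Rightarrow> 'a cube_L2"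
  is "\<lambda>f g x. f x + g x"
  by (auto simp: cube_L2_rel_def intro!: cube_sq_integrable_add)

lift_definition uminus_cube_L2 :: "'a cube_L2 \<Rightarrow> 'a cube_L2" is "\<lambda>f x. - f x"
  by (auto simp: cube_L2_rel_def cube_sq_integrable_def)

lift_definition minus_cube_L2 :: "'a cube_L2 \<Rightarrow> 'a cube_L2 \<Rightarrow> 'a cube_L2"
  is "\<lambda>f g x. f x - g x"
  by (auto simp: cube_L2_rel_def intro!: cube_sq_integrable_diff)

lift_definition scaleR_cube_L2 :: "real \<Rightarrow> 'a cube_L2 \<Rightarrow> 'a cube_L2" is "\<lambda>c f x. c * f x"
  by (auto simp: cube_L2_rel_def intro!: cube_sq_integrable_scale)

instance
  by standard
    (transfer; auto simp: cube_L2_rel_def algebra_simps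
      intro!: cube_sq_integrable_0 cube_sq_integrable_add cube_sq_integrable_diff
        cube_sq_integrable_scale)+

end

instantiation cube_L2 :: (finite) real_inner
begin

lift_definition inner_cube_L2 :: "'a cube_L2 \<Rightarrow> 'a cube_L2 \<Rightarrow> real"
  is "\<lambda>f g. \<integral>x. f x * g x \<partial>cube_measure"
  unfolding cube_L2_rel_def cube_sq_integrable_def
  by (intro integral_cong_AE) auto

definition norm_cube_L2 :: "'a cube_L2 \<Rightarrow> real" where
  "norm_cube_L2 x = sqrt (x \<bullet> x)"

definition dist_cube_L2 :: "'a cube_L2 \<Rightarrow> 'a cube_L2 \<Rightarrow> real" where
  "dist_cube_L2 x y = norm (x - y)"

definition sgn_cube_L2 :: "'a cube_L2 \<Rightarrow> 'a cube_L2" where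
  "sgn_cube_L2 x = inverse (norm x) *\<^sub>R x"

definition uniformity_cube_L2 :: "('a cube_L2 \<times> 'a cube_L2) filter" where
  "uniformity_cube_L2 = (INF e\<in>{0 <..}. principal {(x, y). dist x y < e})"

definition open_cube_L2 :: "'a cube_L2 set \<Rightarrow> bool" where
  "open_cube_L2 U \<longleftrightarrow>
     (\<forall>x\<in>U. eventually (\<lambda>(x', y). x' = x \<longrightarrow> y \<in> U) uniformity)"

instance
proof
  fix x y z :: "'a cube_L2" and r :: real
  show "dist x y = norm (x - y)" by (rule dist_cube_L2_def)
  show "sgn x = inverse (norm x) *\<^sub>R x" by (rule sgn_cube_L2_def)
  show "(uniformity :: ('a cube_L2 \<times> 'a cube_L2) filter) =
      (INF e\<in>{0 <..}. principal {(x, y). dist x y < e})"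
    by (rule uniformity_cube_L2_def)
  show "open U \<longleftrightarrow> (\<forall>x\<in>U. eventually (\<lambda>(x', y). x' = x \<longrightarrow> y \<in> U) uniformity)"
    for U :: "'a cube_L2 set"
    by (rule open_cube_L2_def)
  show "x \<bullet> y = y \<bullet> x" by transfer (simp add: mult.commute)
  show "(x + y) \<bullet> z = x \<bullet> z + y \<bullet> z"
    by transfer
      (simp add: cube_L2_rel_def distrib_right Bochner_Integration.integral_add
        cube_sq_integrable_mult)
  show "(r *\<^sub>R x) \<bullet> y = r * (x \<bullet> y)"
    by transfer (simp add: mult.assoc)
  show "0 \<le> x \<bullet> x" by transfer simp
  show "(x \<bullet> x = 0) = (x = 0)"
  proof transfer
    fix f :: "real ^ 'a \<Rightarrow> real"
    assume "cube_L2_rel f f"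
    then have f: "cube_sq_integrable f" by (simp add: cube_L2_rel_def)
    have "(\<integral>x. f x * f x \<partial>cube_measure) = 0 \<longleftrightarrow> (AE x in cube_measure. f x * f x = 0)"
      by (rule integral_nonneg_eq_0_iff_AE[OF cube_sq_integrable_mult[OF f f]]) simp
    then show "((\<integral>x. f x * f x \<partial>cube_measure) = 0) = cube_L2_rel f (\<lambda>x. 0)"
      by (simp add: cube_L2_rel_def f cube_sq_integrable_0)
  qed
  show "norm x = sqrt (x \<bullet> x)" by (rule norm_cube_L2_def)
qed

end

lemma rep_cube_L2: "cube_sq_integrable (rep_cube_L2 x)"
  using Quotient_rep_reflp[OF Quotient_cube_L2, of x] by (simp add: cube_L2_rel_def)

lemma abs_rep_cube_L2: "abs_cube_L2 (rep_cube_L2 x) = x"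
  by (rule Quotient_abs_rep[OF Quotient_cube_L2])

lemma norm_abs_cube_L2:
  assumes "cube_sq_integrable f"
  shows "ennreal ((norm (abs_cube_L2 f))\<^sup>2) = (\<integral>\<^sup>+x. ennreal ((f x)\<^sup>2) \<partial>cube_measure)"
proof -
  have "abs_cube_L2 f \<bullet> abs_cube_L2 f = (\<integral>x. f x * f x \<partial>cube_measure)"
    using assms by (simp add: inner_cube_L2.abs_eq cube_L2_rel_def)
  then have "(norm (abs_cube_L2 f))\<^sup>2 = (\<integral>x. (f x)\<^sup>2 \<partial>cube_measure)"
    unfolding power2_norm_eq_inner by (simp add: power2_eq_square)
  then show ?thesis
    using assms by (simp add: cube_sq_integrable_def nn_integral_eq_integral)
qed

lemma norm_diff_cube_L2:
  "ennreal ((norm (x - y))\<^sup>2) =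
     (\<integral>\<^sup>+z. ennreal ((rep_cube_L2 x z - rep_cube_L2 y z)\<^sup>2) \<partial>cube_measure)"
proof -
  have "abs_cube_L2 (\<lambda>z. rep_cube_L2 x z - rep_cube_L2 y z) = x - y"
    using minus_cube_L2.abs_eq[of "rep_cube_L2 x" "rep_cube_L2 y"]
    by (simp add: cube_L2_rel_def rep_cube_L2 abs_rep_cube_L2)
  then show ?thesis
    using norm_abs_cube_L2[OF cube_sq_integrable_diff[OF rep_cube_L2[of x] rep_cube_L2[of y]]]
    by simp
qed

instance cube_L2 :: (finite) complete_space
proof
  fix X :: "nat \<Rightarrow> 'a cube_L2"
  assume X: "Cauchy X"
  let ?M = "cube_measure :: (real ^ 'a) measure"
  interpret finite_measure ?M by (rule finite_measure_cube)
  have "\<exists>N. \<forall>m\<ge>N. \<forall>n\<ge>N. norm (X m - X n) < (1/2) ^ k" for k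
    using X unfolding Cauchy_def dist_norm by simp
  then obtain N where N: "\<And>k m n. m \<ge> N k \<Longrightarrow> n \<ge> N k \<Longrightarrow> norm (X m - X n) < (1/2) ^ k"
    by metis
  define s where "s k = (\<Sum>i\<le>k. N i) + k" for k
  have s_mono: "strict_mono s"
    by (rule strict_monoI_Suc) (simp add: s_def)
  have s_ge: "s m \<ge> N k" if "k \<le> m" for k m
  proof -
    have "N k \<le> (\<Sum>i\<le>m. N i)"
      using that by (intro member_le_sum) auto
    then show ?thesis by (simp add: s_def)
  qed
  define f where "f k = rep_cube_L2 (X (s k))" for k
  have f: "cube_sq_integrable (f k)" for k
    by (simp add: f_def rep_cube_L2)
  then have [measurable]: "f k \<in> borel_measurable ?M" for k
    by (simp add: cube_sq_integrable_def)
  have f_diff: "(\<integral>\<^sup>+x. ennreal ((f m x - f k x)\<^sup>2) \<partial>?M) \<le> ennreal (((1/2) ^ k)\<^sup>2)"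
    if "k \<le> m" for k m
  proof -
    have "norm (X (s m) - X (s k)) \<le> (1/2) ^ k"
      using N[OF s_ge[OF that] s_ge[OF order_refl]] by simp
    then show ?thesis
      unfolding f_def norm_diff_cube_L2[symmetric]
      by (intro ennreal_leI power_mono) auto
  qed
  have L1: "(\<integral>\<^sup>+x. ennreal \<bar>f (Suc k) x - f k x\<bar> \<partial>?M) \<le>
      ennreal ((3/4) ^ k * (measure ?M (space ?M) + 2))" for k
  proof -
    have ineq: "\<bar>a\<bar> \<le> (1/2) ^ k + 2 ^ k * a\<^sup>2" for a :: real
    proof (cases "\<bar>a\<bar> \<le> (1/2) ^ k")
      case True
      have "0 \<le> 2 ^ k * a\<^sup>2" by simp
      with True show ?thesis by linarith
    next
      case False
      then have "(2 ^ k * (1/2) ^ k) * \<bar>a\<bar> \<le> (2 ^ k * \<bar>a\<bar>) * \<bar>a\<bar>"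
        by (intro mult_right_mono mult_left_mono) auto
      moreover have "(2::real) ^ k * (1/2) ^ k = 1"
        by (simp flip: power_mult_distrib)
      ultimately have "\<bar>a\<bar> \<le> 2 ^ k * a\<^sup>2"
        by (simp add: power2_eq_square)
      moreover have "(0::real) \<le> (1/2) ^ k" by simp
      ultimately show ?thesis by linarith
    qed
    have "(\<integral>\<^sup>+x. ennreal \<bar>f (Suc k) x - f k x\<bar> \<partial>?M) \<le>
        (\<integral>\<^sup>+x. ennreal ((1/2) ^ k) + ennreal (2 ^ k) * ennreal ((f (Suc k) x - f k x)\<^sup>2) \<partial>?M)"
      using ineq
      by (intro nn_integral_mono)
        (simp del: ennreal_plus add: ennreal_plus[symmetric] ennreal_mult[symmetric] ennreal_leI)
    also have "\<dots> = ennreal ((1/2) ^ k) * emeasure ?M (space ?M) +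
        ennreal (2 ^ k) * (\<integral>\<^sup>+x. ennreal ((f (Suc k) x - f k x)\<^sup>2) \<partial>?M)"
      by (subst nn_integral_add) (auto simp: nn_integral_cmult)
    also have "\<dots> \<le> ennreal ((1/2) ^ k) * ennreal (measure ?M (space ?M)) +
        ennreal (2 ^ k) * ennreal (((1/2) ^ k)\<^sup>2)"
      by (intro add_mono mult_left_mono f_diff) (auto simp: emeasure_eq_measure)
    also have "\<dots> = ennreal ((1/2) ^ k * measure ?M (space ?M) + 2 ^ k * ((1/2) ^ k)\<^sup>2)"
      by (simp add: ennreal_mult ennreal_plus)
    also have "\<dots> \<le> ennreal ((3/4) ^ k * (measure ?M (space ?M) + 2))"
    proof (rule ennreal_leI)
      have e: "(2::real) ^ k * ((1/2) ^ k)\<^sup>2 = (1/2) ^ k"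
        by (simp add: power2_eq_square power_mult_distrib power_divide)
      have "(1/2::real) ^ k \<le> (3/4) ^ k" by (rule power_mono) auto
      then have "(1/2) ^ k * (measure ?M (space ?M) + 1) \<le>
          (3/4) ^ k * (measure ?M (space ?M) + 2)"
        by (intro mult_mono) auto
      then show "(1/2) ^ k * measure ?M (space ?M) + 2 ^ k * ((1/2) ^ k)\<^sup>2 \<le>
          (3/4) ^ k * (measure ?M (space ?M) + 2)"
        unfolding e by (simp add: algebra_simps)
    qed
    finally show ?thesis .
  qed
  have "(\<integral>\<^sup>+x. (\<Sum>k. ennreal \<bar>f (Suc k) x - f k x\<bar>) \<partial>?M) =
      (\<Sum>k. \<integral>\<^sup>+x. ennreal \<bar>f (Suc k) x - f k x\<bar> \<partial>?M)"
    by (rule nn_integral_suminf) auto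
  also have "\<dots> \<le> (\<Sum>k. ennreal ((3/4) ^ k * (measure ?M (space ?M) + 2)))"
    by (intro suminf_le L1) auto
  also have "\<dots> < \<infinity>"
  proof -
    have "summable (\<lambda>k. (3/4::real) ^ k * (measure ?M (space ?M) + 2))"
      by (intro summable_mult2 summable_geometric) auto
    then show ?thesis
      by (subst suminf_ennreal_eq[OF _ summable_sums]) auto
  qed
  finally have "(\<integral>\<^sup>+x. (\<Sum>k. ennreal \<bar>f (Suc k) x - f k x\<bar>) \<partial>?M) \<noteq> \<infinity>"
    by simp
  then have AE_fin: "AE x in ?M. (\<Sum>k. ennreal \<bar>f (Suc k) x - f k x\<bar>) \<noteq> \<infinity>"
    by (intro nn_integral_PInf_AE) auto
  define g where "g x = lim (\<lambda>k. f k x)" for x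
  have [measurable]: "g \<in> borel_measurable ?M"
    unfolding g_def by measurable
  have conv: "AE x in ?M. (\<lambda>k. f k x) \<longlonglongrightarrow> g x"
    using AE_fin
  proof eventually_elim
    case (elim x)
    have "summable (\<lambda>k. \<bar>f (Suc k) x - f k x\<bar>)"
      by (rule summable_suminf_not_top) (use elim in auto)
    then have "summable (\<lambda>k. f (Suc k) x - f k x)"
      by (rule summable_rabs_cancel)
    then have "(\<lambda>n. \<Sum>k<n. f (Suc k) x - f k x) \<longlonglongrightarrow> (\<Sum>k. f (Suc k) x - f k x)"
      by (rule summable_LIMSEQ)
    then have "(\<lambda>n. f n x - f 0 x) \<longlonglongrightarrow> (\<Sum>k. f (Suc k) x - f k x)"
      by (simp only: sum_lessThan_telescope[of "\<lambda>k. f k x"])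
    from tendsto_add[OF this tendsto_const[of "f 0 x"]]
    have "convergent (\<lambda>n. f n x)"
      by (auto simp: convergent_def)
    then show ?case
      unfolding g_def by (simp add: convergent_LIMSEQ_iff)
  qed
  have g_diff: "(\<integral>\<^sup>+x. ennreal ((g x - f k x)\<^sup>2) \<partial>?M) \<le> ennreal (((1/2) ^ k)\<^sup>2)" for k
  proof -
    have "(\<integral>\<^sup>+x. ennreal ((g x - f k x)\<^sup>2) \<partial>?M) =
        (\<integral>\<^sup>+x. liminf (\<lambda>m. ennreal ((f m x - f k x)\<^sup>2)) \<partial>?M)"
      using conv
    proof (intro nn_integral_cong_AE, eventually_elim)
      case (elim x)
      have "(\<lambda>m. ennreal ((f m x - f k x)\<^sup>2)) \<longlonglongrightarrow> ennreal ((g x - f k x)\<^sup>2)"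
        by (intro tendsto_ennrealI tendsto_intros elim)
      then show ?case
        by (intro lim_imp_Liminf[symmetric]) auto
    qed
    also have "\<dots> \<le> liminf (\<lambda>m. \<integral>\<^sup>+x. ennreal ((f m x - f k x)\<^sup>2) \<partial>?M)"
      by (rule nn_integral_liminf) auto
    also have "\<dots> \<le> liminf (\<lambda>m. ennreal (((1/2) ^ k)\<^sup>2))"
      by (intro Liminf_mono eventually_sequentiallyI[of k] f_diff)
    finally show ?thesis
      by (simp add: Liminf_const)
  qed
  have gf: "cube_sq_integrable (\<lambda>x. g x - f k x)" for k
    unfolding cube_sq_integrable_def
    using g_diff[of k] by (auto intro!: integrableI_nonneg order_le_less_trans[OF g_diff])
  have g: "cube_sq_integrable g"
    using cube_sq_integrable_add[OF gf[of 0] f[of 0]] by simp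
  have bound: "norm (X (s k) - abs_cube_L2 g) \<le> (1/2) ^ k" for k
  proof -
    have eq: "abs_cube_L2 (\<lambda>x. g x - f k x) = abs_cube_L2 g - X (s k)"
      using minus_cube_L2.abs_eq[of g "f k"] f[of k] g
      by (simp add: cube_L2_rel_def f_def abs_rep_cube_L2)
    have "ennreal ((norm (abs_cube_L2 g - X (s k)))\<^sup>2) \<le> ennreal (((1/2) ^ k)\<^sup>2)"
      using g_diff[of k] norm_abs_cube_L2[OF gf[of k]] unfolding eq by simp
    then have "(norm (abs_cube_L2 g - X (s k)))\<^sup>2 \<le> ((1/2) ^ k)\<^sup>2"
      by (subst (asm) ennreal_le_iff) auto
    then show ?thesis
      by (subst norm_minus_commute) (rule power2_le_imp_le, auto)
  qed
  have "(\<lambda>k. X (s k) - abs_cube_L2 g) \<longlonglongrightarrow> 0"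
  proof (rule Lim_null_comparison)
    show "\<forall>\<^sub>F k in sequentially. norm (X (s k) - abs_cube_L2 g) \<le> (1/2) ^ k"
      using bound by simp
    show "(\<lambda>k. (1/2::real) ^ k) \<longlonglongrightarrow> 0"
      by (rule LIMSEQ_power_zero) simp
  qed
  then have lim: "(\<lambda>k. X (s k)) \<longlonglongrightarrow> abs_cube_L2 g"
    by (simp add: LIM_zero_iff)
  show "convergent X"
  proof (rule convergentI[of _ "abs_cube_L2 g"], rule metric_LIMSEQ_I)
    fix e :: real assume e: "0 < e"
    obtain N1 where N1: "\<And>m n. m \<ge> N1 \<Longrightarrow> n \<ge> N1 \<Longrightarrow> dist (X m) (X n) < e/2"
      using metric_CauchyD[OF X, of "e/2"] e by auto
    obtain N2 where N2: "\<And>k. k \<ge> N2 \<Longrightarrow> dist (X (s k)) (abs_cube_L2 g) < e/2"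
      using metric_LIMSEQ_D[OF lim, of "e/2"] e by auto
    show "\<exists>N. \<forall>n\<ge>N. dist (X n) (abs_cube_L2 g) < e"
    proof (intro exI allI impI)
      fix n assume n: "n \<ge> N1"
      let ?k = "max N1 N2"
      have "s ?k \<ge> N1" using seq_suble[OF s_mono, of ?k] by simp
      then have "dist (X n) (X (s ?k)) < e/2" using N1 n by simp
      moreover have "dist (X (s ?k)) (abs_cube_L2 g) < e/2" using N2[of ?k] by simp
      ultimately show "dist (X n) (abs_cube_L2 g) < e"
        using dist_triangle[of "X n" "abs_cube_L2 g" "X (s ?k)"] by linarith
    qed
  qed
qed

text \<open>The class of the indicator function of the rectangle \<open>[0,t]\<close>.\<close>

definition rect_ind :: "real ^ 'n \<Rightarrow> 'n cube_L2" where
  "rect_ind t = abs_cube_L2 (indicator (cbox 0 t))"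


section \<open>Gaussian measures and processes\<close>

text \<open>Degenerate laws count as Gaussian.\<close>

definition centred_gaussian_law :: "real measure \<Rightarrow> bool" where
  "centred_gaussian_law N \<longleftrightarrow>
     N = return borel 0 \<or> (\<exists>\<sigma>>0. N = density lborel (normal_density 0 \<sigma>))"

definition centred_gaussian_measure :: "'e::real_normed_vector measure \<Rightarrow> bool" where
  "centred_gaussian_measure \<mu> \<longleftrightarrow> prob_space \<mu> \<and> sets \<mu> = sets borel \<and>
     (\<forall>\<xi> :: 'e \<Rightarrow>\<^sub>L real. centred_gaussian_law (distr \<mu> borel (blinfun_apply \<xi>)))"

text \<open>The real parts of finite complex linear combinations are exactly the finite real linear
  combinations of the real and imaginary parts, so this says that the real and imaginary parts of
  the variables are jointly Gaussian and centred.\<close>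

definition centred_gaussian_process ::
    "'w measure \<Rightarrow> 'i set \<Rightarrow> ('i \<Rightarrow> 'w \<Rightarrow> complex) \<Rightarrow> bool" where
  "centred_gaussian_process P T X \<longleftrightarrow>
     (\<forall>i\<in>T. X i \<in> borel_measurable P) \<and>
     (\<forall>F c. finite F \<longrightarrow> F \<subseteq> T \<longrightarrow>
        centred_gaussian_law (distr P borel (\<lambda>w. Re (\<Sum>i\<in>F. c i * X i w))))"

definition mfbm_cov :: "real \<Rightarrow> real ^ 'n \<Rightarrow> real ^ 'n \<Rightarrow> real" where
  "mfbm_cov h s t =
     (measure lborel (cbox 0 s) powr (2 * h) + measure lborel (cbox 0 t) powr (2 * h)
      - measure lborel (sym_diff (cbox 0 s) (cbox 0 t)) powr (2 * h)) / 2"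

text \<open>The covariance of a centred complex process is the Hermitian one; no condition is put on
  the expectation of \<open>X s * X t\<close>.\<close>

definition multiparameter_fbm ::
    "real \<Rightarrow> 'w measure \<Rightarrow> (real ^ 'n \<Rightarrow> 'w \<Rightarrow> complex) \<Rightarrow> bool" where
  "multiparameter_fbm h P X \<longleftrightarrow> centred_gaussian_process P (cbox 0 1) X \<and>
     (\<forall>s\<in>cbox 0 1. \<forall>t\<in>cbox 0 1.
        (\<integral>w. X s w * cnj (X t w) \<partial>P) = complex_of_real (mfbm_cov h s t))"


section \<open>Abstract Wiener spaces\<close>

definition covariance_operator ::
    "'e::{banach, second_countable_topology} measure \<Rightarrow> ('e \<Rightarrow>\<^sub>L real) \<Rightarrow> 'e" where
  "covariance_operator \<mu> \<xi> = (\<integral>x. blinfun_apply \<xi> x *\<^sub>R x \<partial>\<mu>)"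

text \<open>The embedding of \<open>H\<close> into \<open>E\<close> is an explicit map \<open>j\<close>; the element of \<open>H\<close> corresponding to
  \<open>S \<xi>\<close> is its preimage under \<open>j\<close>.\<close>

definition dual_to_H ::
    "('h::real_inner \<Rightarrow> 'e) \<Rightarrow> 'e::{banach, second_countable_topology} measure
      \<Rightarrow> ('e \<Rightarrow>\<^sub>L real) \<Rightarrow> 'h" where
  "dual_to_H j \<mu> \<xi> = inv j (covariance_operator \<mu> \<xi>)"

definition abstract_wiener_space ::
    "('h::{real_inner, complete_space} \<Rightarrow> 'e) \<Rightarrow> 'e::{banach, second_countable_topology} measure
      \<Rightarrow> bool" where
  "abstract_wiener_space j \<mu> \<longleftrightarrow>
     centred_gaussian_measure \<mu> \<and>
     bounded_linear j \<and> inj j \<and> closure (range j) = UNIV \<and>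
     range (covariance_operator \<mu>) \<subseteq> range j \<and>
     (\<forall>\<xi> \<xi>'. dual_to_H j \<mu> \<xi> \<bullet> dual_to_H j \<mu> \<xi>' =
        (\<integral>x. blinfun_apply \<xi> x * blinfun_apply \<xi>' x \<partial>\<mu>)) \<and>
     closure (range (dual_to_H j \<mu>)) = UNIV"

definition orthonormal_basis :: "'h::real_inner set \<Rightarrow> bool" where
  "orthonormal_basis U \<longleftrightarrow>
     pairwise orthogonal U \<and> (\<forall>u\<in>U. norm u = 1) \<and> closure (span U) = UNIV"

definition hilbert_schmidt :: "('h::real_inner \<Rightarrow> 'e::real_inner) \<Rightarrow> bool" where
  "hilbert_schmidt j \<longleftrightarrow> bounded_linear j \<and>
     (\<exists>U. orthonormal_basis U \<and> (\<lambda>u. (norm (j u))\<^sup>2) summable_on U)"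


section \<open>Stable measures and Levy measures\<close>

definition fourier_measure :: "'e::real_normed_vector measure \<Rightarrow> ('e \<Rightarrow>\<^sub>L real) \<Rightarrow> complex" where
  "fourier_measure \<Gamma> \<xi> = (\<integral>x. cis (blinfun_apply \<xi> x) \<partial>\<Gamma>)"

definition symmetric_measure :: "'e::real_normed_vector measure \<Rightarrow> bool" where
  "symmetric_measure \<Gamma> \<longleftrightarrow> distr \<Gamma> borel (\<lambda>x. - x) = \<Gamma>"

definition strictly_stable ::
    "real \<Rightarrow> 'e::{real_normed_vector, second_countable_topology} measure \<Rightarrow> bool" where
  "strictly_stable \<alpha> \<Gamma> \<longleftrightarrow> prob_space \<Gamma> \<and> sets \<Gamma> = sets borel \<and>
     (\<forall>a>0. \<forall>b>0.
        distr (\<Gamma> \<Otimes>\<^sub>M \<Gamma>) borel (\<lambda>(x, y). a *\<^sub>R x + b *\<^sub>R y) =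
        distr \<Gamma> borel (\<lambda>x. ((a powr \<alpha> + b powr \<alpha>) powr (1 / \<alpha>)) *\<^sub>R x))"

text \<open>\<open>\<Delta>\<close> is the jump measure in the Levy--Khintchine representation of \<open>\<Gamma>\<close>, with drift \<open>b\<close> and
  Gaussian part \<open>\<rho>\<close>. In a separable Hilbert space the Levy measures are exactly the measures
  without mass at 0 that integrate \<open>min 1 \<parallel>x\<parallel>\<^sup>2\<close>.\<close>

definition levy_measure_of ::
    "'e::{real_inner, banach, second_countable_topology} measure \<Rightarrow> 'e measure \<Rightarrow> bool" where
  "levy_measure_of \<Gamma> \<Delta> \<longleftrightarrow>
     sets \<Delta> = sets borel \<and> emeasure \<Delta> {0} = 0 \<and>
     (\<integral>\<^sup>+x. ennreal (min 1 ((norm x)\<^sup>2)) \<partial>\<Delta>) < \<infinity> \<and>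
     (\<exists>b \<rho>. centred_gaussian_measure \<rho> \<and>
        (\<forall>\<xi>. fourier_measure \<Gamma> \<xi> =
           exp (\<i> * complex_of_real (blinfun_apply \<xi> b)
                - complex_of_real (\<integral>x. (blinfun_apply \<xi> x)\<^sup>2 \<partial>\<rho>) / 2
                + (\<integral>x. cis (blinfun_apply \<xi> x) - 1
                        - \<i> * complex_of_real (blinfun_apply \<xi> x * indicator (cball 0 1) x) \<partial>\<Delta>))))"


section \<open>White noise and Wiener integral\<close>

text \<open>Finite additivity, and countable additivity in quadratic mean, follow from the covariance.\<close>

definition complex_white_noise ::
    "'w measure \<Rightarrow> 'e measure \<Rightarrow> ('e set \<Rightarrow> 'w \<Rightarrow> complex) \<Rightarrow> bool" where
  "complex_white_noise P \<Delta> B \<longleftrightarrow>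
     centred_gaussian_process P {A \<in> sets \<Delta>. emeasure \<Delta> A < \<infinity>} B \<and>
     (\<forall>A\<in>sets \<Delta>. \<forall>A'\<in>sets \<Delta>. emeasure \<Delta> A < \<infinity> \<longrightarrow> emeasure \<Delta> A' < \<infinity> \<longrightarrow>
        (\<integral>w. B A w * cnj (B A' w) \<partial>P) = complex_of_real (measure \<Delta> (A \<inter> A')))"

definition simple_wiener_integral ::
    "'e measure \<Rightarrow> ('e set \<Rightarrow> 'w \<Rightarrow> complex) \<Rightarrow> ('e \<Rightarrow> complex) \<Rightarrow> 'w \<Rightarrow> complex" where
  "simple_wiener_integral \<Delta> B f w =
     (\<Sum>y \<in> f ` space \<Delta> - {0}. y * B {x \<in> space \<Delta>. f x = y} w)"

text \<open>\<open>simple_bochner_integrable\<close> is the library's predicate for simple functions that vanish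
  outside a set of finite measure.\<close>

definition has_wiener_integral ::
    "'w measure \<Rightarrow> 'e measure \<Rightarrow> ('e set \<Rightarrow> 'w \<Rightarrow> complex) \<Rightarrow> ('e \<Rightarrow> complex)
      \<Rightarrow> ('w \<Rightarrow> complex) \<Rightarrow> bool" where
  "has_wiener_integral P \<Delta> B f X \<longleftrightarrow>
     f \<in> borel_measurable \<Delta> \<and> X \<in> borel_measurable P \<and>
     (\<exists>s. (\<forall>n. Bochner_Integration.simple_bochner_integrable \<Delta> (s n)) \<and>
          (\<lambda>n. \<integral>\<^sup>+x. ennreal ((cmod (s n x - f x))\<^sup>2) \<partial>\<Delta>) \<longlonglongrightarrow> 0 \<and>
          (\<lambda>n. \<integral>\<^sup>+w. ennreal ((cmod (simple_wiener_integral \<Delta> B (s n) w - X w))\<^sup>2) \<partial>P) \<longlonglongrightarrow> 0)"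

text \<open>The integral is determined up to almost sure equality; an arbitrary version is chosen.\<close>

definition wiener_integral ::
    "'w measure \<Rightarrow> 'e measure \<Rightarrow> ('e set \<Rightarrow> 'w \<Rightarrow> complex) \<Rightarrow> ('e \<Rightarrow> complex)
      \<Rightarrow> 'w \<Rightarrow> complex" where
  "wiener_integral P \<Delta> B f = (SOME X. has_wiener_integral P \<Delta> B f X)"

definition noise_process ::
    "'w measure \<Rightarrow> 'e measure \<Rightarrow> ('e set \<Rightarrow> 'w \<Rightarrow> complex)
      \<Rightarrow> ('e::real_normed_vector \<Rightarrow>\<^sub>L real) \<Rightarrow> 'w \<Rightarrow> complex" where
  "noise_process P \<Delta> B \<xi> = wiener_integral P \<Delta> B (\<lambda>x. 1 - cis (blinfun_apply \<xi> x))"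


section \<open>Extension to the Hilbert space\<close>

text \<open>\<open>g\<close> is a version of the Paley--Wiener image of \<open>\<phi>\<close>: the \<open>L\<^sup>2(\<mu>)\<close>-limit of functionals \<open>\<xi> n\<close>
  whenever \<open>S (\<xi> n)\<close> tends to \<open>\<phi>\<close> in \<open>H\<close>. The measures \<open>\<mu>\<close> and \<open>\<Delta>\<close> need not be comparable, so
  for \<open>g\<close> to be meaningful under \<open>\<Delta>\<close> it must also be the limit in \<open>\<Delta>\<close>-measure.\<close>

definition paley_wiener_version ::
    "('h::real_inner \<Rightarrow> 'e) \<Rightarrow> 'e::{banach, second_countable_topology} measure \<Rightarrow> 'e measure
      \<Rightarrow> 'h \<Rightarrow> ('e \<Rightarrow> real) \<Rightarrow> bool" where
  "paley_wiener_version j \<mu> \<Delta> \<phi> g \<longleftrightarrow> g \<in> borel_measurable borel \<and>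
     (\<forall>\<xi>. (\<lambda>n. dual_to_H j \<mu> (\<xi> n)) \<longlonglongrightarrow> \<phi> \<longrightarrow>
        (\<lambda>n. \<integral>\<^sup>+x. ennreal ((blinfun_apply (\<xi> n) x - g x)\<^sup>2) \<partial>\<mu>) \<longlonglongrightarrow> 0 \<and>
        (\<forall>\<epsilon>>0. (\<lambda>n. emeasure \<Delta> {x. \<epsilon> \<le> \<bar>blinfun_apply (\<xi> n) x - g x\<bar>}) \<longlonglongrightarrow> 0))"

text \<open>\<open>W\<close> is the extension of \<open>X\<close> from the dual of \<open>E\<close> to \<open>H\<close> by limits in quadratic mean.
  Constant sequences \<open>\<xi>\<close> give \<open>W (S \<xi>) = X \<xi>\<close> almost surely.\<close>

definition L2_extension ::
    "('h::real_inner \<Rightarrow> 'e) \<Rightarrow> 'e::{banach, second_countable_topology} measure \<Rightarrow> 'w measure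
      \<Rightarrow> (('e \<Rightarrow>\<^sub>L real) \<Rightarrow> 'w \<Rightarrow> complex) \<Rightarrow> ('h \<Rightarrow> 'w \<Rightarrow> complex) \<Rightarrow> bool" where
  "L2_extension j \<mu> P X W \<longleftrightarrow>
     (\<forall>\<phi>. W \<phi> \<in> borel_measurable P \<and> integrable P (\<lambda>w. (cmod (W \<phi> w))\<^sup>2)) \<and>
     (\<forall>\<phi> \<xi>. (\<lambda>n. dual_to_H j \<mu> (\<xi> n)) \<longlonglongrightarrow> \<phi> \<longrightarrow>
        (\<lambda>n. \<integral>\<^sup>+w. ennreal ((cmod (X (\<xi> n) w - W \<phi> w))\<^sup>2) \<partial>P) \<longlonglongrightarrow> 0)"

end

theory Submission
  imports Defs
begin

text \<open>
  Write \<open>d \<xi>\<close> for the element \<open>S \<xi>\<close> of \<open>H\<close> and \<open>\<alpha> = 4 h\<close>. Comparing moduli in the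
  Levy--Khintchine formula of \<open>\<Gamma>\<close>, and letting \<open>\<xi>\<close> be multiplied by large scalars, shows that there is
  no Gaussian part and that \<open>\<parallel>d \<xi>\<parallel>\<^sup>\<alpha> = 2 \<integral> (1 - cos \<langle>\<xi>, x\<rangle>) \<partial>\<Delta>\<close>. Comparing arguments, the phase is a
  multiple of \<open>2 \<pi>\<close> that is continuous along rays, hence zero. Both facts together evaluate
  \<open>\<integral> (1 - e\<^sup>i\<^sup>\<xi>) (1 - e\<^sup>-\<^sup>i\<^sup>\<eta>) \<partial>\<Delta>\<close>, which by the Wiener isometry is the covariance of the process on the
  dual; so \<open>d \<xi> \<mapsto> \<B>(\<xi>)\<close> is uniformly continuous into \<open>L\<^sup>2(P)\<close> and extends to \<open>H\<close>. If \<open>d (\<xi> n)\<close>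
  converges, then \<open>\<xi> n\<close> is Cauchy in \<open>\<mu>\<close>-measure and, because the integrals of \<open>1 - cos (t \<xi>)\<close> control
  the tails of \<open>\<xi>\<close>, also in \<open>\<Delta>\<close>-measure; a pointwise limit along a subsequence is a Paley--Wiener
  version for both measures. Gaussianity passes to limits in quadratic mean via characteristic
  functions.
\<close>

section \<open>Convergence in quadratic mean\<close>

text \<open>The integrand \<open>1 - cis \<xi>\<close> is not linear in \<open>\<xi>\<close>, so the
  extension to H is not that of a linear isometry. Linearity is replaced by the chord identity
  |e^(ia) - e^(ib)|^2 = 2 (1 - cos (a - b)): the distance of two integrands depends on
  \<open>\<xi> - \<eta>\<close> alone, and the cosine identity turns it into
  \<open>norm (d \<xi> - d \<eta>) powr \<alpha>\<close>. Since the squared norm of an indicator is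
  the volume of its set, the exponent 4h on norms is the exponent 2h on volumes, and a difference of
  indicators produces the symmetric difference. The obstacle is the Paley-Wiener image under
  \<Delta>: a null set of \<mu> need not be null for \<Delta>, so an L2(\<mu>) limit settles nothing
  there. One Borel function has to serve both measures and every approximating sequence. It is
  characterised by inequalities against each \<open>\<eta>\<close> in the dual
  (\<open>pw_version\<close>), which Fatou's lemma carries to limits and which force convergence
  along all sequences; equality for the norm is recovered afterwards from the variance of a Wiener
  integral.\<close>

lemma Cauchy_in_measure_AE_convergent:
  fixes f :: "nat \<Rightarrow> 'a \<Rightarrow> 'b::{banach, second_countable_topology}"
  assumes [measurable]: "\<And>n. f n \<in> borel_measurable M"
    and Cauchy: "\<And>e. e > 0 \<Longrightarrow> \<exists>N. \<forall>m\<ge>N. \<forall>n\<ge>N.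
      emeasure M {x \<in> space M. e \<le> norm (f m x - f n x)} \<le> ennreal e"
  shows "\<exists>r::nat \<Rightarrow> nat. strict_mono r \<and> (AE x in M. convergent (\<lambda>n. f (r n) x))"
proof -
  \<comment> \<open>Indices are picked so fast that the k-th increment exceeds 2^-k only on a set of
    measure at most 2^-k; Borel-Cantelli then makes the increments summable almost everywhere. Only
    these exceptional sets have to be small, so the argument covers \<Delta>, whose total mass may
    be infinite.\<close>
  have "\<exists>N. \<forall>m\<ge>N. \<forall>n\<ge>N.
      emeasure M {x \<in> space M. (1/2)^k \<le> norm (f m x - f n x)} \<le> ennreal ((1/2)^k)" for k :: nat
    by (rule Cauchy) simp
  then obtain N where N: "\<And>k m n. m \<ge> N k \<Longrightarrow> n \<ge> N k \<Longrightarrow>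
      emeasure M {x \<in> space M. (1/2)^k \<le> norm (f m x - f n x)} \<le> ennreal ((1/2)^k)"
    by metis
  \<comment> \<open>The partial sum dominates every earlier threshold \<open>N i\<close>, and the
    summand \<open>k\<close> makes \<open>s\<close> strictly increasing.\<close>
  define s where "s k = (\<Sum>i\<le>k. N i) + k" for k
  have s_mono: "strict_mono s"
    by (rule strict_monoI_Suc) (simp add: s_def)
  have s_ge: "s m \<ge> N k" if "k \<le> m" for k m
  proof -
    have "N k \<le> (\<Sum>i\<le>m. N i)"
      using that by (intro member_le_sum) auto
    then show ?thesis by (simp add: s_def)
  qed
  define A where "A k = {x \<in> space M. (1/2)^k \<le> norm (f (s (Suc k)) x - f (s k) x)}" for k
  have [measurable]: "A k \<in> sets M" for k
    unfolding A_def by measurable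
  have A_le: "emeasure M (A k) \<le> ennreal ((1/2)^k)" for k
    unfolding A_def by (intro N s_ge) auto
  have A_fin: "emeasure M (A k) < \<infinity>" for k
    using A_le[of k] by (rule order_le_less_trans) simp
  have "summable (\<lambda>k. measure M (A k))"
  proof (rule summable_comparison_test)
    show "\<exists>N. \<forall>n\<ge>N. norm (measure M (A n)) \<le> (1/2)^n"
      using A_le by (auto simp: measure_def intro!: enn2real_leI)
    show "summable (\<lambda>n. (1/2::real)^n)"
      by (rule summable_geometric) simp
  qed
  from borel_cantelli_AE1[OF _ A_fin this]
  have "AE x in M. eventually (\<lambda>n. x \<in> space M - A n) sequentially"
    by simp
  then have "AE x in M. convergent (\<lambda>n. f (s n) x)"
  proof eventually_elim
    case (elim x)
    have "summable (\<lambda>k. f (s (Suc k)) x - f (s k) x)"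
    proof (rule summable_comparison_test_ev)
      show "\<forall>\<^sub>F n in sequentially. norm (f (s (Suc n)) x - f (s n) x) \<le> (1/2)^n"
        using elim by eventually_elim (auto simp: A_def)
      show "summable (\<lambda>n. (1/2::real)^n)"
        by (rule summable_geometric) simp
    qed
    then have "(\<lambda>n. \<Sum>k<n. f (s (Suc k)) x - f (s k) x) \<longlonglongrightarrow> (\<Sum>k. f (s (Suc k)) x - f (s k) x)"
      by (rule summable_LIMSEQ)
    then have "(\<lambda>n. f (s n) x - f (s 0) x) \<longlonglongrightarrow> (\<Sum>k. f (s (Suc k)) x - f (s k) x)"
      by (simp only: sum_lessThan_telescope[of "\<lambda>k. f (s k) x"])
    from tendsto_add[OF this tendsto_const[of "f (s 0) x"]]
    show ?case
      by (auto simp: convergent_def)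
  qed
  with s_mono show ?thesis by blast
qed

text \<open>Fatou's lemma with a bound that varies with \<open>n\<close>. It transports quantitative
  estimates to pointwise limits, where no dominating function is at hand.\<close>

lemma nn_integral_le_of_AE_tendsto:
  fixes u :: "nat \<Rightarrow> 'a \<Rightarrow> ennreal"
  assumes [measurable]: "\<And>n. u n \<in> borel_measurable M"
    and lim: "AE x in M. (\<lambda>n. u n x) \<longlonglongrightarrow> v x"
    and bound: "\<forall>\<^sub>F n in sequentially. (\<integral>\<^sup>+x. u n x \<partial>M) \<le> c n" and c: "c \<longlonglongrightarrow> C"
  shows "(\<integral>\<^sup>+x. v x \<partial>M) \<le> C"
proof -
  have "(\<integral>\<^sup>+x. v x \<partial>M) = (\<integral>\<^sup>+x. liminf (\<lambda>n. u n x) \<partial>M)"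
    using lim by (intro nn_integral_cong_AE, eventually_elim) (simp add: lim_imp_Liminf)
  also have "\<dots> \<le> liminf (\<lambda>n. \<integral>\<^sup>+x. u n x \<partial>M)"
    by (rule nn_integral_liminf) simp
  also have "\<dots> \<le> liminf c"
    by (rule Liminf_mono[OF bound])
  also have "\<dots> = C"
    by (simp add: lim_imp_Liminf c)
  finally show ?thesis .
qed

lemma borel_measurable_cnj[measurable]: "cnj \<in> borel_measurable borel"
  by (intro borel_measurable_continuous_onI continuous_intros)

section \<open>Calculus of square-integrable functions\<close>

definition L2_fun :: "'a measure \<Rightarrow> ('a \<Rightarrow> 'b::real_normed_vector) \<Rightarrow> bool" where
  "L2_fun M f \<longleftrightarrow> f \<in> borel_measurable M \<and> integrable M (\<lambda>x. (norm (f x))\<^sup>2)"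

text \<open>Stated with the nonnegative integral because the Bochner integral of a non-integrable
  function is 0, which could fake convergence. The form also agrees with
  \<open>has_wiener_integral\<close> and \<open>L2_extension\<close>.\<close>

definition L2_tendsto ::
    "'a measure \<Rightarrow> (nat \<Rightarrow> 'a \<Rightarrow> 'b::real_normed_vector) \<Rightarrow> ('a \<Rightarrow> 'b) \<Rightarrow> bool" where
  "L2_tendsto M f g \<longleftrightarrow> (\<lambda>n. \<integral>\<^sup>+x. ennreal ((norm (f n x - g x))\<^sup>2) \<partial>M) \<longlonglongrightarrow> 0"

lemma norm_add_sq_le: "(norm (a + b))\<^sup>2 \<le> 2 * (norm a)\<^sup>2 + 2 * (norm (b::'a::real_normed_vector))\<^sup>2"
proof -
  have "(norm (a + b))\<^sup>2 \<le> (norm a + norm b)\<^sup>2"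
    by (rule power_mono[OF norm_triangle_ineq]) simp
  moreover have "0 \<le> (norm a - norm b)\<^sup>2" by simp
  ultimately show ?thesis by (simp add: power2_eq_square algebra_simps)
qed

lemma norm_diff_sq_le: "(norm (a - b))\<^sup>2 \<le> 2 * (norm a)\<^sup>2 + 2 * (norm (b::'a::real_normed_vector))\<^sup>2"
  using norm_add_sq_le[of a "- b"] by simp

text \<open>Stands in for Minkowski's inequality; the factor 2 is harmless, as only finiteness,
  Cauchy estimates and convergence to 0 are drawn from it.\<close>

lemma nn_integral_norm_diff_sq_le:
  fixes f g k :: "'a \<Rightarrow> 'b::{real_normed_vector, second_countable_topology}"
  assumes [measurable]: "f \<in> borel_measurable M" "g \<in> borel_measurable M" "k \<in> borel_measurable M"
  shows "(\<integral>\<^sup>+x. ennreal ((norm (f x - k x))\<^sup>2) \<partial>M) \<le>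
    2 * (\<integral>\<^sup>+x. ennreal ((norm (f x - g x))\<^sup>2) \<partial>M) + 2 * (\<integral>\<^sup>+x. ennreal ((norm (g x - k x))\<^sup>2) \<partial>M)"
proof -
  have "(\<integral>\<^sup>+x. ennreal ((norm (f x - k x))\<^sup>2) \<partial>M) \<le>
      (\<integral>\<^sup>+x. 2 * ennreal ((norm (f x - g x))\<^sup>2) + 2 * ennreal ((norm (g x - k x))\<^sup>2) \<partial>M)"
  proof (rule nn_integral_mono)
    fix x
    have "ennreal ((norm (f x - k x))\<^sup>2) \<le> ennreal (2 * (norm (f x - g x))\<^sup>2 + 2 * (norm (g x - k x))\<^sup>2)"
      using norm_add_sq_le[of "f x - g x" "g x - k x"] by (intro ennreal_leI) simp
    then show "ennreal ((norm (f x - k x))\<^sup>2) \<le>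
        2 * ennreal ((norm (f x - g x))\<^sup>2) + 2 * ennreal ((norm (g x - k x))\<^sup>2)"
      by (simp add: ennreal_mult)
  qed
  also have "\<dots> = 2 * (\<integral>\<^sup>+x. ennreal ((norm (f x - g x))\<^sup>2) \<partial>M) +
      2 * (\<integral>\<^sup>+x. ennreal ((norm (g x - k x))\<^sup>2) \<partial>M)"
    by (simp add: nn_integral_add nn_integral_cmult)
  finally show ?thesis .
qed

lemma emeasure_norm_ge_le:
  fixes f :: "'a \<Rightarrow> 'b::{real_normed_vector, second_countable_topology}"
  assumes [measurable]: "f \<in> borel_measurable M" and e: "0 < e"
  shows "emeasure M {x \<in> space M. e \<le> norm (f x)} \<le>
    ennreal (1/e\<^sup>2) * (\<integral>\<^sup>+x. ennreal ((norm (f x))\<^sup>2) \<partial>M)"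
proof -
  have "{x \<in> space M. e \<le> norm (f x)} =
      {x \<in> space M. 1 \<le> ennreal (1/e\<^sup>2) * ennreal ((norm (f x))\<^sup>2)}"
    using e by (auto simp: ennreal_mult[symmetric] field_simps power_mono
      simp flip: ennreal_1 intro: power2_le_imp_le)
  then have "emeasure M {x \<in> space M. e \<le> norm (f x)} \<le>
      ennreal (1/e\<^sup>2) * (\<integral>\<^sup>+x. ennreal ((norm (f x))\<^sup>2) * indicator (space M) x \<partial>M)"
    by (simp only:) (intro nn_integral_Markov_inequality, measurable)
  then show ?thesis
    by (simp add: nn_integral_set_ennreal)
qed

context
  fixes M :: "'a measure"
begin

lemma L2_funI:
  fixes f :: "'a \<Rightarrow> 'b::{real_normed_vector, second_countable_topology}"
  assumes "f \<in> borel_measurable M" "(\<integral>\<^sup>+x. ennreal ((norm (f x))\<^sup>2) \<partial>M) < \<infinity>"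
  shows "L2_fun M f"
  using assms by (auto simp: L2_fun_def intro!: integrableI_nonneg)

lemma L2_fun_measurable[measurable_dest]: "L2_fun M f \<Longrightarrow> f \<in> borel_measurable M"
  by (simp add: L2_fun_def)

lemma L2_fun_nn_integral:
  "L2_fun M f \<Longrightarrow>
    (\<integral>\<^sup>+x. ennreal ((norm (f x))\<^sup>2) \<partial>M) = ennreal (\<integral>x. (norm (f x))\<^sup>2 \<partial>M)"
  by (intro nn_integral_eq_integral) (auto simp: L2_fun_def)

lemma L2_fun_diff:
  fixes f g :: "'a \<Rightarrow> 'b::{real_normed_vector, second_countable_topology}"
  assumes "L2_fun M f" "L2_fun M g"
  shows "L2_fun M (\<lambda>x. f x - g x)"
  unfolding L2_fun_def
proof
  note [measurable] = L2_fun_measurable[OF assms(1)] L2_fun_measurable[OF assms(2)]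
  show "(\<lambda>x. f x - g x) \<in> borel_measurable M" by measurable
  show "integrable M (\<lambda>x. (norm (f x - g x))\<^sup>2)"
  proof (rule Bochner_Integration.integrable_bound)
    show "integrable M (\<lambda>x. 2 * (norm (f x))\<^sup>2 + 2 * (norm (g x))\<^sup>2)"
      using assms by (auto simp: L2_fun_def)
    show "AE x in M. norm ((norm (f x - g x))\<^sup>2) \<le> norm (2 * (norm (f x))\<^sup>2 + 2 * (norm (g x))\<^sup>2)"
      using norm_diff_sq_le by (intro AE_I2) (auto simp: abs_of_nonneg)
  qed measurable
qed

lemma L2_fun_cmult: "L2_fun M f \<Longrightarrow> L2_fun M (\<lambda>x. c * f x)" for c :: complex
  by (auto simp: L2_fun_def norm_mult power_mult_distrib)

lemma L2_fun_add: "L2_fun M f \<Longrightarrow> L2_fun M g \<Longrightarrow> L2_fun M (\<lambda>x. f x + g x)"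
  for f g :: "'a \<Rightarrow> complex"
  using L2_fun_diff[OF _ L2_fun_cmult[of g "-1"], of f] by simp

lemma L2_fun_zero: "L2_fun M (\<lambda>x. 0)"
  by (simp add: L2_fun_def)

lemma L2_fun_sum:
  assumes "\<And>i. i \<in> I \<Longrightarrow> L2_fun M (f i)"
  shows "L2_fun M (\<lambda>x. \<Sum>i\<in>I. f i x :: complex)"
  using assms
  by (induction I rule: infinite_finite_induct) (auto intro: L2_fun_add L2_fun_zero)

lemma L2_fun_inner_integrable:
  fixes f g :: "'a \<Rightarrow> complex"
  assumes "L2_fun M f" "L2_fun M g"
  shows "integrable M (\<lambda>x. f x * cnj (g x))"
proof (rule Bochner_Integration.integrable_bound)
  note [measurable] = L2_fun_measurable[OF assms(1)] L2_fun_measurable[OF assms(2)]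
  show "integrable M (\<lambda>x. (norm (f x))\<^sup>2 + (norm (g x))\<^sup>2)"
    using assms by (auto simp: L2_fun_def)
  show "(\<lambda>x. f x * cnj (g x)) \<in> borel_measurable M" by measurable
  have "norm a * norm b \<le> (norm a)\<^sup>2 + (norm b)\<^sup>2" for a b :: complex
  proof -
    have "0 \<le> (norm a - norm b)\<^sup>2" by simp
    then have "2 * (norm a * norm b) \<le> (norm a)\<^sup>2 + (norm b)\<^sup>2"
      by (simp add: power2_diff)
    moreover have "0 \<le> norm a * norm b" by simp
    ultimately show ?thesis by linarith
  qed
  then show "AE x in M. norm (f x * cnj (g x)) \<le> norm ((norm (f x))\<^sup>2 + (norm (g x))\<^sup>2)"
    by (intro AE_I2) (simp add: norm_mult abs_of_nonneg)
qed

lemma norm_L2_inner_le: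
  fixes f g :: "'a \<Rightarrow> complex"
  assumes "L2_fun M f" "L2_fun M g"
  shows "cmod (\<integral>x. f x * cnj (g x) \<partial>M) \<le>
    sqrt (\<integral>x. (cmod (f x))\<^sup>2 \<partial>M) * sqrt (\<integral>x. (cmod (g x))\<^sup>2 \<partial>M)"
proof -
  note [measurable] = L2_fun_measurable[OF assms(1)] L2_fun_measurable[OF assms(2)]
  define c where "c = (\<integral>x. cmod (f x) * cmod (g x) \<partial>M)"
  have int: "integrable M (\<lambda>x. cmod (f x) * cmod (g x))"
    using integrable_norm[OF L2_fun_inner_integrable[OF assms]] by (simp add: norm_mult)
  have c0: "0 \<le> c" unfolding c_def by simp
  have "cmod (\<integral>x. f x * cnj (g x) \<partial>M) \<le> c"
    unfolding c_def using integral_norm_bound[of M "\<lambda>x. f x * cnj (g x)"] by (simp add: norm_mult)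
  also have "c \<le> sqrt ((\<integral>x. (cmod (f x))\<^sup>2 \<partial>M) * (\<integral>x. (cmod (g x))\<^sup>2 \<partial>M))"
  proof (rule real_le_rsqrt)
    have "(\<integral>\<^sup>+x. ennreal (cmod (f x)) * ennreal (cmod (g x)) \<partial>M)\<^sup>2 \<le>
        (\<integral>\<^sup>+x. (ennreal (cmod (f x)))\<^sup>2 \<partial>M) * (\<integral>\<^sup>+x. (ennreal (cmod (g x)))\<^sup>2 \<partial>M)"
      by (rule Cauchy_Schwarz_nn_integral) measurable
    moreover have "(\<integral>\<^sup>+x. ennreal (cmod (f x)) * ennreal (cmod (g x)) \<partial>M) = ennreal c"
      unfolding c_def
      by (subst nn_integral_eq_integral[OF int, symmetric]) (auto simp: ennreal_mult)
    ultimately have "ennreal (c\<^sup>2) \<le>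
        ennreal ((\<integral>x. (cmod (f x))\<^sup>2 \<partial>M) * (\<integral>x. (cmod (g x))\<^sup>2 \<partial>M))"
      using c0 assms by (simp add: ennreal_power L2_fun_nn_integral ennreal_mult)
    then show "c\<^sup>2 \<le> (\<integral>x. (cmod (f x))\<^sup>2 \<partial>M) * (\<integral>x. (cmod (g x))\<^sup>2 \<partial>M)"
      by (subst (asm) ennreal_le_iff) auto
  qed
  finally show ?thesis by (simp add: real_sqrt_mult)
qed

lemma L2_tendsto_integral:
  fixes f :: "nat \<Rightarrow> 'a \<Rightarrow> 'b::{real_normed_vector, second_countable_topology}"
  assumes "\<And>n. L2_fun M (f n)" "L2_fun M g" "L2_tendsto M f g"
  shows "(\<lambda>n. \<integral>x. (norm (f n x - g x))\<^sup>2 \<partial>M) \<longlonglongrightarrow> 0"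
  using assms(3) L2_fun_nn_integral[OF L2_fun_diff[OF assms(1) assms(2)]]
    tendsto_ennreal_iff[of "\<lambda>n. \<integral>x. (norm (f n x - g x))\<^sup>2 \<partial>M" sequentially 0]
  by (simp add: L2_tendsto_def)

text \<open>A single \<open>f n\<close> at squared distance below 1 from \<open>g\<close> suffices:
  both \<open>g - f n\<close> and \<open>f n\<close> then have finite second moment.\<close>

lemma L2_fun_limit:
  fixes f :: "nat \<Rightarrow> 'a \<Rightarrow> 'b::{real_normed_vector, second_countable_topology}"
  assumes f: "\<And>n. L2_fun M (f n)" and [measurable]: "g \<in> borel_measurable M"
    and lim: "L2_tendsto M f g"
  shows "L2_fun M g"
proof (rule L2_funI)
  note [measurable] = L2_fun_measurable[OF f]
  have "\<forall>\<^sub>F n in sequentially. (\<integral>\<^sup>+x. ennreal ((norm (f n x - g x))\<^sup>2) \<partial>M) < 1"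
    using lim unfolding L2_tendsto_def by (rule order_tendstoD(2)) simp
  then obtain n where n: "(\<integral>\<^sup>+x. ennreal ((norm (f n x - g x))\<^sup>2) \<partial>M) < 1"
    using eventually_happens'[OF sequentially_bot] by blast
  have "(\<integral>\<^sup>+x. ennreal ((norm (g x - 0))\<^sup>2) \<partial>M) \<le>
      2 * (\<integral>\<^sup>+x. ennreal ((norm (g x - f n x))\<^sup>2) \<partial>M) + 2 * (\<integral>\<^sup>+x. ennreal ((norm (f n x - 0))\<^sup>2) \<partial>M)"
    by (rule nn_integral_norm_diff_sq_le) measurable
  also have "\<dots> < \<infinity>"
    using n L2_fun_nn_integral[OF f, of n]
    by (simp add: norm_minus_commute ennreal_mult_less_top less_top[symmetric] ennreal_add_eq_top ennreal_mult_eq_top_iff)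
       (metis ennreal_one_less_top order_less_trans less_irrefl)
  finally show "(\<integral>\<^sup>+x. ennreal ((norm (g x))\<^sup>2) \<partial>M) < \<infinity>" by simp
qed measurable

lemma L2_tendsto_inner:
  fixes f g :: "nat \<Rightarrow> 'a \<Rightarrow> complex"
  assumes f: "\<And>n. L2_fun M (f n)" "L2_fun M f'" "L2_tendsto M f f'"
    and g: "\<And>n. L2_fun M (g n)" "L2_fun M g'" "L2_tendsto M g g'"
  shows "(\<lambda>n. \<integral>x. f n x * cnj (g n x) \<partial>M) \<longlonglongrightarrow> (\<integral>x. f' x * cnj (g' x) \<partial>M)"
proof -
  define a where "a n = sqrt (\<integral>x. (cmod (f n x - f' x))\<^sup>2 \<partial>M)" for n
  define b where "b n = sqrt (\<integral>x. (cmod (g n x - g' x))\<^sup>2 \<partial>M)" for n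
  define F where "F = sqrt (\<integral>x. (cmod (f' x))\<^sup>2 \<partial>M)"
  define G where "G = sqrt (\<integral>x. (cmod (g' x))\<^sup>2 \<partial>M)"
  have a: "a \<longlonglongrightarrow> 0"
    unfolding a_def using tendsto_real_sqrt[OF L2_tendsto_integral[OF f]] by simp
  have b: "b \<longlonglongrightarrow> 0"
    unfolding b_def using tendsto_real_sqrt[OF L2_tendsto_integral[OF g]] by simp
  note df = L2_fun_diff[OF f(1) f(2)] and dg = L2_fun_diff[OF g(1) g(2)]
  have "(\<lambda>n. (\<integral>x. f n x * cnj (g n x) \<partial>M) - (\<integral>x. f' x * cnj (g' x) \<partial>M)) \<longlonglongrightarrow> 0"
  proof (rule Lim_null_comparison)
    show "\<forall>\<^sub>F n in sequentially.
        norm ((\<integral>x. f n x * cnj (g n x) \<partial>M) - (\<integral>x. f' x * cnj (g' x) \<partial>M)) \<le> a n * b n + a n * G + F * b n"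
    proof (rule always_eventually, rule allI)
      fix n
      \<comment> \<open>Expanding around the limits leaves three terms, each with at least one
        factor that tends to 0 in quadratic mean.\<close>
      have "f n x * cnj (g n x) - f' x * cnj (g' x) =
          (f n x - f' x) * cnj (g n x - g' x) + (f n x - f' x) * cnj (g' x) + f' x * cnj (g n x - g' x)" for x
        by (simp add: algebra_simps)
      then have "(\<integral>x. f n x * cnj (g n x) \<partial>M) - (\<integral>x. f' x * cnj (g' x) \<partial>M) =
          (\<integral>x. (f n x - f' x) * cnj (g n x - g' x) \<partial>M) + (\<integral>x. (f n x - f' x) * cnj (g' x) \<partial>M)
          + (\<integral>x. f' x * cnj (g n x - g' x) \<partial>M)"
        using L2_fun_inner_integrable[OF df[of n] dg[of n]] L2_fun_inner_integrable[OF df[of n] g(2)]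
          L2_fun_inner_integrable[OF f(2) dg[of n]]
          L2_fun_inner_integrable[OF f(1)[of n] g(1)[of n]] L2_fun_inner_integrable[OF f(2) g(2)]
        by (simp flip: Bochner_Integration.integral_diff Bochner_Integration.integral_add)
      then have "norm ((\<integral>x. f n x * cnj (g n x) \<partial>M) - (\<integral>x. f' x * cnj (g' x) \<partial>M)) \<le>
          cmod (\<integral>x. (f n x - f' x) * cnj (g n x - g' x) \<partial>M) + cmod (\<integral>x. (f n x - f' x) * cnj (g' x) \<partial>M)
          + cmod (\<integral>x. f' x * cnj (g n x - g' x) \<partial>M)"
        by (simp only:) (intro order_trans[OF norm_triangle_ineq] add_right_mono norm_triangle_ineq)
      also have "\<dots> \<le> a n * b n + a n * G + F * b n"
        unfolding a_def b_def F_def G_def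
        by (intro add_mono norm_L2_inner_le df dg f(2) g(2))
      finally show "norm ((\<integral>x. f n x * cnj (g n x) \<partial>M) - (\<integral>x. f' x * cnj (g' x) \<partial>M)) \<le>
          a n * b n + a n * G + F * b n" .
    qed
    show "(\<lambda>n. a n * b n + a n * G + F * b n) \<longlonglongrightarrow> 0"
      by (rule tendsto_eq_intros a b | simp)+
  qed
  then show ?thesis by (simp add: LIM_zero_iff)
qed

lemma L2_norm_diff_expand:
  fixes f g :: "'a \<Rightarrow> complex"
  assumes f: "L2_fun M f" and g: "L2_fun M g"
  shows "(\<integral>x. (cmod (f x - g x))\<^sup>2 \<partial>M) = Re (\<integral>x. f x * cnj (f x) \<partial>M) + Re (\<integral>x. g x * cnj (g x) \<partial>M)
    - 2 * Re (\<integral>x. f x * cnj (g x) \<partial>M)"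
proof -
  have eq: "(cmod (f x - g x))\<^sup>2 = Re (f x * cnj (f x)) + Re (g x * cnj (g x)) - 2 * Re (f x * cnj (g x))" for x
    unfolding cmod_power2 by (simp add: power2_eq_square algebra_simps)
  have "(\<integral>x. (cmod (f x - g x))\<^sup>2 \<partial>M) =
      (\<integral>x. Re (f x * cnj (f x)) \<partial>M) + (\<integral>x. Re (g x * cnj (g x)) \<partial>M)
      - 2 * (\<integral>x. Re (f x * cnj (g x)) \<partial>M)"
    unfolding eq
    by (subst Bochner_Integration.integral_diff Bochner_Integration.integral_add integral_mult_right_zero;
        (intro integrable_mult_right Bochner_Integration.integrable_add integrable_Re
          L2_fun_inner_integrable f g)?)+ (rule refl)
  then show ?thesis
    using L2_fun_inner_integrable[OF f f] L2_fun_inner_integrable[OF g g] L2_fun_inner_integrable[OF f g]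
    by (simp only: integral_Re)
qed

lemma L2_tendsto_cmult:
  fixes f :: "nat \<Rightarrow> 'a \<Rightarrow> complex"
  assumes [measurable]: "\<And>n. f n \<in> borel_measurable M" "g \<in> borel_measurable M"
    and lim: "L2_tendsto M f g"
  shows "L2_tendsto M (\<lambda>n x. c * f n x) (\<lambda>x. c * g x)"
proof -
  have "(\<integral>\<^sup>+x. ennreal ((cmod (c * f n x - c * g x))\<^sup>2) \<partial>M) =
      ennreal ((cmod c)\<^sup>2) * (\<integral>\<^sup>+x. ennreal ((cmod (f n x - g x))\<^sup>2) \<partial>M)" for n
    by (simp add: norm_mult power_mult_distrib ennreal_mult nn_integral_cmult flip: right_diff_distrib)
  then show ?thesis
    using ennreal_tendsto_cmult[OF _ lim[unfolded L2_tendsto_def], of "ennreal ((cmod c)\<^sup>2)"]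
    by (simp add: L2_tendsto_def)
qed

lemma L2_tendsto_add:
  fixes f g :: "nat \<Rightarrow> 'a \<Rightarrow> complex"
  assumes [measurable]: "\<And>n. f n \<in> borel_measurable M" "f' \<in> borel_measurable M"
      "\<And>n. g n \<in> borel_measurable M" "g' \<in> borel_measurable M"
    and lim: "L2_tendsto M f f'" "L2_tendsto M g g'"
  shows "L2_tendsto M (\<lambda>n x. f n x + g n x) (\<lambda>x. f' x + g' x)"
  unfolding L2_tendsto_def
proof (rule tendsto_sandwich[OF _ _ tendsto_const])
  show "(\<lambda>n. 2 * (\<integral>\<^sup>+x. ennreal ((cmod (f n x - f' x))\<^sup>2) \<partial>M) +
      2 * (\<integral>\<^sup>+x. ennreal ((cmod (g n x - g' x))\<^sup>2) \<partial>M)) \<longlonglongrightarrow> 0"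
    using tendsto_add[OF ennreal_tendsto_cmult[OF _ lim(1)[unfolded L2_tendsto_def], of 2]
        ennreal_tendsto_cmult[OF _ lim(2)[unfolded L2_tendsto_def], of 2]]
    by simp
  show "\<forall>\<^sub>F n in sequentially. (\<integral>\<^sup>+x. ennreal ((cmod (f n x + g n x - (f' x + g' x)))\<^sup>2) \<partial>M) \<le>
      2 * (\<integral>\<^sup>+x. ennreal ((cmod (f n x - f' x))\<^sup>2) \<partial>M) + 2 * (\<integral>\<^sup>+x. ennreal ((cmod (g n x - g' x))\<^sup>2) \<partial>M)"
  proof (rule always_eventually, rule allI)
    fix n
    show "(\<integral>\<^sup>+x. ennreal ((cmod (f n x + g n x - (f' x + g' x)))\<^sup>2) \<partial>M) \<le>
      2 * (\<integral>\<^sup>+x. ennreal ((cmod (f n x - f' x))\<^sup>2) \<partial>M) + 2 * (\<integral>\<^sup>+x. ennreal ((cmod (g n x - g' x))\<^sup>2) \<partial>M)"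
      \<comment> \<open>The intermediate function \<open>f' + g n\<close> differs from the two ends
        by exactly \<open>f n - f'\<close> and \<open>g n - g'\<close>.\<close>
      using nn_integral_norm_diff_sq_le[of "\<lambda>x. f n x + g n x" M "\<lambda>x. f' x + g n x" "\<lambda>x. f' x + g' x"]
      by simp
  qed
qed simp

text \<open>Riesz-Fischer for functions instead of classes: a subsequence converges almost
  everywhere, and Fatou's lemma in the second index of the Cauchy estimate brings the whole sequence
  to that limit.\<close>

lemma L2_complete:
  fixes f :: "nat \<Rightarrow> 'a \<Rightarrow> 'b::{banach, second_countable_topology}"
  assumes [measurable]: "\<And>n. f n \<in> borel_measurable M"
    and Cauchy: "\<And>e. e > 0 \<Longrightarrow> \<exists>N. \<forall>m\<ge>N. \<forall>n\<ge>N.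
      (\<integral>\<^sup>+x. ennreal ((norm (f m x - f n x))\<^sup>2) \<partial>M) \<le> ennreal e"
  shows "\<exists>g\<in>borel_measurable M. L2_tendsto M f g"
proof -
  have "\<exists>r::nat \<Rightarrow> nat. strict_mono r \<and> (AE x in M. convergent (\<lambda>n. f (r n) x))"
  proof (rule Cauchy_in_measure_AE_convergent)
    fix e :: real assume e: "e > 0"
    \<comment> \<open>By Chebyshev, a squared distance of \<open>e^3\<close> leaves measure at most
      \<open>e^3 / e^2 = e\<close> for deviations of size \<open>e\<close>.\<close>
    then obtain N where N: "\<And>m n. m \<ge> N \<Longrightarrow> n \<ge> N \<Longrightarrow>
        (\<integral>\<^sup>+x. ennreal ((norm (f m x - f n x))\<^sup>2) \<partial>M) \<le> ennreal (e^3)"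
      using Cauchy[of "e^3"] by auto
    show "\<exists>N. \<forall>m\<ge>N. \<forall>n\<ge>N. emeasure M {x \<in> space M. e \<le> norm (f m x - f n x)} \<le> ennreal e"
    proof (intro exI allI impI)
      fix m n assume mn: "m \<ge> N" "n \<ge> N"
      have "emeasure M {x \<in> space M. e \<le> norm (f m x - f n x)} \<le>
          ennreal (1/e\<^sup>2) * (\<integral>\<^sup>+x. ennreal ((norm (f m x - f n x))\<^sup>2) \<partial>M)"
        by (rule emeasure_norm_ge_le) (use e in auto)
      also have "\<dots> \<le> ennreal (1/e\<^sup>2) * ennreal (e^3)"
        using N[OF mn] by (intro mult_left_mono) auto
      also have "\<dots> = ennreal e"
        using e by (simp add: ennreal_mult[symmetric] power2_eq_square power3_eq_cube)
      finally show "emeasure M {x \<in> space M. e \<le> norm (f m x - f n x)} \<le> ennreal e" .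
    qed
  qed measurable
  then obtain r :: "nat \<Rightarrow> nat" where r: "strict_mono r" "AE x in M. convergent (\<lambda>n. f (r n) x)"
    by blast
  \<comment> \<open>Where the subsequence diverges, \<open>lim\<close> is an unspecified value; this
    concerns a null set only, and \<open>g\<close> is measurable all the same.\<close>
  define g where "g x = lim (\<lambda>n. f (r n) x)" for x
  have [measurable]: "g \<in> borel_measurable M"
    unfolding g_def by measurable
  have "L2_tendsto M f g"
    unfolding L2_tendsto_def
  proof (rule order_tendstoI)
    fix a :: ennreal assume "0 < a"
    then obtain b where b: "0 < b" "b < a" using dense by blast
    define e where "e = enn2real b"
    have "b < top" using b(2) by (rule less_le_trans) simp
    then have e: "0 < e" "ennreal e < a"
      using b by (auto simp: e_def enn2real_positive_iff)
    obtain N where N: "\<And>m n. m \<ge> N \<Longrightarrow> n \<ge> N \<Longrightarrow>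
        (\<integral>\<^sup>+x. ennreal ((norm (f m x - f n x))\<^sup>2) \<partial>M) \<le> ennreal e"
      using Cauchy[OF e(1)] by auto
    have "(\<integral>\<^sup>+x. ennreal ((norm (f m x - g x))\<^sup>2) \<partial>M) \<le> ennreal e" if m: "m \<ge> N" for m
    proof (rule nn_integral_le_of_AE_tendsto)
      show "AE x in M. (\<lambda>n. ennreal ((norm (f m x - f (r n) x))\<^sup>2)) \<longlonglongrightarrow> ennreal ((norm (f m x - g x))\<^sup>2)"
        using r(2) unfolding g_def convergent_LIMSEQ_iff
        by eventually_elim (intro tendsto_ennrealI tendsto_intros)
      show "\<forall>\<^sub>F n in sequentially. (\<integral>\<^sup>+x. ennreal ((norm (f m x - f (r n) x))\<^sup>2) \<partial>M) \<le> ennreal e"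
        using eventually_ge_at_top[of N] by eventually_elim (metis N m r(1) seq_suble order_trans)
    qed auto
    then show "\<forall>\<^sub>F n in sequentially. (\<integral>\<^sup>+x. ennreal ((norm (f n x - g x))\<^sup>2) \<partial>M) < a"
      using e(2) by (auto simp: eventually_sequentially intro: order_le_less_trans)
  qed simp
  then show ?thesis by auto
qed

end

lemma L2_tendsto_trans:
  fixes f g :: "nat \<Rightarrow> 'a \<Rightarrow> 'b::{real_normed_vector, second_countable_topology}"
  assumes [measurable]: "\<And>n. f n \<in> borel_measurable M" "\<And>n. g n \<in> borel_measurable M"
      "f' \<in> borel_measurable M"
    and g: "(\<lambda>n. \<integral>\<^sup>+x. ennreal ((norm (g n x - f n x))\<^sup>2) \<partial>M) \<longlonglongrightarrow> 0"
    and f: "L2_tendsto M f f'"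
  shows "L2_tendsto M g f'"
  unfolding L2_tendsto_def
proof (rule tendsto_sandwich[OF _ _ tendsto_const])
  show "(\<lambda>n. 2 * (\<integral>\<^sup>+x. ennreal ((norm (g n x - f n x))\<^sup>2) \<partial>M) +
      2 * (\<integral>\<^sup>+x. ennreal ((norm (f n x - f' x))\<^sup>2) \<partial>M)) \<longlonglongrightarrow> 0"
    using tendsto_add[OF ennreal_tendsto_cmult[OF _ g, of 2]
        ennreal_tendsto_cmult[OF _ f[unfolded L2_tendsto_def], of 2]]
    by simp
qed (auto intro!: always_eventually nn_integral_norm_diff_sq_le)

lemma L2_tendsto_Cauchy:
  fixes f :: "nat \<Rightarrow> 'a \<Rightarrow> 'b::{real_normed_vector, second_countable_topology}"
  assumes [measurable]: "\<And>n. f n \<in> borel_measurable M" "g \<in> borel_measurable M"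
    and lim: "L2_tendsto M f g" and e: "0 < e"
  shows "\<exists>N. \<forall>m\<ge>N. \<forall>n\<ge>N. (\<integral>\<^sup>+x. ennreal ((norm (f m x - f n x))\<^sup>2) \<partial>M) \<le> ennreal e"
proof -
  have "\<forall>\<^sub>F n in sequentially. (\<integral>\<^sup>+x. ennreal ((norm (f n x - g x))\<^sup>2) \<partial>M) < ennreal (e/4)"
    using lim e unfolding L2_tendsto_def by (intro order_tendstoD(2)) auto
  then obtain N where N: "\<And>n. n \<ge> N \<Longrightarrow> (\<integral>\<^sup>+x. ennreal ((norm (f n x - g x))\<^sup>2) \<partial>M) < ennreal (e/4)"
    by (auto simp: eventually_sequentially)
  show ?thesis
  proof (intro exI allI impI)
    fix m n assume mn: "m \<ge> N" "n \<ge> N"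
    have "(\<integral>\<^sup>+x. ennreal ((norm (f m x - f n x))\<^sup>2) \<partial>M) \<le>
        2 * (\<integral>\<^sup>+x. ennreal ((norm (f m x - g x))\<^sup>2) \<partial>M) + 2 * (\<integral>\<^sup>+x. ennreal ((norm (g x - f n x))\<^sup>2) \<partial>M)"
      by (rule nn_integral_norm_diff_sq_le) measurable
    also have "\<dots> \<le> 2 * ennreal (e/4) + 2 * ennreal (e/4)"
      using N[OF mn(1)] N[OF mn(2)]
      by (intro add_mono mult_left_mono) (auto simp: norm_minus_commute less_imp_le)
    also have "\<dots> = ennreal 4 * ennreal (e/4)"
      by (simp flip: distrib_right)
    also have "\<dots> = ennreal (4 * (e/4))"
      by (rule ennreal_mult[symmetric]) (use e in auto)
    also have "\<dots> = ennreal e"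
      by simp
    finally show "(\<integral>\<^sup>+x. ennreal ((norm (f m x - f n x))\<^sup>2) \<partial>M) \<le> ennreal e" .
  qed
qed

lemma L2_simple_approximation:
  fixes f :: "'a \<Rightarrow> complex"
  assumes f: "L2_fun M f"
  shows "\<exists>s. (\<forall>n. Bochner_Integration.simple_bochner_integrable M (s n)) \<and> L2_tendsto M s f"
proof -
  note [measurable] = L2_fun_measurable[OF f]
  obtain s where s: "\<And>i. simple_function M (s i)" "\<And>x. x \<in> space M \<Longrightarrow> (\<lambda>i. s i x) \<longlonglongrightarrow> f x"
      "\<And>i x. x \<in> space M \<Longrightarrow> cmod (s i x) \<le> 2 * cmod (f x)"
    using borel_measurable_implies_sequence_metric[of f M 0] f by (simp add: L2_fun_def) blast
  have [measurable]: "s i \<in> borel_measurable M" for i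
    using s(1) by (rule borel_measurable_simple_function)
  have fin: "(\<integral>\<^sup>+x. ennreal (k * (cmod (f x))\<^sup>2) \<partial>M) < \<infinity>" if "0 \<le> k" for k
    using that by (simp add: ennreal_mult nn_integral_cmult L2_fun_nn_integral[OF f] ennreal_mult_less_top)
  have "Bochner_Integration.simple_bochner_integrable M (s n)" for n
  proof -
    \<comment> \<open>A simple function with finite second moment vanishes outside a set of finite
      measure, which is what \<open>simple_bochner_integrable\<close> asks for. The factor 4 is the
      square of the 2 in \<open>s(3)\<close>.\<close>
    have "(\<integral>\<^sup>+x. ennreal (norm ((cmod (s n x))\<^sup>2)) \<partial>M) \<le> (\<integral>\<^sup>+x. ennreal (4 * (cmod (f x))\<^sup>2) \<partial>M)"
      using power_mono[OF s(3)[of _ n], of _ 2]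
      by (intro nn_integral_mono ennreal_leI) (simp add: power_mult_distrib)
    then have "Bochner_Integration.simple_bochner_integrable M (\<lambda>x. (cmod (s n x))\<^sup>2)"
      using fin[of 4] by (intro simple_bochner_integrableI_bounded simple_function_compose1[OF s(1)]) auto
    then have "emeasure M {x \<in> space M. (cmod (s n x))\<^sup>2 \<noteq> 0} \<noteq> \<infinity>"
      by (simp add: simple_bochner_integrable.simps)
    then show ?thesis
      using s(1) by (simp add: simple_bochner_integrable.simps)
  qed
  moreover have "L2_tendsto M s f"
    unfolding L2_tendsto_def
  proof -
    have "(\<lambda>n. \<integral>\<^sup>+x. ennreal ((norm (s n x - f x))\<^sup>2) \<partial>M) \<longlonglongrightarrow> (\<integral>\<^sup>+x. 0 \<partial>M)"
    proof (rule nn_integral_dominated_convergence)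
      \<comment> \<open>The constant is 2 * 4 + 2, from \<open>norm_diff_sq_le\<close> and
        \<open>s(3)\<close>.\<close>
      show "AE x in M. ennreal ((norm (s j x - f x))\<^sup>2) \<le> ennreal (10 * (cmod (f x))\<^sup>2)" for j
      proof (intro AE_I2 ennreal_leI)
        fix x assume x: "x \<in> space M"
        show "(norm (s j x - f x))\<^sup>2 \<le> 10 * (cmod (f x))\<^sup>2"
          using norm_diff_sq_le[of "s j x" "f x"] power_mono[OF s(3)[OF x, of j], of 2]
          by (simp add: power_mult_distrib)
      qed
      show "AE x in M. (\<lambda>i. ennreal ((norm (s i x - f x))\<^sup>2)) \<longlonglongrightarrow> 0"
      proof (rule AE_I2)
        fix x assume x: "x \<in> space M"
        have "(\<lambda>i. ennreal ((norm (s i x - f x))\<^sup>2)) \<longlonglongrightarrow> ennreal ((norm (f x - f x))\<^sup>2)"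
          by (intro tendsto_ennrealI tendsto_intros s(2) x)
        then show "(\<lambda>i. ennreal ((norm (s i x - f x))\<^sup>2)) \<longlonglongrightarrow> 0" by simp
      qed
    qed (use fin[of 10] in auto)
    then show "(\<lambda>n. \<integral>\<^sup>+x. ennreal ((norm (s n x - f x))\<^sup>2) \<partial>M) \<longlonglongrightarrow> 0" by simp
  qed
  ultimately show ?thesis by blast
qed

section \<open>Centred Gaussian laws\<close>

lemma real_distribution_density_normal:
  assumes "0 < \<sigma>"
  shows "real_distribution (density lborel (normal_density m \<sigma>))"
  using prob_space_normal_density[OF assms]
  by (simp add: real_distribution_def real_distribution_axioms_def)

lemma char_density_normal:
  assumes \<sigma>: "0 < \<sigma>"
  shows "char (density lborel (normal_density 0 \<sigma>)) t = complex_of_real (exp (- (\<sigma>\<^sup>2 * t\<^sup>2) / 2))"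
proof -
  interpret S: real_distribution std_normal_distribution
    by (rule real_dist_normal_dist)
  have "distributed std_normal_distribution lborel (\<lambda>x. x) (\<lambda>x. ennreal (std_normal_density x))"
    by (auto simp: distributed_def distr_id2)
  from S.normal_density_affine[OF this zero_less_one, of \<sigma> 0]
  have "distributed std_normal_distribution lborel (\<lambda>x. \<sigma> * x) (\<lambda>x. ennreal (normal_density 0 \<sigma> x))"
    using \<sigma> by simp
  then have "distr std_normal_distribution lborel (\<lambda>x. \<sigma> * x) = density lborel (normal_density 0 \<sigma>)"
    by (simp add: distributed_def)
  then have "char (density lborel (normal_density 0 \<sigma>)) t =
      (\<integral>x. iexp (t * x) \<partial>distr std_normal_distribution lborel (\<lambda>x. \<sigma> * x))"
    by (simp add: char_def)
  also have "\<dots> = (\<integral>x. iexp (t * (\<sigma> * x)) \<partial>std_normal_distribution)"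
    by (rule integral_distr) auto
  also have "\<dots> = char std_normal_distribution (\<sigma> * t)"
    by (simp add: char_def ac_simps)
  finally show ?thesis
    by (simp add: char_std_normal_distribution power_mult_distrib)
qed

lemma char_return_0: "char (return borel 0) t = 1"
  by (simp add: char_def integral_return)

text \<open>Dirac and normal laws share one formula for the characteristic function, with the second
  moment as variance. Together with the converse below it removes the case distinction from all
  later arguments.\<close>

lemma centred_gaussian_lawD:
  assumes "centred_gaussian_law N"
  shows "real_distribution N" "integrable N (\<lambda>x. x\<^sup>2)"
    "char N t = complex_of_real (exp (- ((\<integral>x. x\<^sup>2 \<partial>N) * t\<^sup>2) / 2))"
proof -
  consider "N = return borel 0" | \<sigma> where "\<sigma> > 0" "N = density lborel (normal_density 0 \<sigma>)"
    using assms unfolding centred_gaussian_law_def by blast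
  then have "real_distribution N \<and> integrable N (\<lambda>x. x\<^sup>2) \<and>
    char N t = complex_of_real (exp (- ((\<integral>x. x\<^sup>2 \<partial>N) * t\<^sup>2) / 2))"
  proof cases
    case 1
    then show ?thesis
      by (auto simp: char_return_0 integral_return real_distribution_def real_distribution_axioms_def
          intro!: prob_space_return integrableI_bounded simp: nn_integral_return)
  next
    case 2
    have "integrable N (\<lambda>x. x\<^sup>2)" "(\<integral>x. x\<^sup>2 \<partial>N) = \<sigma>\<^sup>2"
      using normal_moment_even[OF 2(1), of 0 1] 2(1)
      by (auto simp: 2(2) integrable_density integral_density has_bochner_integral_iff power2_eq_square mult_ac)
    then show ?thesis
      using real_distribution_density_normal[OF 2(1)] char_density_normal[OF 2(1)] by (simp add: 2(2))
  qed
  then show "real_distribution N" "integrable N (\<lambda>x. x\<^sup>2)"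
    "char N t = complex_of_real (exp (- ((\<integral>x. x\<^sup>2 \<partial>N) * t\<^sup>2) / 2))" by auto
qed

text \<open>Levy's uniqueness theorem. Variance 0 is split off because \<open>normal_density\<close>
  yields a law only for a positive deviation.\<close>

lemma centred_gaussian_lawI:
  assumes N: "real_distribution N" and "0 \<le> v"
    and char: "\<And>t. char N t = complex_of_real (exp (- (v * t\<^sup>2) / 2))"
  shows "centred_gaussian_law N"
proof (cases "v = 0")
  case True
  have "N = return borel 0"
  proof (rule Levy_uniqueness[OF N])
    show "real_distribution (return borel 0)"
      by (auto simp: real_distribution_def real_distribution_axioms_def intro: prob_space_return)
    show "char N = char (return borel 0)"
      by (rule ext) (simp add: char True char_return_0)
  qed
  then show ?thesis by (simp add: centred_gaussian_law_def)
next
  case False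
  with \<open>0 \<le> v\<close> have v: "0 < sqrt v" by simp
  have "N = density lborel (normal_density 0 (sqrt v))"
  proof (rule Levy_uniqueness[OF N real_distribution_density_normal[OF v]])
    show "char N = char (density lborel (normal_density 0 (sqrt v)))"
      using \<open>0 \<le> v\<close> by (intro ext) (simp add: char char_density_normal[OF v])
  qed
  then show ?thesis using v unfolding centred_gaussian_law_def by blast
qed

lemma norm_iexp_diff_le: "cmod (iexp a - iexp b) \<le> \<bar>a - b\<bar>"
proof -
  have "iexp a - iexp b = iexp b * (iexp (a - b) - 1)"
    by (simp add: algebra_simps flip: exp_add)
  moreover have "cmod (iexp (a - b) - 1) \<le> \<bar>a - b\<bar>"
    using iexp_approx1[of "a - b" 0] by simp
  ultimately show ?thesis
    by (simp add: norm_mult)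
qed

text \<open>Convergence in quadratic mean moves both the characteristic functions and the variances
  to their limits, so the limit again has a Gaussian characteristic function. Its variance may be 0,
  which is why degenerate laws must count as Gaussian.\<close>

lemma (in prob_space) centred_gaussian_law_L2_limit:
  fixes X :: "nat \<Rightarrow> 'a \<Rightarrow> complex"
  assumes X: "\<And>n. L2_fun M (X n)" and Y: "L2_fun M Y" and lim: "L2_tendsto M X Y"
    and gauss: "\<And>n. centred_gaussian_law (distr M borel (\<lambda>w. Re (X n w)))"
  shows "centred_gaussian_law (distr M borel (\<lambda>w. Re (Y w)))"
proof -
  note [measurable] = L2_fun_measurable[OF X] L2_fun_measurable[OF Y]
  \<comment> \<open>The real part is put back into the complex numbers so that the complex
    inner-product lemmas give the convergence of the variances.\<close>
  define R where "R Z = (\<lambda>w. complex_of_real (Re (Z w :: complex)))" for Z :: "'a \<Rightarrow> complex"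
  have L2R: "L2_fun M (R Z)" if Z: "L2_fun M Z" for Z
    unfolding L2_fun_def
  proof
    note [measurable] = L2_fun_measurable[OF Z]
    show "R Z \<in> borel_measurable M" unfolding R_def by measurable
    show "integrable M (\<lambda>x. (cmod (R Z x))\<^sup>2)"
    proof (rule Bochner_Integration.integrable_bound)
      show "integrable M (\<lambda>x. (cmod (Z x))\<^sup>2)" using Z by (simp add: L2_fun_def)
      show "AE x in M. norm ((cmod (R Z x))\<^sup>2) \<le> norm ((cmod (Z x))\<^sup>2)"
        by (intro AE_I2) (simp add: R_def cmod_power2)
    qed (simp add: R_def)
  qed
  have limR: "L2_tendsto M (\<lambda>n. R (X n)) (R Y)"
    unfolding L2_tendsto_def
  proof (rule tendsto_sandwich[OF _ _ tendsto_const lim[unfolded L2_tendsto_def]])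
    show "\<forall>\<^sub>F n in sequentially. (\<integral>\<^sup>+x. ennreal ((cmod (R (X n) x - R Y x))\<^sup>2) \<partial>M) \<le>
        (\<integral>\<^sup>+x. ennreal ((cmod (X n x - Y x))\<^sup>2) \<partial>M)"
      by (intro always_eventually allI nn_integral_mono ennreal_leI)
         (simp add: R_def cmod_power2 flip: of_real_diff)
  qed simp
  have sq: "(\<integral>w. R Z w * cnj (R Z w) \<partial>M) = complex_of_real (\<integral>w. (Re (Z w))\<^sup>2 \<partial>M)" for Z
    by (simp add: R_def power2_eq_square flip: of_real_mult)
  have var: "(\<lambda>n. \<integral>w. (Re (X n w))\<^sup>2 \<partial>M) \<longlonglongrightarrow> (\<integral>w. (Re (Y w))\<^sup>2 \<partial>M)"
    using L2_tendsto_inner[OF L2R[OF X] L2R[OF Y] limR L2R[OF X] L2R[OF Y] limR]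
    unfolding sq tendsto_of_real_iff .
  have "char (distr M borel (\<lambda>w. Re (Y w))) t =
      complex_of_real (exp (- ((\<integral>w. (Re (Y w))\<^sup>2 \<partial>M) * t\<^sup>2) / 2))" for t
  proof (rule LIMSEQ_unique)
    have charX: "char (distr M borel (\<lambda>w. Re (Z w))) t = (\<integral>w. iexp (t * Re (Z w)) \<partial>M)"
      if [measurable]: "Z \<in> borel_measurable M" for Z
      unfolding char_def by (subst integral_distr) auto
    have intI: "integrable M (\<lambda>w. iexp (t * Re (Z w)))" if [measurable]: "Z \<in> borel_measurable M" for Z
      by (rule integrable_iexp) measurable
    define a where "a n = sqrt (\<integral>x. (cmod (R (X n) x - R Y x))\<^sup>2 \<partial>M)" for n
    have a: "a \<longlonglongrightarrow> 0"
      unfolding a_def using tendsto_real_sqrt[OF L2_tendsto_integral[OF L2R[OF X] L2R[OF Y] limR]]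
      by simp
    have "(\<lambda>n. char (distr M borel (\<lambda>w. Re (X n w))) t - char (distr M borel (\<lambda>w. Re (Y w))) t) \<longlonglongrightarrow> 0"
    proof (rule Lim_null_comparison)
      show "\<forall>\<^sub>F n in sequentially. cmod (char (distr M borel (\<lambda>w. Re (X n w))) t -
          char (distr M borel (\<lambda>w. Re (Y w))) t) \<le> \<bar>t\<bar> * a n"
      proof (intro always_eventually allI)
        fix n
        define D where "D w = R (X n) w - R Y w" for w
        have D: "L2_fun M D"
          unfolding D_def by (intro L2_fun_diff L2R X Y)
        \<comment> \<open>Cauchy-Schwarz of the modulus of \<open>D\<close> against the constant 1
          bounds an L1 norm by an L2 norm; the constant has norm 1 in a probability space.\<close>
        define U where "U w = complex_of_real (cmod (D w))" for w
        have U: "L2_fun M U"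
          using D unfolding U_def L2_fun_def by auto
        have one: "L2_fun M (\<lambda>w. 1 :: complex)"
          by (simp add: L2_fun_def)
        have intD: "integrable M (\<lambda>w. cmod (D w))"
          using integrable_norm[OF L2_fun_inner_integrable[OF D one]] by simp
        have "cmod (char (distr M borel (\<lambda>w. Re (X n w))) t - char (distr M borel (\<lambda>w. Re (Y w))) t) =
            cmod (\<integral>w. iexp (t * Re (X n w)) - iexp (t * Re (Y w)) \<partial>M)"
          by (subst Bochner_Integration.integral_diff)
             (simp_all only: charX intI L2_fun_measurable[OF X] L2_fun_measurable[OF Y])
        also have "\<dots> \<le> (\<integral>w. cmod (iexp (t * Re (X n w)) - iexp (t * Re (Y w))) \<partial>M)"
          by (rule integral_norm_bound)
        also have "\<dots> \<le> (\<integral>w. \<bar>t\<bar> * cmod (D w) \<partial>M)"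
        proof (rule integral_mono)
          show "integrable M (\<lambda>w. cmod (iexp (t * Re (X n w)) - iexp (t * Re (Y w))))"
            by (intro integrable_norm Bochner_Integration.integrable_diff intI) auto
          show "integrable M (\<lambda>w. \<bar>t\<bar> * cmod (D w))" using intD by simp
          show "cmod (iexp (t * Re (X n w)) - iexp (t * Re (Y w))) \<le> \<bar>t\<bar> * cmod (D w)" for w
            using norm_iexp_diff_le[of "t * Re (X n w)" "t * Re (Y w)"]
            by (simp add: D_def R_def abs_mult flip: of_real_diff right_diff_distrib)
        qed
        also have "\<dots> = \<bar>t\<bar> * cmod (\<integral>w. U w * cnj 1 \<partial>M)"
          by (simp add: U_def)
        also have "\<dots> \<le> \<bar>t\<bar> * a n"
          using norm_L2_inner_le[OF U one]
          by (intro mult_left_mono) (auto simp: a_def U_def D_def prob_space)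
        finally show "cmod (char (distr M borel (\<lambda>w. Re (X n w))) t -
          char (distr M borel (\<lambda>w. Re (Y w))) t) \<le> \<bar>t\<bar> * a n" .
      qed
      show "(\<lambda>n. \<bar>t\<bar> * a n) \<longlonglongrightarrow> 0"
        using tendsto_mult_right_zero[OF a] .
    qed
    then show "(\<lambda>n. char (distr M borel (\<lambda>w. Re (X n w))) t) \<longlonglongrightarrow> char (distr M borel (\<lambda>w. Re (Y w))) t"
      by (simp add: LIM_zero_iff)
    have "char (distr M borel (\<lambda>w. Re (X n w))) t = complex_of_real (exp (- ((\<integral>w. (Re (X n w))\<^sup>2 \<partial>M) * t\<^sup>2) / 2))" for n
      using centred_gaussian_lawD(3)[OF gauss[of n], of t] by (simp add: integral_distr)
    then show "(\<lambda>n. char (distr M borel (\<lambda>w. Re (X n w))) t) \<longlonglongrightarrow>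
        complex_of_real (exp (- ((\<integral>w. (Re (Y w))\<^sup>2 \<partial>M) * t\<^sup>2) / 2))"
      using var by (auto intro!: tendsto_intros)
  qed
  then show ?thesis
    by (intro centred_gaussian_lawI[where v = "\<integral>w. (Re (Y w))\<^sup>2 \<partial>M"]) (auto intro: real_distribution_distr)
qed

section \<open>The Wiener integral\<close>

locale white_noise = prob_space P for P :: "'w measure" +
  fixes \<Delta> :: "'e measure" and B :: "'e set \<Rightarrow> 'w \<Rightarrow> complex"
  assumes noise: "complex_white_noise P \<Delta> B"
begin

lemma noise_gaussian:
  assumes "finite F" "\<And>A. A \<in> F \<Longrightarrow> A \<in> sets \<Delta> \<and> emeasure \<Delta> A < \<infinity>"
  shows "centred_gaussian_law (distr P borel (\<lambda>w. Re (\<Sum>A\<in>F. c A * B A w)))"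
  using noise assms unfolding complex_white_noise_def centred_gaussian_process_def by blast

text \<open>The covariance clause alone gives no integrability, since a divergent Bochner integral
  is 0. The finite second moment comes from the Gaussian law of the real parts of multiples of
  \<open>B A\<close>.\<close>

lemma noise_L2:
  assumes A: "A \<in> sets \<Delta>" "emeasure \<Delta> A < \<infinity>"
  shows "L2_fun P (B A)"
proof -
  have [measurable]: "B A \<in> borel_measurable P"
    using noise A by (auto simp: complex_white_noise_def centred_gaussian_process_def)
  have sq: "integrable P (\<lambda>w. (Re (c * B A w))\<^sup>2)" for c
    using centred_gaussian_lawD(2)[OF noise_gaussian[of "{A}" "\<lambda>_. c"]] A
    by (simp add: integrable_distr_eq del: times_complex.sel)
  \<comment> \<open>Multiplication by -i turns the imaginary part into a real part, to which the
    Gaussian law applies.\<close>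
  have "integrable P (\<lambda>w. (Re (1 * B A w))\<^sup>2 + (Re ((- \<i>) * B A w))\<^sup>2)"
    by (intro Bochner_Integration.integrable_add sq)
  then show ?thesis
    by (simp add: L2_fun_def cmod_power2)
qed

lemma noise_inner:
  "A \<in> sets \<Delta> \<Longrightarrow> emeasure \<Delta> A < \<infinity> \<Longrightarrow> A' \<in> sets \<Delta> \<Longrightarrow> emeasure \<Delta> A' < \<infinity> \<Longrightarrow>
    (\<integral>w. B A w * cnj (B A' w) \<partial>P) = complex_of_real (measure \<Delta> (A \<inter> A'))"
  using noise by (auto simp: complex_white_noise_def)

section \<open>Isometry on simple integrands\<close>

lemma simple_level:
  assumes s: "Bochner_Integration.simple_bochner_integrable \<Delta> s" and y: "y \<noteq> 0"
  shows "{x \<in> space \<Delta>. s x = y} \<in> sets \<Delta>" "emeasure \<Delta> {x \<in> space \<Delta>. s x = y} < \<infinity>"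
proof -
  have sf: "simple_function \<Delta> s" and fin: "emeasure \<Delta> {x \<in> space \<Delta>. s x \<noteq> 0} \<noteq> \<infinity>"
    using s by (auto simp: simple_bochner_integrable.simps)
  have sets: "{x \<in> space \<Delta>. R (s x)} \<in> sets \<Delta>" for R
    using simple_functionD(2)[OF sf, of "{y. R y}"] by (simp add: vimage_def Int_def conj_commute)
  show "{x \<in> space \<Delta>. s x = y} \<in> sets \<Delta>" by (rule sets)
  have "emeasure \<Delta> {x \<in> space \<Delta>. s x = y} \<le> emeasure \<Delta> {x \<in> space \<Delta>. s x \<noteq> 0}"
    using y by (intro emeasure_mono sets) auto
  then show "emeasure \<Delta> {x \<in> space \<Delta>. s x = y} < \<infinity>"
    using fin by (simp add: less_top order_le_less_trans)
qed

lemma simple_range_finite: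
  "Bochner_Integration.simple_bochner_integrable \<Delta> s \<Longrightarrow> finite (s ` space \<Delta> - {0})"
  by (auto simp: simple_bochner_integrable.simps dest: simple_functionD(1))

lemma simple_L2_fun:
  fixes s :: "'e \<Rightarrow> complex"
  assumes s: "Bochner_Integration.simple_bochner_integrable \<Delta> s"
  shows "L2_fun \<Delta> s"
proof -
  have sf: "simple_function \<Delta> s"
    using s by (simp add: simple_bochner_integrable.simps)
  have "Bochner_Integration.simple_bochner_integrable \<Delta> (\<lambda>x. (cmod (s x))\<^sup>2)"
    using s simple_function_compose1[OF sf, of "\<lambda>a. (cmod a)\<^sup>2"] by (simp add: simple_bochner_integrable.simps)
  then have "integrable \<Delta> (\<lambda>x. (cmod (s x))\<^sup>2)"
    by (rule integrable.intros[OF has_bochner_integral_simple_bochner_integrable])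
  then show ?thesis
    using borel_measurable_simple_function[OF sf] by (simp add: L2_fun_def)
qed

lemma simple_wiener_L2_fun:
  assumes "Bochner_Integration.simple_bochner_integrable \<Delta> s"
  shows "L2_fun P (simple_wiener_integral \<Delta> B s)"
  unfolding simple_wiener_integral_def[abs_def]
  by (intro L2_fun_sum L2_fun_cmult noise_L2 simple_level[OF assms]) auto

text \<open>The level sets of \<open>s\<close> and \<open>t\<close> are unrelated. Each pair is
  evaluated directly through the measure of its intersection, which takes the place of a common
  refinement.\<close>

lemma simple_wiener_inner:
  assumes s: "Bochner_Integration.simple_bochner_integrable \<Delta> s" and t: "Bochner_Integration.simple_bochner_integrable \<Delta> t"
  shows "(\<integral>w. simple_wiener_integral \<Delta> B s w * cnj (simple_wiener_integral \<Delta> B t w) \<partial>P) =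
    (\<integral>x. s x * cnj (t x) \<partial>\<Delta>)"
proof -
  \<comment> \<open>The value 0 is left out, as in \<open>simple_wiener_integral\<close>: its level
    set may have infinite measure, where the noise is not controlled.\<close>
  define S where "S = s ` space \<Delta> - {0}"
  define T where "T = t ` space \<Delta> - {0}"
  define U where "U y = {x \<in> space \<Delta>. s x = y}" for y
  define V where "V y = {x \<in> space \<Delta>. t x = y}" for y
  have fin: "finite S" "finite T"
    using simple_range_finite s t by (auto simp: S_def T_def)
  have U: "U y \<in> sets \<Delta>" "emeasure \<Delta> (U y) < \<infinity>" if "y \<in> S" for y
    using simple_level[OF s, of y] that by (auto simp: U_def S_def)
  have V: "V y \<in> sets \<Delta>" "emeasure \<Delta> (V y) < \<infinity>" if "y \<in> T" for y
    using simple_level[OF t, of y] that by (auto simp: V_def T_def)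
  have "(\<integral>w. simple_wiener_integral \<Delta> B s w * cnj (simple_wiener_integral \<Delta> B t w) \<partial>P) =
      (\<integral>w. (\<Sum>y\<in>S. \<Sum>z\<in>T. (y * cnj z) * (B (U y) w * cnj (B (V z) w))) \<partial>P)"
    by (intro Bochner_Integration.integral_cong refl)
       (simp add: simple_wiener_integral_def S_def T_def U_def V_def sum_product mult_ac)
  also have "\<dots> = (\<Sum>y\<in>S. \<Sum>z\<in>T. (y * cnj z) * complex_of_real (measure \<Delta> (U y \<inter> V z)))"
    using U V by (simp add: Bochner_Integration.integral_sum Bochner_Integration.integrable_sum
        integrable_mult_right L2_fun_inner_integrable noise_L2 noise_inner)
  also have "\<dots> = (\<integral>x. (\<Sum>y\<in>S. \<Sum>z\<in>T. indicator (U y \<inter> V z) x *\<^sub>R (y * cnj z)) \<partial>\<Delta>)"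
  proof -
    have hb: "has_bochner_integral \<Delta> (\<lambda>x. indicator (U y \<inter> V z) x *\<^sub>R (y * cnj z))
        (measure \<Delta> (U y \<inter> V z) *\<^sub>R (y * cnj z))" if "y \<in> S" "z \<in> T" for y z
    proof (rule has_bochner_integral_indicator)
      show "U y \<inter> V z \<in> sets \<Delta>" using U V that by auto
      have "emeasure \<Delta> (U y \<inter> V z) \<le> emeasure \<Delta> (U y)"
        using U that by (intro emeasure_mono) auto
      then show "emeasure \<Delta> (U y \<inter> V z) < \<infinity>" using U that by (auto intro: order_le_less_trans)
    qed
    have "has_bochner_integral \<Delta> (\<lambda>x. \<Sum>y\<in>S. \<Sum>z\<in>T. indicator (U y \<inter> V z) x *\<^sub>R (y * cnj z))
        (\<Sum>y\<in>S. \<Sum>z\<in>T. measure \<Delta> (U y \<inter> V z) *\<^sub>R (y * cnj z))"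
      by (intro has_bochner_integral_sum hb)
    then show ?thesis
      by (simp add: has_bochner_integral_integral_eq scaleR_conv_of_real mult_ac)
  qed
  also have "\<dots> = (\<integral>x. s x * cnj (t x) \<partial>\<Delta>)"
  proof (intro Bochner_Integration.integral_cong refl)
    fix x assume x: "x \<in> space \<Delta>"
    have "s x = (\<Sum>y\<in>S. indicator (U y) x *\<^sub>R y)"
    proof -
      have "(\<Sum>y\<in>S. indicator (U y) x *\<^sub>R y) = (\<Sum>y\<in>S. if y = s x then y else 0)"
        using x by (intro sum.cong) (auto simp: U_def indicator_def)
      also have "\<dots> = (if s x \<in> S then s x else 0)"
        by (rule sum.delta[OF fin(1)])
      finally show ?thesis using x by (auto simp: S_def)
    qed
    moreover have "t x = (\<Sum>y\<in>T. indicator (V y) x *\<^sub>R y)"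
    proof -
      have "(\<Sum>y\<in>T. indicator (V y) x *\<^sub>R y) = (\<Sum>y\<in>T. if y = t x then y else 0)"
        using x by (intro sum.cong) (auto simp: V_def indicator_def)
      also have "\<dots> = (if t x \<in> T then t x else 0)"
        by (rule sum.delta[OF fin(2)])
      finally show ?thesis using x by (auto simp: T_def)
    qed
    ultimately have "s x * cnj (t x) =
        (\<Sum>y\<in>S. indicator (U y) x *\<^sub>R y) * cnj (\<Sum>y\<in>T. indicator (V y) x *\<^sub>R y)"
      by simp
    also have "\<dots> = (\<Sum>y\<in>S. \<Sum>z\<in>T. indicator (U y \<inter> V z) x *\<^sub>R (y * cnj z))"
      by (simp add: sum_product indicator_inter_arith mult.commute[of "indicat_real (U _) x"])
    finally show "(\<Sum>y\<in>S. \<Sum>z\<in>T. indicator (U y \<inter> V z) x *\<^sub>R (y * cnj z)) = s x * cnj (t x)" ..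
  qed
  finally show ?thesis .
qed

section \<open>The integral as a closed isometric relation\<close>

lemma has_wiener_integralE:
  assumes "has_wiener_integral P \<Delta> B f X"
  obtains s where "\<And>n. Bochner_Integration.simple_bochner_integrable \<Delta> (s n)" "L2_tendsto \<Delta> s f"
    "L2_tendsto P (\<lambda>n. simple_wiener_integral \<Delta> B (s n)) X"
    "f \<in> borel_measurable \<Delta>" "X \<in> borel_measurable P"
  using assms by (auto simp: has_wiener_integral_def L2_tendsto_def)

lemma has_wiener_integralI:
  assumes "\<And>n. Bochner_Integration.simple_bochner_integrable \<Delta> (s n)" "L2_tendsto \<Delta> s f"
    "L2_tendsto P (\<lambda>n. simple_wiener_integral \<Delta> B (s n)) X"
    "f \<in> borel_measurable \<Delta>" "X \<in> borel_measurable P"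
  shows "has_wiener_integral P \<Delta> B f X"
  using assms by (auto simp: has_wiener_integral_def L2_tendsto_def)

lemma has_wiener_integral_simple:
  assumes s: "Bochner_Integration.simple_bochner_integrable \<Delta> s"
  shows "has_wiener_integral P \<Delta> B s (simple_wiener_integral \<Delta> B s)"
  by (rule has_wiener_integralI[of "\<lambda>_. s"])
     (auto simp: L2_tendsto_def s L2_fun_measurable simple_L2_fun simple_wiener_L2_fun)

lemma has_wiener_integral_L2:
  assumes "has_wiener_integral P \<Delta> B f X"
  shows "L2_fun \<Delta> f" "L2_fun P X"
proof -
  obtain s where s: "\<And>n. Bochner_Integration.simple_bochner_integrable \<Delta> (s n)" "L2_tendsto \<Delta> s f"
    "L2_tendsto P (\<lambda>n. simple_wiener_integral \<Delta> B (s n)) X"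
    "f \<in> borel_measurable \<Delta>" "X \<in> borel_measurable P"
    using assms by (rule has_wiener_integralE) (rule that)
  show "L2_fun \<Delta> f" by (rule L2_fun_limit[OF simple_L2_fun[OF s(1)] s(4,2)])
  show "L2_fun P X" by (rule L2_fun_limit[OF simple_wiener_L2_fun[OF s(1)] s(5,3)])
qed

lemma has_wiener_integral_inner:
  assumes f: "has_wiener_integral P \<Delta> B f X" and g: "has_wiener_integral P \<Delta> B g Y"
  shows "(\<integral>w. X w * cnj (Y w) \<partial>P) = (\<integral>x. f x * cnj (g x) \<partial>\<Delta>)"
proof -
  obtain s where s: "\<And>n. Bochner_Integration.simple_bochner_integrable \<Delta> (s n)" "L2_tendsto \<Delta> s f"
      "L2_tendsto P (\<lambda>n. simple_wiener_integral \<Delta> B (s n)) X"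
    using f by (rule has_wiener_integralE) (rule that)
  obtain t where t: "\<And>n. Bochner_Integration.simple_bochner_integrable \<Delta> (t n)" "L2_tendsto \<Delta> t g"
      "L2_tendsto P (\<lambda>n. simple_wiener_integral \<Delta> B (t n)) Y"
    using g by (rule has_wiener_integralE) (rule that)
  show ?thesis
  proof (rule LIMSEQ_unique)
    show "(\<lambda>n. \<integral>x. s n x * cnj (t n x) \<partial>\<Delta>) \<longlonglongrightarrow> (\<integral>x. f x * cnj (g x) \<partial>\<Delta>)"
      by (rule L2_tendsto_inner[OF simple_L2_fun[OF s(1)] has_wiener_integral_L2(1)[OF f] s(2)
            simple_L2_fun[OF t(1)] has_wiener_integral_L2(1)[OF g] t(2)])
    show "(\<lambda>n. \<integral>x. s n x * cnj (t n x) \<partial>\<Delta>) \<longlonglongrightarrow> (\<integral>w. X w * cnj (Y w) \<partial>P)"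
      unfolding simple_wiener_inner[OF s(1) t(1), symmetric]
      by (rule L2_tendsto_inner[OF simple_wiener_L2_fun[OF s(1)] has_wiener_integral_L2(2)[OF f] s(3)
            simple_wiener_L2_fun[OF t(1)] has_wiener_integral_L2(2)[OF g] t(3)])
  qed
qed

lemma has_wiener_integral_dist:
  assumes f: "has_wiener_integral P \<Delta> B f X" and g: "has_wiener_integral P \<Delta> B g Y"
  shows "(\<integral>w. (cmod (X w - Y w))\<^sup>2 \<partial>P) = (\<integral>x. (cmod (f x - g x))\<^sup>2 \<partial>\<Delta>)"
  by (simp only: L2_norm_diff_expand has_wiener_integral_L2[OF f] has_wiener_integral_L2[OF g]
      has_wiener_integral_inner[OF f f] has_wiener_integral_inner[OF f g] has_wiener_integral_inner[OF g g])

lemma has_wiener_integral_nn_dist: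
  assumes f: "has_wiener_integral P \<Delta> B f X" and g: "has_wiener_integral P \<Delta> B g Y"
  shows "(\<integral>\<^sup>+w. ennreal ((cmod (X w - Y w))\<^sup>2) \<partial>P) = (\<integral>\<^sup>+x. ennreal ((cmod (f x - g x))\<^sup>2) \<partial>\<Delta>)"
  by (simp only: L2_fun_nn_integral L2_fun_diff has_wiener_integral_L2[OF f] has_wiener_integral_L2[OF g]
      has_wiener_integral_dist[OF f g])

text \<open>The graph of the integral is closed: each \<open>f n\<close> is replaced by a simple
  function at squared distance at most 1/(n+1), and the diagonal sequence has the same limits. This
  identifies limits of integrals without reference to the arbitrary version behind
  \<open>wiener_integral\<close>.\<close>

lemma has_wiener_integral_limit:
  assumes fX: "\<And>n. has_wiener_integral P \<Delta> B (f n) (X n)"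
    and [measurable]: "f' \<in> borel_measurable \<Delta>" "X' \<in> borel_measurable P"
    and f: "L2_tendsto \<Delta> f f'" and X: "L2_tendsto P X X'"
  shows "has_wiener_integral P \<Delta> B f' X'"
proof -
  have [measurable]: "f n \<in> borel_measurable \<Delta>" "X n \<in> borel_measurable P" for n
    using has_wiener_integral_L2[OF fX] by (auto simp: L2_fun_measurable)
  have "\<exists>s. Bochner_Integration.simple_bochner_integrable \<Delta> s \<and>
      (\<integral>\<^sup>+x. ennreal ((cmod (s x - f n x))\<^sup>2) \<partial>\<Delta>) \<le> ennreal (inverse (Suc n)) \<and>
      (\<integral>\<^sup>+w. ennreal ((cmod (simple_wiener_integral \<Delta> B s w - X n w))\<^sup>2) \<partial>P) \<le> ennreal (inverse (Suc n))" for n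
  proof -
    obtain s where s: "\<And>n. Bochner_Integration.simple_bochner_integrable \<Delta> (s n)" "L2_tendsto \<Delta> s (f n)"
      using fX[of n] by (rule has_wiener_integralE) (rule that)
    have "\<forall>\<^sub>F k in sequentially. (\<integral>\<^sup>+x. ennreal ((cmod (s k x - f n x))\<^sup>2) \<partial>\<Delta>) < ennreal (inverse (Suc n))"
      using s(2) unfolding L2_tendsto_def by (rule order_tendstoD(2)) simp
    then obtain k where k: "(\<integral>\<^sup>+x. ennreal ((cmod (s k x - f n x))\<^sup>2) \<partial>\<Delta>) < ennreal (inverse (Suc n))"
      using eventually_happens'[OF sequentially_bot] by blast
    \<comment> \<open>Isometry turns the distance of the integrands into that of the integrals, so
      one index \<open>k\<close> serves both bounds.\<close>
    then show ?thesis
      using s(1)[of k] has_wiener_integral_nn_dist[OF has_wiener_integral_simple[OF s(1)[of k]] fX[of n]]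
      by (intro exI[of _ "s k"]) auto
  qed
  from choice[OF allI[OF this]]
  obtain s where "\<forall>n. Bochner_Integration.simple_bochner_integrable \<Delta> (s n) \<and>
      (\<integral>\<^sup>+x. ennreal ((cmod (s n x - f n x))\<^sup>2) \<partial>\<Delta>) \<le> ennreal (inverse (Suc n)) \<and>
      (\<integral>\<^sup>+w. ennreal ((cmod (simple_wiener_integral \<Delta> B (s n) w - X n w))\<^sup>2) \<partial>P) \<le> ennreal (inverse (Suc n))" ..
  then have s: "\<And>n. Bochner_Integration.simple_bochner_integrable \<Delta> (s n)"
      "\<And>n. (\<integral>\<^sup>+x. ennreal ((cmod (s n x - f n x))\<^sup>2) \<partial>\<Delta>) \<le> ennreal (inverse (Suc n))"
      "\<And>n. (\<integral>\<^sup>+w. ennreal ((cmod (simple_wiener_integral \<Delta> B (s n) w - X n w))\<^sup>2) \<partial>P) \<le> ennreal (inverse (Suc n))"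
    by blast+
  have lim0: "u \<longlonglongrightarrow> 0" if "\<And>n. u n \<le> ennreal (inverse (Suc n))" for u
  proof (rule tendsto_sandwich[OF _ _ tendsto_const])
    show "(\<lambda>n. ennreal (inverse (Suc n))) \<longlonglongrightarrow> 0"
      using tendsto_ennrealI[OF LIMSEQ_inverse_real_of_nat] by simp
  qed (use that in auto)
  note [measurable] = L2_fun_measurable[OF simple_L2_fun[OF s(1)]]
    L2_fun_measurable[OF simple_wiener_L2_fun[OF s(1)]]
  show ?thesis
  proof (rule has_wiener_integralI)
    show "L2_tendsto \<Delta> s f'"
      by (rule L2_tendsto_trans[OF _ _ _ lim0[OF s(2)] f]) auto
    show "L2_tendsto P (\<lambda>n. simple_wiener_integral \<Delta> B (s n)) X'"
      by (rule L2_tendsto_trans[OF _ _ _ lim0[OF s(3)] X]) auto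
  qed (auto simp: s(1))
qed

lemma has_wiener_integral_exists:
  assumes f: "L2_fun \<Delta> f"
  shows "\<exists>X. has_wiener_integral P \<Delta> B f X"
proof -
  obtain s where s: "\<And>n. Bochner_Integration.simple_bochner_integrable \<Delta> (s n)" "L2_tendsto \<Delta> s f"
    using L2_simple_approximation[OF f] by auto
  let ?I = "\<lambda>n. simple_wiener_integral \<Delta> B (s n)"
  have "\<exists>X\<in>borel_measurable P. L2_tendsto P ?I X"
  proof (rule L2_complete)
    show "?I n \<in> borel_measurable P" for n
      by (rule L2_fun_measurable[OF simple_wiener_L2_fun[OF s(1)]])
    show "\<exists>N. \<forall>m\<ge>N. \<forall>n\<ge>N. (\<integral>\<^sup>+w. ennreal ((cmod (?I m w - ?I n w))\<^sup>2) \<partial>P) \<le> ennreal e"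
      if "0 < e" for e
      using L2_tendsto_Cauchy[OF _ _ s(2) that] L2_fun_measurable[OF simple_L2_fun[OF s(1)]]
        L2_fun_measurable[OF f]
      by (simp add: has_wiener_integral_nn_dist[OF has_wiener_integral_simple[OF s(1)] has_wiener_integral_simple[OF s(1)]])
  qed
  then show ?thesis
    using has_wiener_integralI[OF s] L2_fun_measurable[OF f] by blast
qed

lemma has_wiener_integral_wiener_integral:
  assumes "L2_fun \<Delta> f"
  shows "has_wiener_integral P \<Delta> B f (wiener_integral P \<Delta> B f)"
  unfolding wiener_integral_def using has_wiener_integral_exists[OF assms] by (rule someI_ex)

text \<open>The class on which joint Gaussianity is given by hypothesis. It is closed under linear
  combinations as functions, whereas simple integrals add up only almost surely, because
  \<open>B\<close> is additive only almost surely.\<close>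

definition noise_comb :: "('w \<Rightarrow> complex) \<Rightarrow> bool" where
  "noise_comb X \<longleftrightarrow> (\<exists>F c. finite F \<and> F \<subseteq> {A \<in> sets \<Delta>. emeasure \<Delta> A < \<infinity>} \<and>
     X = (\<lambda>w. \<Sum>A\<in>F. c A * B A w))"

lemma noise_comb_L2: "noise_comb X \<Longrightarrow> L2_fun P X"
  by (auto simp: noise_comb_def intro!: L2_fun_sum L2_fun_cmult noise_L2)

lemma noise_comb_gaussian: "noise_comb X \<Longrightarrow> centred_gaussian_law (distr P borel (\<lambda>w. Re (X w)))"
  unfolding noise_comb_def using noise_gaussian by blast

lemma noise_comb_cmult:
  assumes "noise_comb X"
  shows "noise_comb (\<lambda>w. a * X w)"
proof -
  obtain F c where F: "finite F" "F \<subseteq> {A \<in> sets \<Delta>. emeasure \<Delta> A < \<infinity>}"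
      "X = (\<lambda>w. \<Sum>A\<in>F. c A * B A w)"
    using assms by (auto simp: noise_comb_def)
  show ?thesis
    unfolding noise_comb_def using F
    by (intro exI[of _ F] exI[of _ "\<lambda>A. a * c A"]) (simp add: sum_distrib_left mult.assoc)
qed

lemma noise_comb_add:
  assumes "noise_comb X" "noise_comb Y"
  shows "noise_comb (\<lambda>w. X w + Y w)"
proof -
  obtain F c where F: "finite F" "F \<subseteq> {A \<in> sets \<Delta>. emeasure \<Delta> A < \<infinity>}"
      "X = (\<lambda>w. \<Sum>A\<in>F. c A * B A w)"
    using assms by (auto simp: noise_comb_def)
  obtain G d where G: "finite G" "G \<subseteq> {A \<in> sets \<Delta>. emeasure \<Delta> A < \<infinity>}"
      "Y = (\<lambda>w. \<Sum>A\<in>G. d A * B A w)"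
    using assms by (auto simp: noise_comb_def)
  \<comment> \<open>A set that occurs in both families must carry the sum of its two coefficients,
    so both are extended by 0 to the union.\<close>
  let ?c = "\<lambda>A. (if A \<in> F then c A else 0) + (if A \<in> G then d A else 0)"
  have "(\<Sum>A\<in>F \<union> G. ?c A * B A w) = X w + Y w" for w
  proof -
    have "(\<Sum>A\<in>F. c A * B A w) = (\<Sum>A\<in>F \<union> G. (if A \<in> F then c A else 0) * B A w)"
      using F(1) G(1) by (intro sum.mono_neutral_cong_left) auto
    moreover have "(\<Sum>A\<in>G. d A * B A w) = (\<Sum>A\<in>F \<union> G. (if A \<in> G then d A else 0) * B A w)"
      using F(1) G(1) by (intro sum.mono_neutral_cong_left) auto
    ultimately show ?thesis
      by (simp add: F(3) G(3) distrib_right sum.distrib)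
  qed
  then show ?thesis
    unfolding noise_comb_def using F(1,2) G(1,2)
    by (intro exI[of _ "F \<union> G"] exI[of _ ?c]) auto
qed

lemma noise_comb_zero: "noise_comb (\<lambda>w. 0)"
  unfolding noise_comb_def by (intro exI[of _ "{}"]) auto

lemma noise_comb_sum:
  "(\<And>i. i \<in> I \<Longrightarrow> noise_comb (X i)) \<Longrightarrow> noise_comb (\<lambda>w. \<Sum>i\<in>I. X i w)"
  by (induction I rule: infinite_finite_induct) (auto intro: noise_comb_add noise_comb_zero)

lemma noise_comb_noise:
  assumes "A \<in> sets \<Delta>" "emeasure \<Delta> A < \<infinity>"
  shows "noise_comb (B A)"
  unfolding noise_comb_def using assms by (intro exI[of _ "{A}"] exI[of _ "\<lambda>_. 1"]) auto

lemma noise_comb_simple_wiener: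
  assumes "Bochner_Integration.simple_bochner_integrable \<Delta> s"
  shows "noise_comb (simple_wiener_integral \<Delta> B s)"
  unfolding simple_wiener_integral_def[abs_def]
  by (intro noise_comb_sum noise_comb_cmult noise_comb_noise simple_level[OF assms]) auto

lemma wiener_integral_comb_approximation:
  assumes "\<And>i. i \<in> F \<Longrightarrow> has_wiener_integral P \<Delta> B (f i) (X i)"
  shows "\<exists>Y. (\<forall>n. noise_comb (Y n)) \<and> L2_tendsto P Y (\<lambda>w. \<Sum>i\<in>F. c i * X i w)"
  using assms
proof (induction F rule: infinite_finite_induct)
  case (insert i F)
  obtain Y where Y: "\<And>n. noise_comb (Y n)" "L2_tendsto P Y (\<lambda>w. \<Sum>i\<in>F. c i * X i w)"
    using insert by auto
  obtain s where s: "\<And>n. Bochner_Integration.simple_bochner_integrable \<Delta> (s n)"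
      "L2_tendsto P (\<lambda>n. simple_wiener_integral \<Delta> B (s n)) (X i)"
    using insert.prems[OF insertI1] by (rule has_wiener_integralE) (rule that)
  have meas: "X k \<in> borel_measurable P" if "k \<in> insert i F" for k
    using has_wiener_integral_L2(2)[OF insert.prems[OF that]] by (rule L2_fun_measurable)
  note [measurable] = meas[of i, simplified] L2_fun_measurable[OF noise_comb_L2[OF Y(1)]]
    L2_fun_measurable[OF simple_wiener_L2_fun[OF s(1)]]
  have [measurable]: "(\<lambda>w. \<Sum>i\<in>F. c i * X i w) \<in> borel_measurable P"
    using meas by (intro borel_measurable_sum) auto
  have "L2_tendsto P (\<lambda>n w. c i * simple_wiener_integral \<Delta> B (s n) w + Y n w)
      (\<lambda>w. c i * X i w + (\<Sum>i\<in>F. c i * X i w))"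
    by (intro L2_tendsto_add L2_tendsto_cmult s Y) measurable
  moreover have "noise_comb (\<lambda>w. c i * simple_wiener_integral \<Delta> B (s n) w + Y n w)" for n
    by (intro noise_comb_add noise_comb_cmult noise_comb_simple_wiener s Y)
  ultimately show ?case
    using insert.hyps by (auto intro!: exI[of _ "\<lambda>n w. c i * simple_wiener_integral \<Delta> B (s n) w + Y n w"])
qed (auto intro!: exI[of _ "\<lambda>_ _. 0"] noise_comb_zero simp: L2_tendsto_def)

lemma centred_gaussian_process_wiener:
  assumes X: "\<And>i. i \<in> T \<Longrightarrow> has_wiener_integral P \<Delta> B (f i) (X i)"
  shows "centred_gaussian_process P T X"
  unfolding centred_gaussian_process_def
proof (intro conjI ballI allI impI)
  show "X i \<in> borel_measurable P" if "i \<in> T" for i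
    using has_wiener_integral_L2(2)[OF X[OF that]] by (rule L2_fun_measurable)
  fix F c assume F: "finite F" "F \<subseteq> T"
  then obtain Y where Y: "\<And>n. noise_comb (Y n)" "L2_tendsto P Y (\<lambda>w. \<Sum>i\<in>F. c i * X i w)"
    using wiener_integral_comb_approximation[of F f X c] X by blast
  have "L2_fun P (\<lambda>w. \<Sum>i\<in>F. c i * X i w)"
    using F X by (intro L2_fun_sum L2_fun_cmult has_wiener_integral_L2(2)) auto
  then show "centred_gaussian_law (distr P borel (\<lambda>w. Re (\<Sum>i\<in>F. c i * X i w)))"
    by (intro centred_gaussian_law_L2_limit[OF noise_comb_L2[OF Y(1)] _ Y(2)] noise_comb_gaussian Y(1))
qed

end

section \<open>Tails of the Levy measure\<close>

lemma norm_diff_cis_sq: "(cmod (cis a - cis b))\<^sup>2 = 2 * (1 - cos (a - b))"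
proof -
  have "(cmod (cis a - cis b))\<^sup>2 = ((cos a)\<^sup>2 + (sin a)\<^sup>2) + ((cos b)\<^sup>2 + (sin b)\<^sup>2)
      - 2 * (cos a * cos b + sin a * sin b)"
    unfolding cmod_power2 by (simp add: power2_eq_square algebra_simps)
  then show ?thesis by (simp add: cos_diff)
qed

text \<open>One dyadic shell, rescaled to [1, 2], lies inside [0, pi], where the cosine decreases;
  so it stays away from 1 there.\<close>

lemma one_minus_cos_ge:
  fixes v :: real
  assumes "1 \<le> \<bar>v\<bar>" "\<bar>v\<bar> \<le> 2"
  shows "1 - cos 1 \<le> 1 - cos v"
proof -
  have "cos \<bar>v\<bar> \<le> cos 1"
    using assms pi_ge_two by (intro cos_monotone_0_pi_le) auto
  then show ?thesis by simp
qed

lemma one_minus_cos_one_pos: "0 < 1 - cos (1::real)"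
  using cos_monotone_0_pi[of 0 1] pi_ge_two by simp

text \<open>Sum of the geometric series with first term
  \<open>e powr (- \<alpha>) / (2 * (1 - cos 1))\<close> and ratio
  \<open>2 powr (- \<alpha>)\<close>, whose k-th term bounds the k-th dyadic shell of the
  tail.\<close>

definition tail_const :: "real \<Rightarrow> real \<Rightarrow> real" where
  "tail_const \<alpha> e = e powr (- \<alpha>) / (2 * (1 - cos 1) * (1 - 2 powr (- \<alpha>)))"

text \<open>Split the tail into the shells \<open>2\<^sup>k e \<le> \<bar>u\<bar> \<le> 2\<^sup>k\<^sup>+\<^sup>1 e\<close>; on the \<open>k\<close>-th one
  \<open>1 - cos (t u)\<close> is bounded below for \<open>t = 1 / (2\<^sup>k e)\<close>.\<close>

lemma emeasure_tail_le:
  fixes u :: "'a \<Rightarrow> real"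
  assumes [measurable]: "u \<in> borel_measurable M" and \<alpha>: "0 < \<alpha>" and e: "0 < e" and c: "0 \<le> c"
    and bound: "\<And>t. 0 < t \<Longrightarrow> (\<integral>\<^sup>+x. ennreal (2 * (1 - cos (t * u x))) \<partial>M) \<le> ennreal (t powr \<alpha> * c)"
  shows "emeasure M {x \<in> space M. e \<le> \<bar>u x\<bar>} \<le> ennreal (tail_const \<alpha> e * c)"
proof -
  define q where "q = 1 - cos (1::real)"
  have q: "0 < q" unfolding q_def by (rule one_minus_cos_one_pos)
  define S where "S k = {x \<in> space M. e * 2^k \<le> \<bar>u x\<bar> \<and> \<bar>u x\<bar> \<le> e * 2^Suc k}" for k :: nat
  have [measurable]: "S k \<in> sets M" for k
    unfolding S_def by measurable
  define a where "a k = 1 / (2 * q) * (e powr (- \<alpha>) * c) * (2 powr (- \<alpha>))^k" for k :: nat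
  have S: "emeasure M (S k) \<le> ennreal (a k)" for k
  proof -
    define t where "t = 1 / (e * 2^k)"
    have t: "0 < t" using e by (simp add: t_def)
    have sub: "S k \<subseteq> {x \<in> space M. 1 \<le> ennreal (1 / (2 * q)) * ennreal (2 * (1 - cos (t * u x)))}"
    proof
      fix x assume x: "x \<in> S k"
      have "1 \<le> \<bar>t * u x\<bar>" "\<bar>t * u x\<bar> \<le> 2"
        using x e by (auto simp: S_def t_def abs_mult field_simps)
      from one_minus_cos_ge[OF this] have "q \<le> 1 - cos (t * u x)" by (simp add: q_def)
      then have "1 \<le> 1 / (2 * q) * (2 * (1 - cos (t * u x)))"
        using q by (simp add: field_simps)
      then have "ennreal 1 \<le> ennreal (1 / (2 * q) * (2 * (1 - cos (t * u x))))"
        by (rule ennreal_leI)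
      also have "\<dots> = ennreal (1 / (2 * q)) * ennreal (2 * (1 - cos (t * u x)))"
        using q by (intro ennreal_mult) auto
      finally show "x \<in> {x \<in> space M. 1 \<le> ennreal (1 / (2 * q)) * ennreal (2 * (1 - cos (t * u x)))}"
        using x by (simp add: S_def)
    qed
    have "emeasure M (S k) \<le> emeasure M {x \<in> space M. 1 \<le> ennreal (1 / (2 * q)) * ennreal (2 * (1 - cos (t * u x)))}"
      by (rule emeasure_mono[OF sub]) measurable
    also have "\<dots> \<le> ennreal (1 / (2 * q)) * (\<integral>\<^sup>+x. ennreal (2 * (1 - cos (t * u x))) * indicator (space M) x \<partial>M)"
      by (rule nn_integral_Markov_inequality) measurable
    also have "\<dots> = ennreal (1 / (2 * q)) * (\<integral>\<^sup>+x. ennreal (2 * (1 - cos (t * u x))) \<partial>M)"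
      by (intro arg_cong[where f = "\<lambda>z. ennreal (1 / (2 * q)) * z"] nn_integral_cong) simp
    also have "\<dots> \<le> ennreal (1 / (2 * q)) * ennreal (t powr \<alpha> * c)"
      by (intro mult_left_mono bound t) simp
    also have "\<dots> = ennreal (1 / (2 * q) * (t powr \<alpha> * c))"
      using q c by (intro ennreal_mult[symmetric]) auto
    also have "1 / (2 * q) * (t powr \<alpha> * c) = a k"
    proof -
      have "t powr \<alpha> = (e * 2^k) powr (- \<alpha>)"
        using e by (simp add: t_def powr_def ln_div)
      also have "\<dots> = e powr (- \<alpha>) * (2^k) powr (- \<alpha>)"
        using e by (simp add: powr_mult)
      also have "(2^k) powr (- \<alpha>) = (2 powr (- \<alpha>))^k"
        by (simp add: powr_power powr_powr mult.commute flip: powr_realpow)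
      finally show ?thesis by (simp add: a_def)
    qed
    finally show ?thesis .
  qed
  have r: "0 \<le> (2::real) powr (- \<alpha>)" "(2::real) powr (- \<alpha>) < 1"
    using \<alpha> powr_less_one[of 2 "-\<alpha>"] by auto
  have sums: "a sums (tail_const \<alpha> e * c)"
    using sums_mult[OF geometric_sums[of "2 powr (- \<alpha>)"], of "1 / (2 * q) * (e powr (- \<alpha>) * c)"] r
    by (simp add: a_def[abs_def] tail_const_def q_def mult_ac)
  have "{x \<in> space M. e \<le> \<bar>u x\<bar>} \<subseteq> (\<Union>k. S k)"
  proof
    fix x assume x: "x \<in> {x \<in> space M. e \<le> \<bar>u x\<bar>}"
    have "\<exists>k. \<bar>u x\<bar> \<le> e * 2^Suc k"
    proof -
      obtain k where "\<bar>u x\<bar> / e < 2^k"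
        using real_arch_pow[of 2 "\<bar>u x\<bar> / e"] by auto
      then have "\<bar>u x\<bar> \<le> e * 2^k" using e by (simp add: field_simps)
      also have "\<dots> \<le> e * 2^Suc k" using e by simp
      finally show ?thesis ..
    qed
    \<comment> \<open>Minimality of the index gives the lower end of the shell; for index 0 the
      lower end is the tail condition itself. Adjacent shells share a boundary, which subadditivity
      tolerates.\<close>
    then have ex: "\<bar>u x\<bar> \<le> e * 2^Suc (LEAST k. \<bar>u x\<bar> \<le> e * 2^Suc k)" (is "_ \<le> e * 2^Suc ?k")
      by (rule LeastI_ex)
    have "e * 2^?k \<le> \<bar>u x\<bar>"
    proof (cases ?k)
      case 0
      then show ?thesis using x by simp
    next
      case (Suc m)
      then have "m < ?k" by simp
      from not_less_Least[OF this] show ?thesis using Suc by simp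
    qed
    with ex x show "x \<in> (\<Union>k. S k)"
      by (auto simp: S_def simp del: power_Suc)
  qed
  then have "emeasure M {x \<in> space M. e \<le> \<bar>u x\<bar>} \<le> emeasure M (\<Union>k. S k)"
    by (rule emeasure_mono) measurable
  also have "\<dots> \<le> (\<Sum>k. emeasure M (S k))"
    by (rule emeasure_subadditive_countably) auto
  also have "\<dots> \<le> (\<Sum>k. ennreal (a k))"
    by (intro suminf_le S) auto
  also have "\<dots> = ennreal (tail_const \<alpha> e * c)"
    using q c by (intro suminf_ennreal_eq sums) (simp add: a_def)
  finally show ?thesis .
qed


lemma blinfun_borel_measurable [measurable]: "blinfun_apply \<xi> \<in> borel_measurable borel"
  by (intro borel_measurable_continuous_onI linear_continuous_on blinfun.bounded_linear_right)


section \<open>The spherical noise and its extension\<close>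

text \<open>\<open>d \<xi>\<close> stands for the element \<open>S \<xi>\<close> of \<open>H\<close>. The assumption \<open>phase\<close> replaces the symmetry
  of \<open>\<Delta>\<close>.\<close>

locale spherical_noise = white_noise P \<Delta> B
  for P :: "'w measure" and \<Delta> :: "'e::{real_normed_vector, second_countable_topology} measure" and B +
  fixes d :: "('e \<Rightarrow>\<^sub>L real) \<Rightarrow> 'h::real_normed_vector" and \<mu> :: "'e measure" and \<alpha> :: real
  assumes alpha: "0 < \<alpha>"
    and sets_mu [measurable_cong]: "sets \<mu> = sets borel"
    and sets_Delta [measurable_cong]: "sets \<Delta> = sets borel"
    and linear_d: "linear d"
    and dense_d: "closure (range d) = UNIV"
    and mu: "\<And>\<xi>. (\<integral>\<^sup>+x. ennreal ((blinfun_apply \<xi> x)\<^sup>2) \<partial>\<mu>) = ennreal ((norm (d \<xi>))\<^sup>2)"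
    and Delta: "\<And>\<xi>. (\<integral>\<^sup>+x. ennreal (2 * (1 - cos (blinfun_apply \<xi> x))) \<partial>\<Delta>) = ennreal (norm (d \<xi>) powr \<alpha>)"
    and phase: "\<And>\<xi> \<eta> :: 'e \<Rightarrow>\<^sub>L real. (\<integral>x. sin (blinfun_apply \<xi> x) - sin (blinfun_apply \<eta> x) - sin (blinfun_apply \<xi> x - blinfun_apply \<eta> x) \<partial>\<Delta>) = 0"
begin

lemma space_Delta [simp]: "space \<Delta> = UNIV" and space_mu [simp]: "space \<mu> = UNIV"
  using sets_eq_imp_space_eq[OF sets_Delta] sets_eq_imp_space_eq[OF sets_mu] by auto

lemma mu_diff: "(\<integral>\<^sup>+x. ennreal ((blinfun_apply \<xi> x - blinfun_apply \<eta> x)\<^sup>2) \<partial>\<mu>) = ennreal ((norm (d \<xi> - d \<eta>))\<^sup>2)"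
  using mu[of "\<xi> - \<eta>"] by (simp add: blinfun.diff_left linear_diff[OF linear_d])

lemma Delta_diff:
  assumes t: "0 < t"
  shows "(\<integral>\<^sup>+x. ennreal (2 * (1 - cos (t * (blinfun_apply \<xi> x - blinfun_apply \<eta> x)))) \<partial>\<Delta>) =
    ennreal (t powr \<alpha> * norm (d \<xi> - d \<eta>) powr \<alpha>)"
  using Delta[of "t *\<^sub>R (\<xi> - \<eta>)"] t
  by (simp add: blinfun.diff_left blinfun.scaleR_left linear_diff[OF linear_d]
      linear_scale[OF linear_d] powr_mult)

text \<open>Estimates against every \<open>\<eta>\<close> instead of a limit along one sequence:
  they survive Fatou's lemma and yield convergence along every sequence with
  \<open>d (\<xi> n)\<close> tending to \<open>\<phi>\<close>. The scale \<open>t = 1\<close> gives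
  convergence of the integrands in L2(\<Delta>); the other scales feed the tail estimate and hence
  convergence in \<Delta>-measure.\<close>

definition pw_version :: "'h \<Rightarrow> ('e \<Rightarrow> real) \<Rightarrow> bool" where
  "pw_version \<phi> g \<longleftrightarrow> g \<in> borel_measurable borel \<and>
    (\<forall>\<eta>. (\<integral>\<^sup>+x. ennreal ((blinfun_apply \<eta> x - g x)\<^sup>2) \<partial>\<mu>) \<le> ennreal ((norm (d \<eta> - \<phi>))\<^sup>2) \<and>
      (\<forall>t>0. (\<integral>\<^sup>+x. ennreal (2 * (1 - cos (t * (blinfun_apply \<eta> x - g x)))) \<partial>\<Delta>) \<le>
        ennreal (t powr \<alpha> * norm (d \<eta> - \<phi>) powr \<alpha>)))"

lemma approximating_sequence: "\<exists>\<xi>. (\<lambda>n::nat. d (\<xi> n)) \<longlonglongrightarrow> \<phi>"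
proof -
  have "\<phi> \<in> closure (range d)" by (simp add: dense_d)
  then obtain f where f: "\<And>n. f n \<in> range d" "f \<longlonglongrightarrow> \<phi>"
    unfolding closure_sequential by blast
  from f(1) have "\<exists>\<xi>. \<forall>n. f n = d (\<xi> n)" by (intro choice) blast
  then obtain \<xi> where "\<And>n. f n = d (\<xi> n)" by blast
  then have "f = (\<lambda>n. d (\<xi> n))" by blast
  with f(2) show ?thesis by auto
qed

text \<open>The value at 0 is a separate assumption because the one-sided limit says nothing about
  it, and the distance is 0 whenever \<open>d (\<xi> m) = d (\<xi> n)\<close>.\<close>

lemma Cauchy_uniform:
  fixes \<xi> :: "nat \<Rightarrow> 'e \<Rightarrow>\<^sub>L real" and F :: "real \<Rightarrow> real"
  assumes lim: "(\<lambda>n. d (\<xi> n)) \<longlonglongrightarrow> \<phi>" and F: "(F \<longlongrightarrow> 0) (at_right 0)" "F 0 = 0" and e: "0 < e"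
  shows "\<exists>N. \<forall>m\<ge>N. \<forall>n\<ge>N. F (norm (d (\<xi> m) - d (\<xi> n))) \<le> e"
proof -
  have "\<forall>\<^sub>F r in at_right 0. F r < e"
    using F(1) e by (rule order_tendstoD(2))
  then obtain b where b: "0 < b" "\<And>r. 0 < r \<Longrightarrow> r < b \<Longrightarrow> F r < e"
    by (auto simp: eventually_at_right_field)
  obtain N where N: "\<And>m n. m \<ge> N \<Longrightarrow> n \<ge> N \<Longrightarrow> norm (d (\<xi> m) - d (\<xi> n)) < b"
    using metric_CauchyD[OF LIMSEQ_imp_Cauchy[OF lim] b(1)] by (auto simp: dist_norm)
  have "F (norm (d (\<xi> m) - d (\<xi> n))) \<le> e" if "m \<ge> N" "n \<ge> N" for m n
    using b(2)[OF _ N[OF that]] F(2) e by (cases "norm (d (\<xi> m) - d (\<xi> n)) = 0") (auto intro: less_imp_le)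
  then show ?thesis by blast
qed

text \<open>Two extractions, since null sets of one measure say nothing about the other: a
  subsequence convergent \<mu>-almost everywhere is thinned again to converge \<Delta>-almost
  everywhere. The pointwise limit of the common subsequence inherits both families of bounds by
  Fatou's lemma.\<close>

lemma pw_version_exists: "\<exists>g. pw_version \<phi> g"
proof -
  obtain \<xi> :: "nat \<Rightarrow> 'e \<Rightarrow>\<^sub>L real" where \<xi>: "(\<lambda>n. d (\<xi> n)) \<longlonglongrightarrow> \<phi>"
    using approximating_sequence by blast
  have "\<exists>r::nat \<Rightarrow> nat. strict_mono r \<and> (AE x in \<mu>. convergent (\<lambda>n. blinfun_apply (\<xi> (r n)) x))"
  proof (rule Cauchy_in_measure_AE_convergent)
    fix e :: real assume e: "0 < e"
    have "((\<lambda>r. 1 / e\<^sup>2 * r\<^sup>2) \<longlongrightarrow> 1 / e\<^sup>2 * 0\<^sup>2) (at_right 0)"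
      by (intro tendsto_intros)
    then have "\<exists>N. \<forall>m\<ge>N. \<forall>n\<ge>N. 1 / e\<^sup>2 * (norm (d (\<xi> m) - d (\<xi> n)))\<^sup>2 \<le> e"
      using e by (intro Cauchy_uniform[OF \<xi>]) auto
    moreover have "emeasure \<mu> {x \<in> space \<mu>. e \<le> norm (blinfun_apply (\<xi> m) x - blinfun_apply (\<xi> n) x)} \<le>
        ennreal (1 / e\<^sup>2 * (norm (d (\<xi> m) - d (\<xi> n)))\<^sup>2)" for m n
      using emeasure_norm_ge_le[of "\<lambda>x. blinfun_apply (\<xi> m) x - blinfun_apply (\<xi> n) x" \<mu>, OF _ e]
      by (simp add: mu_diff flip: ennreal_mult)
    ultimately show "\<exists>N. \<forall>m\<ge>N. \<forall>n\<ge>N.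
        emeasure \<mu> {x \<in> space \<mu>. e \<le> norm (blinfun_apply (\<xi> m) x - blinfun_apply (\<xi> n) x)} \<le> ennreal e"
      by (meson ennreal_leI order_trans)
  qed measurable
  then obtain r :: "nat \<Rightarrow> nat" where r: "strict_mono r" "AE x in \<mu>. convergent (\<lambda>n. blinfun_apply (\<xi> (r n)) x)"
    by blast
  have \<xi>r: "(\<lambda>n. d (\<xi> (r n))) \<longlonglongrightarrow> \<phi>"
    using LIMSEQ_subseq_LIMSEQ[OF \<xi> r(1)] by (simp add: o_def)
  have "\<exists>r'::nat \<Rightarrow> nat. strict_mono r' \<and> (AE x in \<Delta>. convergent (\<lambda>n. blinfun_apply (\<xi> (r (r' n))) x))"
  proof (rule Cauchy_in_measure_AE_convergent)
    fix e :: real assume e: "0 < e"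
    have "((\<lambda>r. tail_const \<alpha> e * r powr \<alpha>) \<longlongrightarrow> tail_const \<alpha> e * 0 powr \<alpha>) (at_right 0)"
      using alpha by (intro tendsto_intros tendsto_powr') (auto simp: eventually_at_right_field intro: exI[of _ 1])
    then have "\<exists>N. \<forall>m\<ge>N. \<forall>n\<ge>N. tail_const \<alpha> e * norm (d (\<xi> (r m)) - d (\<xi> (r n))) powr \<alpha> \<le> e"
      using e by (intro Cauchy_uniform[OF \<xi>r]) auto
    moreover have "emeasure \<Delta> {x \<in> space \<Delta>. e \<le> norm (blinfun_apply (\<xi> m) x - blinfun_apply (\<xi> n) x)} \<le>
        ennreal (tail_const \<alpha> e * norm (d (\<xi> m) - d (\<xi> n)) powr \<alpha>)" for m n
      using emeasure_tail_le[of "\<lambda>x. blinfun_apply (\<xi> m) x - blinfun_apply (\<xi> n) x" \<Delta>, OF _ alpha e] Delta_diff by simp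
    ultimately show "\<exists>N. \<forall>m\<ge>N. \<forall>n\<ge>N.
        emeasure \<Delta> {x \<in> space \<Delta>. e \<le> norm (blinfun_apply (\<xi> (r m)) x - blinfun_apply (\<xi> (r n)) x)} \<le> ennreal e"
      by (meson ennreal_leI order_trans)
  qed measurable
  then obtain r' :: "nat \<Rightarrow> nat" where
    r': "strict_mono r'" "AE x in \<Delta>. convergent (\<lambda>n. blinfun_apply (\<xi> (r (r' n))) x)"
    by blast
  have AE_mu: "AE x in \<mu>. convergent (\<lambda>n. blinfun_apply (\<xi> (r (r' n))) x)"
    using r(2)
  proof eventually_elim
    case (elim x)
    then show ?case
      using convergent_subseq_convergent[OF elim r'(1)] by (simp add: o_def)
  qed
  define z where "z n = \<xi> (r (r' n))" for n
  have z: "(\<lambda>n. d (z n)) \<longlonglongrightarrow> \<phi>"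
    using LIMSEQ_subseq_LIMSEQ[OF \<xi>r r'(1)] by (simp add: o_def z_def)
  define g where "g x = lim (\<lambda>n. blinfun_apply (z n) x)" for x
  have [measurable]: "g \<in> borel_measurable borel"
    unfolding g_def by measurable
  have zg: "AE x in \<mu>. (\<lambda>n. blinfun_apply (z n) x) \<longlonglongrightarrow> g x" "AE x in \<Delta>. (\<lambda>n. blinfun_apply (z n) x) \<longlonglongrightarrow> g x"
    using AE_mu r'(2) by (auto simp: g_def z_def convergent_LIMSEQ_iff)
  have "pw_version \<phi> g"
    unfolding pw_version_def
  proof (intro conjI allI impI)
    fix \<eta> :: "'e \<Rightarrow>\<^sub>L real"
    show "(\<integral>\<^sup>+x. ennreal ((blinfun_apply \<eta> x - g x)\<^sup>2) \<partial>\<mu>) \<le> ennreal ((norm (d \<eta> - \<phi>))\<^sup>2)"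
    proof (rule nn_integral_le_of_AE_tendsto)
      show "AE x in \<mu>. (\<lambda>n. ennreal ((blinfun_apply \<eta> x - blinfun_apply (z n) x)\<^sup>2)) \<longlonglongrightarrow> ennreal ((blinfun_apply \<eta> x - g x)\<^sup>2)"
        using zg(1) by eventually_elim (intro tendsto_ennrealI tendsto_intros)
      show "(\<lambda>n. ennreal ((norm (d \<eta> - d (z n)))\<^sup>2)) \<longlonglongrightarrow> ennreal ((norm (d \<eta> - \<phi>))\<^sup>2)"
        by (intro tendsto_ennrealI tendsto_intros z)
    qed (auto simp: mu_diff)
    fix t :: real assume t: "0 < t"
    show "(\<integral>\<^sup>+x. ennreal (2 * (1 - cos (t * (blinfun_apply \<eta> x - g x)))) \<partial>\<Delta>) \<le>
        ennreal (t powr \<alpha> * norm (d \<eta> - \<phi>) powr \<alpha>)"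
    proof (rule nn_integral_le_of_AE_tendsto)
      show "AE x in \<Delta>. (\<lambda>n. ennreal (2 * (1 - cos (t * (blinfun_apply \<eta> x - blinfun_apply (z n) x))))) \<longlonglongrightarrow>
          ennreal (2 * (1 - cos (t * (blinfun_apply \<eta> x - g x))))"
        using zg(2) by eventually_elim (intro tendsto_ennrealI tendsto_intros)
      show "(\<lambda>n. ennreal (t powr \<alpha> * norm (d \<eta> - d (z n)) powr \<alpha>)) \<longlonglongrightarrow>
          ennreal (t powr \<alpha> * norm (d \<eta> - \<phi>) powr \<alpha>)"
        using alpha by (intro tendsto_ennrealI tendsto_mult tendsto_powr' tendsto_intros z) auto
    qed (auto simp: Delta_diff[OF t] simp del: right_diff_distrib_numeral)
  qed simp
  then show ?thesis by blast
qed

lemma pw_version_mu_tendsto: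
  assumes g: "pw_version \<phi> g" and \<xi>: "(\<lambda>n. d (\<xi> n)) \<longlonglongrightarrow> \<phi>"
  shows "(\<lambda>n. \<integral>\<^sup>+x. ennreal ((blinfun_apply (\<xi> n) x - g x)\<^sup>2) \<partial>\<mu>) \<longlonglongrightarrow> 0"
proof (rule tendsto_sandwich[OF _ _ tendsto_const])
  have "(\<lambda>n. ennreal ((norm (d (\<xi> n) - \<phi>))\<^sup>2)) \<longlonglongrightarrow> ennreal ((norm (\<phi> - \<phi>))\<^sup>2)"
    by (intro tendsto_ennrealI tendsto_intros \<xi>)
  then show "(\<lambda>n. ennreal ((norm (d (\<xi> n) - \<phi>))\<^sup>2)) \<longlonglongrightarrow> 0" by simp
qed (use g in \<open>auto simp: pw_version_def\<close>)

lemma norm_powr_tendsto: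
  assumes "f \<longlonglongrightarrow> (a :: 'h)"
  shows "(\<lambda>n. norm (f n) powr \<alpha>) \<longlonglongrightarrow> norm a powr \<alpha>"
  using assms alpha by (intro tendsto_powr' tendsto_intros) auto

lemma pw_version_Delta_tendsto:
  assumes g: "pw_version \<phi> g" and \<xi>: "(\<lambda>n. d (\<xi> n)) \<longlonglongrightarrow> \<phi>" and e: "0 < e"
  shows "(\<lambda>n. emeasure \<Delta> {x. e \<le> \<bar>blinfun_apply (\<xi> n) x - g x\<bar>}) \<longlonglongrightarrow> 0"
proof (rule tendsto_sandwich[OF _ _ tendsto_const])
  have [measurable]: "g \<in> borel_measurable borel" using g by (simp add: pw_version_def)
  have "(\<lambda>n. d (\<xi> n) - \<phi>) \<longlonglongrightarrow> 0" using \<xi> by (simp add: LIM_zero)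
  from norm_powr_tendsto[OF this]
  have "(\<lambda>n. ennreal (tail_const \<alpha> e * norm (d (\<xi> n) - \<phi>) powr \<alpha>)) \<longlonglongrightarrow>
      ennreal (tail_const \<alpha> e * norm (0::'h) powr \<alpha>)"
    by (intro tendsto_ennrealI tendsto_mult tendsto_const)
  then show "(\<lambda>n. ennreal (tail_const \<alpha> e * norm (d (\<xi> n) - \<phi>) powr \<alpha>)) \<longlonglongrightarrow> 0" by simp
  show "\<forall>\<^sub>F n in sequentially. emeasure \<Delta> {x. e \<le> \<bar>blinfun_apply (\<xi> n) x - g x\<bar>} \<le>
      ennreal (tail_const \<alpha> e * norm (d (\<xi> n) - \<phi>) powr \<alpha>)"
  proof (intro always_eventually allI)
    fix n
    show "emeasure \<Delta> {x. e \<le> \<bar>blinfun_apply (\<xi> n) x - g x\<bar>} \<le> ennreal (tail_const \<alpha> e * norm (d (\<xi> n) - \<phi>) powr \<alpha>)"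
      using emeasure_tail_le[of "\<lambda>x. blinfun_apply (\<xi> n) x - g x" \<Delta>, OF _ alpha e] g by (simp add: pw_version_def)
  qed
qed simp

lemma pw_version_L2:
  assumes g: "pw_version \<phi> g"
  shows "L2_fun \<Delta> (\<lambda>x. 1 - cis (g x))"
proof (rule L2_funI)
  have [measurable]: "g \<in> borel_measurable borel" using g by (simp add: pw_version_def)
  show "(\<lambda>x. 1 - cis (g x)) \<in> borel_measurable \<Delta>"
    unfolding cis_conv_exp by measurable
  \<comment> \<open>The bound is the case \<open>\<eta> = 0\<close>, \<open>t = 1\<close> of
    \<open>pw_version\<close>.\<close>
  have "(\<integral>\<^sup>+x. ennreal ((cmod (1 - cis (g x)))\<^sup>2) \<partial>\<Delta>) =
      (\<integral>\<^sup>+x. ennreal (2 * (1 - cos (1 * (blinfun_apply 0 x - g x)))) \<partial>\<Delta>)"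
    using norm_diff_cis_sq[of 0] by simp
  also have "\<dots> \<le> ennreal (1 powr \<alpha> * norm (d 0 - \<phi>) powr \<alpha>)"
    using g zero_less_one unfolding pw_version_def by blast
  also have "\<dots> < \<infinity>" by simp
  finally show "(\<integral>\<^sup>+x. ennreal ((cmod (1 - cis (g x)))\<^sup>2) \<partial>\<Delta>) < \<infinity>" .
qed

lemma pw_version_L2_tendsto:
  assumes g: "pw_version \<phi> g" and \<xi>: "(\<lambda>n. d (\<xi> n)) \<longlonglongrightarrow> \<phi>"
  shows "L2_tendsto \<Delta> (\<lambda>n x. 1 - cis (blinfun_apply (\<xi> n) x)) (\<lambda>x. 1 - cis (g x))"
  unfolding L2_tendsto_def
proof (rule tendsto_sandwich[OF _ _ tendsto_const])
  have "(\<lambda>n. d (\<xi> n) - \<phi>) \<longlonglongrightarrow> 0" using \<xi> by (simp add: LIM_zero)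
  from tendsto_ennrealI[OF norm_powr_tendsto[OF this]]
  show "(\<lambda>n. ennreal (norm (d (\<xi> n) - \<phi>) powr \<alpha>)) \<longlonglongrightarrow> 0" by simp
  have "(cmod ((1 - cis a) - (1 - cis b)))\<^sup>2 = 2 * (1 - cos (1 * (a - b)))" for a b
    using norm_diff_cis_sq[of a b] by (simp add: norm_minus_commute)
  moreover have "(\<integral>\<^sup>+x. ennreal (2 * (1 - cos (1 * (blinfun_apply (\<xi> n) x - g x)))) \<partial>\<Delta>) \<le>
      ennreal (1 powr \<alpha> * norm (d (\<xi> n) - \<phi>) powr \<alpha>)" for n
    using g zero_less_one unfolding pw_version_def by blast
  ultimately show "\<forall>\<^sub>F n in sequentially. (\<integral>\<^sup>+x. ennreal ((cmod ((1 - cis (blinfun_apply (\<xi> n) x)) - (1 - cis (g x))))\<^sup>2) \<partial>\<Delta>) \<le>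
      ennreal (norm (d (\<xi> n) - \<phi>) powr \<alpha>)"
    by (intro always_eventually allI) simp
qed simp

lemma pw_version_dual: "pw_version (d \<xi>) (blinfun_apply \<xi>)"
  unfolding pw_version_def by (simp add: mu_diff Delta_diff del: right_diff_distrib_numeral)

lemma has_wiener_noise_process:
  "has_wiener_integral P \<Delta> B (\<lambda>x. 1 - cis (blinfun_apply \<xi> x)) (noise_process P \<Delta> B \<xi>)"
  unfolding noise_process_def
  by (rule has_wiener_integral_wiener_integral[OF pw_version_L2[OF pw_version_dual]])

lemma Delta_integral:
  "integrable \<Delta> (\<lambda>x. 1 - cos (blinfun_apply \<xi> x - blinfun_apply \<eta> x))"
  "(\<integral>x. 1 - cos (blinfun_apply \<xi> x - blinfun_apply \<eta> x) \<partial>\<Delta>) = norm (d \<xi> - d \<eta>) powr \<alpha> / 2"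
proof -
  have eq: "(\<integral>\<^sup>+x. ennreal (2 * (1 - cos (blinfun_apply \<xi> x - blinfun_apply \<eta> x))) \<partial>\<Delta>) = ennreal (norm (d \<xi> - d \<eta>) powr \<alpha>)"
    using Delta_diff[of 1 \<xi> \<eta>] by simp
  have int: "integrable \<Delta> (\<lambda>x. 2 * (1 - cos (blinfun_apply \<xi> x - blinfun_apply \<eta> x)))"
    by (rule integrableI_nonneg) (auto simp: eq simp del: right_diff_distrib_numeral)
  then show "integrable \<Delta> (\<lambda>x. 1 - cos (blinfun_apply \<xi> x - blinfun_apply \<eta> x))"
    using integrable_mult_right[of "1/2" \<Delta> "\<lambda>x. 2 * (1 - cos (blinfun_apply \<xi> x - blinfun_apply \<eta> x))"]
    by (simp del: right_diff_distrib_numeral)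
  have "(\<integral>x. 2 * (1 - cos (blinfun_apply \<xi> x - blinfun_apply \<eta> x)) \<partial>\<Delta>) = norm (d \<xi> - d \<eta>) powr \<alpha>"
  proof -
    have "ennreal (norm (d \<xi> - d \<eta>) powr \<alpha>) =
        ennreal (\<integral>x. 2 * (1 - cos (blinfun_apply \<xi> x - blinfun_apply \<eta> x)) \<partial>\<Delta>)"
      unfolding eq[symmetric] by (rule nn_integral_eq_integral[OF int]) simp
    then show ?thesis
      by (subst (asm) ennreal_inj) (auto intro!: Bochner_Integration.integral_nonneg
          simp del: right_diff_distrib_numeral)
  qed
  then show "(\<integral>x. 1 - cos (blinfun_apply \<xi> x - blinfun_apply \<eta> x) \<partial>\<Delta>) = norm (d \<xi> - d \<eta>) powr \<alpha> / 2"
    by (simp del: right_diff_distrib_numeral)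
qed

text \<open>Polarisation: the covariance of a centred field that vanishes at 0 and whose increments
  have second moment \<open>norm (\<phi> - \<psi>) powr \<alpha>\<close>.\<close>

definition fbm_cov :: "'h \<Rightarrow> 'h \<Rightarrow> real" where
  "fbm_cov \<phi> \<psi> = (norm \<phi> powr \<alpha> + norm \<psi> powr \<alpha> - norm (\<phi> - \<psi>) powr \<alpha>) / 2"

text \<open>In (1 - e^(ia)) (1 - e^(-ib)) the real part is (1 - cos a) + (1 - cos b) - (1 - cos (a -
  b)), and the imaginary part is the combination of sines that \<open>phase\<close> kills. A single
  sine may fail to be integrable under \<Delta>, so the three are kept together.\<close>

lemma noise_process_inner:
  "(\<integral>w. noise_process P \<Delta> B \<xi> w * cnj (noise_process P \<Delta> B \<eta> w) \<partial>P) =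
    complex_of_real (fbm_cov (d \<xi>) (d \<eta>))"
proof -
  let ?f = "\<lambda>x. (1 - cis (blinfun_apply \<xi> x)) * cnj (1 - cis (blinfun_apply \<eta> x))"
  have int: "integrable \<Delta> ?f"
    by (intro L2_fun_inner_integrable pw_version_L2[OF pw_version_dual])
  \<comment> \<open>The functional 0 is subtracted so that all three terms are instances of
    \<open>Delta_integral\<close>.\<close>
  have Re: "Re (?f x) = (1 - cos (blinfun_apply \<xi> x - blinfun_apply 0 x)) + (1 - cos (blinfun_apply \<eta> x - blinfun_apply 0 x))
      - (1 - cos (blinfun_apply \<xi> x - blinfun_apply \<eta> x))" for x
    by (simp add: cos_diff algebra_simps)
  have Im: "Im (?f x) = - (sin (blinfun_apply \<xi> x) - sin (blinfun_apply \<eta> x) - sin (blinfun_apply \<xi> x - blinfun_apply \<eta> x))" for x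
    by (simp add: sin_diff algebra_simps)
  have "Re (\<integral>x. ?f x \<partial>\<Delta>) = (\<integral>x. Re (?f x) \<partial>\<Delta>)"
    by (rule integral_Re[OF int, symmetric])
  also have "\<dots> = (\<integral>x. 1 - cos (blinfun_apply \<xi> x - blinfun_apply 0 x) \<partial>\<Delta>) + (\<integral>x. 1 - cos (blinfun_apply \<eta> x - blinfun_apply 0 x) \<partial>\<Delta>)
      - (\<integral>x. 1 - cos (blinfun_apply \<xi> x - blinfun_apply \<eta> x) \<partial>\<Delta>)"
    unfolding Re
    by (simp only: Bochner_Integration.integral_diff[OF Bochner_Integration.integrable_add[OF
          Delta_integral(1)[of \<xi> 0] Delta_integral(1)[of \<eta> 0]] Delta_integral(1)[of \<xi> \<eta>]]
        Bochner_Integration.integral_add[OF Delta_integral(1)[of \<xi> 0] Delta_integral(1)[of \<eta> 0]])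
  also have "\<dots> = fbm_cov (d \<xi>) (d \<eta>)"
    unfolding Delta_integral by (simp add: fbm_cov_def linear_0[OF linear_d] field_simps)
  finally have "Re (\<integral>x. ?f x \<partial>\<Delta>) = fbm_cov (d \<xi>) (d \<eta>)" .
  moreover have "Im (\<integral>x. ?f x \<partial>\<Delta>) = 0"
  proof -
    have "Im (\<integral>x. ?f x \<partial>\<Delta>) = (\<integral>x. Im (?f x) \<partial>\<Delta>)"
      by (rule integral_Im[OF int, symmetric])
    also have "\<dots> = - (\<integral>x. sin (blinfun_apply \<xi> x) - sin (blinfun_apply \<eta> x) - sin (blinfun_apply \<xi> x - blinfun_apply \<eta> x) \<partial>\<Delta>)"
      unfolding Im by (rule Bochner_Integration.integral_minus)
    finally show ?thesis by (simp only: phase minus_zero)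
  qed
  ultimately show ?thesis
    unfolding has_wiener_integral_inner[OF has_wiener_noise_process has_wiener_noise_process]
    by (simp add: complex_eq_iff)
qed

section \<open>Limits in quadratic mean over H\<close>

definition extension :: "('h \<Rightarrow> 'w \<Rightarrow> complex) \<Rightarrow> bool" where
  "extension W \<longleftrightarrow> (\<forall>\<phi>. L2_fun P (W \<phi>)) \<and>
    (\<forall>\<phi> \<xi>. (\<lambda>n. d (\<xi> n)) \<longlonglongrightarrow> \<phi> \<longrightarrow> L2_tendsto P (\<lambda>n. noise_process P \<Delta> B (\<xi> n)) (W \<phi>))"

text \<open>Take for \<open>W \<phi>\<close> the Wiener integral of \<open>1 - cis g\<close> for
  some version \<open>g\<close>; isometry converts L2(\<Delta>) convergence of the integrands, known
  along every sequence, into L2(P) convergence.\<close>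

lemma extension_exists: "\<exists>W. extension W"
proof -
  have "\<exists>X. \<exists>g. pw_version \<phi> g \<and> has_wiener_integral P \<Delta> B (\<lambda>x. 1 - cis (g x)) X" for \<phi>
    using pw_version_exists[of \<phi>] has_wiener_integral_exists[OF pw_version_L2] by blast
  then obtain W where W: "\<And>\<phi>. \<exists>g. pw_version \<phi> g \<and> has_wiener_integral P \<Delta> B (\<lambda>x. 1 - cis (g x)) (W \<phi>)"
    by metis
  have "extension W"
    unfolding extension_def
  proof (intro conjI allI impI)
    fix \<phi>
    obtain g where g: "pw_version \<phi> g" "has_wiener_integral P \<Delta> B (\<lambda>x. 1 - cis (g x)) (W \<phi>)"
      using W by blast
    show "L2_fun P (W \<phi>)" by (rule has_wiener_integral_L2(2)[OF g(2)])
    fix \<xi> :: "nat \<Rightarrow> _" assume \<xi>: "(\<lambda>n. d (\<xi> n)) \<longlonglongrightarrow> \<phi>"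
    show "L2_tendsto P (\<lambda>n. noise_process P \<Delta> B (\<xi> n)) (W \<phi>)"
      using pw_version_L2_tendsto[OF g(1) \<xi>]
      unfolding L2_tendsto_def has_wiener_integral_nn_dist[OF has_wiener_noise_process g(2)] .
  qed
  then show ?thesis by blast
qed

text \<open>Holds for any extension and any version, because the graph of the integral is closed;
  the choices made in the existence proof do not enter.\<close>

lemma extension_has_wiener_integral:
  assumes W: "extension W" and g: "pw_version \<phi> g"
  shows "has_wiener_integral P \<Delta> B (\<lambda>x. 1 - cis (g x)) (W \<phi>)"
proof -
  obtain \<xi> :: "nat \<Rightarrow> 'e \<Rightarrow>\<^sub>L real" where \<xi>: "(\<lambda>n. d (\<xi> n)) \<longlonglongrightarrow> \<phi>"
    using approximating_sequence by blast
  show ?thesis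
    using W \<xi>
    by (intro has_wiener_integral_limit[OF has_wiener_noise_process _ _ pw_version_L2_tendsto[OF g \<xi>]]
        L2_fun_measurable pw_version_L2[OF g]) (auto simp: extension_def)
qed

lemma extension_inner:
  assumes W: "extension W"
  shows "(\<integral>w. W \<phi> w * cnj (W \<psi> w) \<partial>P) = complex_of_real (fbm_cov \<phi> \<psi>)"
proof -
  obtain \<xi> :: "nat \<Rightarrow> 'e \<Rightarrow>\<^sub>L real" where \<xi>: "(\<lambda>n. d (\<xi> n)) \<longlonglongrightarrow> \<phi>"
    using approximating_sequence by blast
  obtain \<eta> :: "nat \<Rightarrow> 'e \<Rightarrow>\<^sub>L real" where \<eta>: "(\<lambda>n. d (\<eta> n)) \<longlonglongrightarrow> \<psi>"
    using approximating_sequence by blast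
  have L2: "L2_fun P (noise_process P \<Delta> B \<zeta>)" for \<zeta>
    by (rule has_wiener_integral_L2(2)[OF has_wiener_noise_process])
  have "(\<lambda>n. \<integral>w. noise_process P \<Delta> B (\<xi> n) w * cnj (noise_process P \<Delta> B (\<eta> n) w) \<partial>P) \<longlonglongrightarrow>
      (\<integral>w. W \<phi> w * cnj (W \<psi> w) \<partial>P)"
    using W \<xi> \<eta> by (intro L2_tendsto_inner L2) (auto simp: extension_def)
  moreover have "(\<lambda>n. complex_of_real (fbm_cov (d (\<xi> n)) (d (\<eta> n)))) \<longlonglongrightarrow> complex_of_real (fbm_cov \<phi> \<psi>)"
    unfolding fbm_cov_def by (intro tendsto_intros norm_powr_tendsto \<xi> \<eta>) simp
  ultimately show ?thesis
    unfolding noise_process_inner by (rule LIMSEQ_unique)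
qed

lemma extension_dist:
  assumes W: "extension W"
  shows "(\<integral>w. (cmod (W \<phi> w - W \<psi> w))\<^sup>2 \<partial>P) = norm (\<phi> - \<psi>) powr \<alpha>"
proof -
  have "L2_fun P (W \<phi>)" "L2_fun P (W \<psi>)" using W by (auto simp: extension_def)
  then show ?thesis
    using alpha by (simp add: L2_norm_diff_expand extension_inner[OF W] fbm_cov_def field_simps)
qed

text \<open>\<open>pw_version\<close> supplies only an upper bound. Equality follows by computing
  the variance of \<open>W \<phi>\<close> twice: as a limit over the dual, and by isometry from the
  integrand \<open>1 - cis g\<close>.\<close>

lemma pw_version_norm:
  assumes W: "extension W" and g: "pw_version \<phi> g"
  shows "norm \<phi> powr \<alpha> = 2 * (\<integral>x. 1 - cos (g x) \<partial>\<Delta>)"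
proof -
  have "(1 - cis a) * cnj (1 - cis a) = complex_of_real (2 * (1 - cos a))" for a
    using norm_diff_cis_sq[of 0 a] by (simp only: cis_zero complex_norm_square[symmetric] minus_zero cos_minus diff_0)
  then have "complex_of_real (fbm_cov \<phi> \<phi>) = (\<integral>x. complex_of_real (2 * (1 - cos (g x))) \<partial>\<Delta>)"
    using has_wiener_integral_inner[OF extension_has_wiener_integral[OF W g] extension_has_wiener_integral[OF W g]]
    by (simp only: extension_inner[OF W])
  also have "\<dots> = complex_of_real (2 * (\<integral>x. 1 - cos (g x) \<partial>\<Delta>))"
    by (simp only: integral_complex_of_real integral_mult_right_zero)
  finally have "fbm_cov \<phi> \<phi> = 2 * (\<integral>x. 1 - cos (g x) \<partial>\<Delta>)"
    unfolding of_real_eq_iff .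
  then show ?thesis using alpha by (simp add: fbm_cov_def)
qed

lemma extension_gaussian:
  assumes W: "extension W"
  shows "centred_gaussian_process P T (\<lambda>t. W (f t))"
proof -
  obtain g where g: "\<And>\<phi>. pw_version \<phi> (g \<phi>)"
    using pw_version_exists by metis
  show ?thesis
    by (rule centred_gaussian_process_wiener[OF extension_has_wiener_integral[OF W g]])
qed

end

section \<open>The embedding of the dual space\<close>

text \<open>The defect of additivity or homogeneity is orthogonal to the range of \<open>d\<close>
  and is itself a combination of values of \<open>d\<close>, hence 0. Linearity of
  \<open>dual_to_H\<close> is thus read off from scalar integrals instead of \<open>inv j\<close>
  and an integral with values in E.\<close>

lemma linear_if_inner_bilinear:
  fixes d :: "'v::real_vector \<Rightarrow> 'h::real_inner"
  assumes b: "\<And>x y. d x \<bullet> d y = b x y" and lin: "\<And>z. linear (\<lambda>x. b x z)"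
  shows "linear d"
proof (rule linearI)
  fix x y
  define v where "v = d (x + y) - d x - d y"
  have "v \<bullet> d z = 0" for z
    by (simp add: v_def inner_diff_left b linear_add[OF lin])
  then have "v \<bullet> v = 0"
    unfolding v_def by (simp add: inner_diff_right)
  then show "d (x + y) = d x + d y" by (simp add: v_def diff_eq_eq add.commute)
next
  fix r x
  define v where "v = d (r *\<^sub>R x) - r *\<^sub>R d x"
  have "v \<bullet> d z = 0" for z
    by (simp add: v_def inner_diff_left b linear_scale[OF lin])
  then have "v \<bullet> v = 0"
    unfolding v_def by (simp add: inner_diff_right)
  then show "d (r *\<^sub>R x) = r *\<^sub>R d x" by (simp add: v_def)
qed

lemma centred_gaussian_measure_sq_integrable:
  fixes \<xi> :: "'e::real_normed_vector \<Rightarrow>\<^sub>L real"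
  assumes "centred_gaussian_measure \<mu>"
  shows "integrable \<mu> (\<lambda>x. (blinfun_apply \<xi> x)\<^sup>2)"
proof -
  have [measurable_cong]: "sets \<mu> = sets borel"
    and "centred_gaussian_law (distr \<mu> borel (blinfun_apply \<xi>))"
    using assms by (auto simp: centred_gaussian_measure_def)
  from centred_gaussian_lawD(2)[OF this(2)] show ?thesis
    by (simp add: integrable_distr_eq)
qed

lemma centred_gaussian_measure_mult_integrable:
  fixes \<xi> \<eta> :: "'e::real_normed_vector \<Rightarrow>\<^sub>L real"
  assumes "centred_gaussian_measure \<mu>"
  shows "integrable \<mu> (\<lambda>x. blinfun_apply \<xi> x * blinfun_apply \<eta> x)"
proof -
  have "integrable \<mu> (\<lambda>x. ((blinfun_apply (\<xi> + \<eta>) x)\<^sup>2 - (blinfun_apply (\<xi> - \<eta>) x)\<^sup>2) / 4)"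
    by (intro integrable_divide Bochner_Integration.integrable_diff
        centred_gaussian_measure_sq_integrable[OF assms])
  then show ?thesis
    by (simp add: blinfun.add_left blinfun.diff_left power2_eq_square algebra_simps)
qed

lemma linear_dual_to_H:
  fixes \<mu> :: "'e::{banach, second_countable_topology} measure"
  assumes "abstract_wiener_space j \<mu>"
  shows "linear (dual_to_H j \<mu>)"
proof (rule linear_if_inner_bilinear)
  have g: "centred_gaussian_measure \<mu>" using assms by (simp add: abstract_wiener_space_def)
  show "dual_to_H j \<mu> \<xi> \<bullet> dual_to_H j \<mu> \<eta> = (\<integral>x. blinfun_apply \<xi> x * blinfun_apply \<eta> x \<partial>\<mu>)" for \<xi> \<eta>
    using assms by (simp add: abstract_wiener_space_def)
  show "linear (\<lambda>\<xi>. \<integral>x. blinfun_apply \<xi> x * blinfun_apply \<zeta> x \<partial>\<mu>)" for \<zeta> :: "'e \<Rightarrow>\<^sub>L real"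
    by (rule linearI)
       (simp_all add: blinfun.add_left blinfun.scaleR_left distrib_right mult.assoc
         centred_gaussian_measure_mult_integrable[OF g])
qed

lemma dual_to_H_isometry:
  assumes "abstract_wiener_space j \<mu>"
  shows "(\<integral>\<^sup>+x. ennreal ((blinfun_apply \<xi> x)\<^sup>2) \<partial>\<mu>) = ennreal ((norm (dual_to_H j \<mu> \<xi>))\<^sup>2)"
proof -
  have g: "centred_gaussian_measure \<mu>" using assms by (simp add: abstract_wiener_space_def)
  have "(norm (dual_to_H j \<mu> \<xi>))\<^sup>2 = (\<integral>x. blinfun_apply \<xi> x * blinfun_apply \<xi> x \<partial>\<mu>)"
    unfolding power2_norm_eq_inner using assms by (simp add: abstract_wiener_space_def)
  then show ?thesis
    using nn_integral_eq_integral[OF centred_gaussian_measure_sq_integrable[OF g, of \<xi>]]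
    by (simp add: power2_eq_square)
qed


section \<open>The Levy--Khintchine formula\<close>

definition levy_kernel :: "('e::real_normed_vector \<Rightarrow>\<^sub>L real) \<Rightarrow> 'e \<Rightarrow> complex" where
  "levy_kernel \<xi> x = cis (blinfun_apply \<xi> x) - 1
     - \<i> * complex_of_real (blinfun_apply \<xi> x * indicator (cball 0 1) x)"

lemma Re_levy_kernel: "Re (levy_kernel \<xi> x) = cos (blinfun_apply \<xi> x) - 1"
  by (simp add: levy_kernel_def)

lemma Im_levy_kernel: "Im (levy_kernel \<xi> x) = sin (blinfun_apply \<xi> x) - blinfun_apply \<xi> x * indicator (cball 0 1) x"
  by (simp add: levy_kernel_def)

text \<open>In the unit ball the compensator leaves a second-order Taylor remainder; outside it the
  kernel has modulus at most 2. The constant covers both cases.\<close>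

lemma norm_levy_kernel_le:
  "cmod (levy_kernel \<xi> x) \<le> (2 + (norm \<xi>)\<^sup>2) * min 1 ((norm x)\<^sup>2)"
proof (cases "norm x \<le> 1")
  case True
  define u where "u = blinfun_apply \<xi> x"
  have "cmod (levy_kernel \<xi> x) = cmod (iexp u - (1 + \<i> * complex_of_real u))"
    using True by (simp add: levy_kernel_def u_def cis_conv_exp diff_diff_eq)
  also have "\<dots> \<le> u\<^sup>2 / 2"
    using iexp_approx1[of u 1] by (simp add: numeral_2_eq_2)
  also have "\<dots> \<le> u\<^sup>2" by simp
  also have "u\<^sup>2 \<le> (norm \<xi> * norm x)\<^sup>2"
    using norm_blinfun[of \<xi> x] by (intro power2_le_iff_abs_le[THEN iffD2]) (auto simp: u_def)
  also have "\<dots> \<le> (2 + (norm \<xi>)\<^sup>2) * (norm x)\<^sup>2"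
    by (simp add: power_mult_distrib distrib_right)
  also have "(norm x)\<^sup>2 = min 1 ((norm x)\<^sup>2)"
    using power_le_one[of "norm x" 2] True by simp
  finally show ?thesis .
next
  case False
  have "cmod (levy_kernel \<xi> x) = cmod (cis (blinfun_apply \<xi> x) - 1)"
    using False by (simp add: levy_kernel_def)
  also have "\<dots> \<le> 2"
    using norm_triangle_ineq4[of "cis (blinfun_apply \<xi> x)" 1] by simp
  also have "\<dots> \<le> (2 + (norm \<xi>)\<^sup>2) * min 1 ((norm x)\<^sup>2)"
    using False by (simp add: min_def)
  finally show ?thesis .
qed

lemma levy_kernel_measurable [measurable]: "levy_kernel \<xi> \<in> borel_measurable borel"
  for \<xi> :: "'a::real_normed_vector \<Rightarrow>\<^sub>L real"
proof -
  have [measurable]: "cball (0::'a) 1 \<in> sets borel" by (rule borel_closed) simp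
  show ?thesis unfolding levy_kernel_def[abs_def] cis_conv_exp by measurable
qed

text \<open>\<open>N\<close> abstracts the exponent \<open>norm (d \<xi>) powr \<alpha>\<close>. The
  left side of \<open>representation\<close> is a positive real number, so modulus and argument of
  the right side can be compared separately.\<close>

locale levy_representation =
  fixes \<Delta> :: "'e::{real_inner, banach, second_countable_topology} measure" and N :: "('e \<Rightarrow>\<^sub>L real) \<Rightarrow> real"
    and \<alpha> :: real and b :: 'e and \<rho> :: "'e measure"
  assumes sets_Delta [measurable_cong]: "sets \<Delta> = sets borel"
    and finite_Delta: "(\<integral>\<^sup>+x. ennreal (min 1 ((norm x)\<^sup>2)) \<partial>\<Delta>) < \<infinity>"
    and alpha: "\<alpha> < 2"
    and homogeneous: "\<And>t \<xi>. 0 < t \<Longrightarrow> N (t *\<^sub>R \<xi>) = t powr \<alpha> * N \<xi>"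
    and representation: "\<And>\<xi>. complex_of_real (exp (- N \<xi> / 2)) =
      exp (\<i> * complex_of_real (blinfun_apply \<xi> b) - complex_of_real (\<integral>x. (blinfun_apply \<xi> x)\<^sup>2 \<partial>\<rho>) / 2
        + (\<integral>x. levy_kernel \<xi> x \<partial>\<Delta>))"
begin

lemma min_integrable: "integrable \<Delta> (\<lambda>x. min 1 ((norm x)\<^sup>2))"
  using finite_Delta by (intro integrableI_nonneg) auto

lemma levy_kernel_integrable: "integrable \<Delta> (levy_kernel \<xi>)"
proof (rule Bochner_Integration.integrable_bound)
  show "integrable \<Delta> (\<lambda>x. (2 + (norm \<xi>)\<^sup>2) * min 1 ((norm x)\<^sup>2))"
    using min_integrable by simp
  show "AE x in \<Delta>. norm (levy_kernel \<xi> x) \<le> norm ((2 + (norm \<xi>)\<^sup>2) * min 1 ((norm x)\<^sup>2))"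
    using norm_levy_kernel_le[of \<xi>] by (intro AE_I2) (auto intro: order_trans[OF _ abs_ge_self])
qed measurable

definition phase :: "('e \<Rightarrow>\<^sub>L real) \<Rightarrow> real" where
  "phase \<xi> = blinfun_apply \<xi> b + (\<integral>x. Im (levy_kernel \<xi> x) \<partial>\<Delta>)"

definition variance :: "('e \<Rightarrow>\<^sub>L real) \<Rightarrow> real" where
  "variance \<xi> = (\<integral>x. (blinfun_apply \<xi> x)\<^sup>2 \<partial>\<rho>)"

lemma representation_polar:
  "complex_of_real (exp (- N \<xi> / 2)) =
    exp (Complex ((\<integral>x. cos (blinfun_apply \<xi> x) - 1 \<partial>\<Delta>) - variance \<xi> / 2) (phase \<xi>))"
proof -
  have "\<i> * complex_of_real (blinfun_apply \<xi> b) - complex_of_real (variance \<xi>) / 2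
      + (\<integral>x. levy_kernel \<xi> x \<partial>\<Delta>) =
    Complex ((\<integral>x. cos (blinfun_apply \<xi> x) - 1 \<partial>\<Delta>) - variance \<xi> / 2) (phase \<xi>)"
    using integral_Re[OF levy_kernel_integrable, of \<xi>] integral_Im[OF levy_kernel_integrable, of \<xi>]
    by (simp add: complex_eq_iff phase_def Re_levy_kernel)
  then show ?thesis
    using representation[of \<xi>] unfolding variance_def by simp
qed

lemma one_minus_cos_integrable: "integrable \<Delta> (\<lambda>x. 1 - cos (blinfun_apply \<xi> x))"
  for \<xi> :: "'e \<Rightarrow>\<^sub>L real"
  using integrable_minus[OF integrable_Re[OF levy_kernel_integrable[of \<xi>]]]
  by (simp add: Re_levy_kernel)

lemma N_eq_variance: "N \<xi> = variance \<xi> + 2 * (\<integral>x. 1 - cos (blinfun_apply \<xi> x) \<partial>\<Delta>)"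
proof -
  have "(\<integral>x. 1 - cos (blinfun_apply \<xi> x) \<partial>\<Delta>) = - (\<integral>x. cos (blinfun_apply \<xi> x) - 1 \<partial>\<Delta>)"
    by (simp flip: Bochner_Integration.integral_minus)
  moreover have "exp (- N \<xi> / 2) = exp ((\<integral>x. cos (blinfun_apply \<xi> x) - 1 \<partial>\<Delta>) - variance \<xi> / 2)"
    using arg_cong[OF representation_polar[of \<xi>], of cmod] by simp
  then have "- N \<xi> / 2 = (\<integral>x. cos (blinfun_apply \<xi> x) - 1 \<partial>\<Delta>) - variance \<xi> / 2"
    by (simp only: exp_inj_iff)
  ultimately show ?thesis by simp
qed

text \<open>The Gaussian part is quadratic, so it would dominate \<open>N\<close>, which has degree \<open>\<alpha> < 2\<close>.\<close>

lemma variance_eq_0: "variance \<xi> = 0"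
proof -
  have le: "variance \<xi> \<le> t powr (\<alpha> - 2) * N \<xi>" if t: "0 < t" for t
  proof -
    have "variance (t *\<^sub>R \<xi>) = t\<^sup>2 * variance \<xi>"
      by (simp add: variance_def blinfun.scaleR_left power_mult_distrib)
    moreover have "0 \<le> (\<integral>x. 1 - cos (blinfun_apply (t *\<^sub>R \<xi>) x) \<partial>\<Delta>)"
      by (rule Bochner_Integration.integral_nonneg) simp
    ultimately have "t\<^sup>2 * variance \<xi> \<le> t powr \<alpha> * N \<xi>"
      using N_eq_variance[of "t *\<^sub>R \<xi>"] homogeneous[OF t, of \<xi>] by simp
    then show ?thesis
      using t by (simp add: powr_diff field_simps)
  qed
  have "((\<lambda>t::real. t powr (\<alpha> - 2) * N \<xi>) \<longlongrightarrow> 0 * N \<xi>) at_top"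
    using alpha by (intro tendsto_intros tendsto_neg_powr filterlim_ident) auto
  moreover have "\<forall>\<^sub>F t in at_top. variance \<xi> \<le> t powr (\<alpha> - 2) * N \<xi>"
    using eventually_gt_at_top[of "0::real"] by (rule eventually_mono) (rule le)
  ultimately have "variance \<xi> \<le> 0 * N \<xi>"
    by (rule tendsto_lowerbound) simp
  moreover have "0 \<le> variance \<xi>"
    unfolding variance_def by (rule Bochner_Integration.integral_nonneg) simp
  ultimately show ?thesis by simp
qed

lemma N_eq: "N \<xi> = 2 * (\<integral>x. 1 - cos (blinfun_apply \<xi> x) \<partial>\<Delta>)"
  using N_eq_variance[of \<xi>] by (simp add: variance_eq_0)

text \<open>The Fourier transform is real. Only that the phase is a multiple of pi is retained,
  which already makes its values discrete.\<close>

lemma sin_phase: "sin (phase \<xi>) = 0"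
proof -
  have "Im (complex_of_real (exp (- N \<xi> / 2))) = 0" by simp
  then show ?thesis unfolding representation_polar by (simp add: Im_exp)
qed

lemma phase_continuous: "continuous_on {0..1} (\<lambda>t::real. phase (t *\<^sub>R \<xi>))"
  unfolding continuous_on_sequentially
proof (intro allI ballI impI)
  fix u :: "nat \<Rightarrow> real" and t :: real
  assume "t \<in> {0..1}" "(\<forall>n. u n \<in> {0..1}) \<and> u \<longlonglongrightarrow> t"
  then have u: "\<And>n. 0 \<le> u n" "\<And>n. u n \<le> 1" "u \<longlonglongrightarrow> t" by auto
  have "(\<lambda>n. \<integral>x. Im (levy_kernel (u n *\<^sub>R \<xi>) x) \<partial>\<Delta>) \<longlonglongrightarrow> (\<integral>x. Im (levy_kernel (t *\<^sub>R \<xi>) x) \<partial>\<Delta>)"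
  proof (rule integral_dominated_convergence)
    show "integrable \<Delta> (\<lambda>x. (2 + (norm \<xi>)\<^sup>2) * min 1 ((norm x)\<^sup>2))"
      using min_integrable by simp
    show "AE x in \<Delta>. (\<lambda>n. Im (levy_kernel (u n *\<^sub>R \<xi>) x)) \<longlonglongrightarrow> Im (levy_kernel (t *\<^sub>R \<xi>) x)"
      unfolding Im_levy_kernel blinfun.scaleR_left by (intro AE_I2 tendsto_intros u)
    show "AE x in \<Delta>. norm (Im (levy_kernel (u n *\<^sub>R \<xi>) x)) \<le> (2 + (norm \<xi>)\<^sup>2) * min 1 ((norm x)\<^sup>2)" for n
    proof (rule AE_I2)
      fix x
      have "norm (Im (levy_kernel (u n *\<^sub>R \<xi>) x)) \<le> cmod (levy_kernel (u n *\<^sub>R \<xi>) x)"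
        by (simp add: abs_Im_le_cmod)
      also have "\<dots> \<le> (2 + (norm (u n *\<^sub>R \<xi>))\<^sup>2) * min 1 ((norm x)\<^sup>2)"
        by (rule norm_levy_kernel_le)
      \<comment> \<open>For parameters in [0, 1] the scaled functional has no larger norm, so one
        dominating function serves the whole segment.\<close>
      also have "\<dots> \<le> (2 + (norm \<xi>)\<^sup>2) * min 1 ((norm x)\<^sup>2)"
        using u(1,2)[of n] by (intro mult_right_mono add_left_mono power_mono)
          (auto simp: mult_left_le_one_le)
      finally show "norm (Im (levy_kernel (u n *\<^sub>R \<xi>) x)) \<le> (2 + (norm \<xi>)\<^sup>2) * min 1 ((norm x)\<^sup>2)" .
    qed
  qed measurable
  then have "(\<lambda>n. phase (u n *\<^sub>R \<xi>)) \<longlonglongrightarrow> phase (t *\<^sub>R \<xi>)"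
    unfolding phase_def blinfun.scaleR_left by (intro tendsto_intros u)
  then show "((\<lambda>t. phase (t *\<^sub>R \<xi>)) \<circ> u) \<longlonglongrightarrow> phase (t *\<^sub>R \<xi>)"
    by (simp add: o_def)
qed

text \<open>A positive phase would, by the intermediate value theorem on the segment from 0 to
  \<open>\<xi>\<close>, take the value \<open>min (phase \<xi>) 1\<close>, which lies strictly
  between 0 and pi, where the sine is positive. The other sign follows because the phase is
  odd.\<close>

lemma phase_nonpos: "phase \<xi> \<le> 0"
proof (rule ccontr)
  assume "\<not> phase \<xi> \<le> 0"
  then have pos: "0 < phase \<xi>" by simp
  have "phase 0 = 0" by (simp add: phase_def Im_levy_kernel)
  then have "\<exists>t\<ge>0. t \<le> 1 \<and> phase (t *\<^sub>R \<xi>) = min (phase \<xi>) 1"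
    using pos by (intro IVT' phase_continuous) auto
  then obtain t where "phase (t *\<^sub>R \<xi>) = min (phase \<xi>) 1" by blast
  then have "sin (min (phase \<xi>) 1) = 0" using sin_phase[of "t *\<^sub>R \<xi>"] by simp
  moreover have "0 < sin (min (phase \<xi>) 1)"
    using pos pi_ge_two by (intro sin_gt_zero) auto
  ultimately show False by simp
qed

lemma phase_eq_0: "phase \<xi> = 0"
proof -
  have "phase (- \<xi>) = - phase \<xi>"
    by (simp add: phase_def Im_levy_kernel blinfun.minus_left flip: Bochner_Integration.integral_minus)
  then show ?thesis using phase_nonpos[of \<xi>] phase_nonpos[of "- \<xi>"] by simp
qed

text \<open>The compensators are linear in the functional and cancel in this combination, which is
  therefore a sum of integrable kernels and integrates to a combination of phases.\<close>

lemma integral_sin_eq_0: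
  fixes \<xi> \<eta> :: "'e \<Rightarrow>\<^sub>L real"
  shows
  "(\<integral>x. sin (blinfun_apply \<xi> x) - sin (blinfun_apply \<eta> x) - sin (blinfun_apply \<xi> x - blinfun_apply \<eta> x) \<partial>\<Delta>) = 0"
proof -
  note int = integrable_Im[OF levy_kernel_integrable]
  have "(\<integral>x. sin (blinfun_apply \<xi> x) - sin (blinfun_apply \<eta> x) - sin (blinfun_apply \<xi> x - blinfun_apply \<eta> x) \<partial>\<Delta>) =
      (\<integral>x. Im (levy_kernel \<xi> x) - Im (levy_kernel \<eta> x) - Im (levy_kernel (\<xi> - \<eta>) x) \<partial>\<Delta>)"
    by (intro Bochner_Integration.integral_cong refl) (simp add: Im_levy_kernel blinfun.diff_left algebra_simps)
  also have "\<dots> = (\<integral>x. Im (levy_kernel \<xi> x) \<partial>\<Delta>) - (\<integral>x. Im (levy_kernel \<eta> x) \<partial>\<Delta>)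
      - (\<integral>x. Im (levy_kernel (\<xi> - \<eta>) x) \<partial>\<Delta>)"
    by (simp only: Bochner_Integration.integral_diff[OF Bochner_Integration.integrable_diff[OF int[of \<xi>] int[of \<eta>]] int[of "\<xi> - \<eta>"]]
        Bochner_Integration.integral_diff[OF int[of \<xi>] int[of \<eta>]])
  also have "\<dots> = phase \<xi> - phase \<eta> - phase (\<xi> - \<eta>)"
    by (simp add: phase_def blinfun.diff_left)
  finally show ?thesis by (simp add: phase_eq_0)
qed

lemma nn_integral_one_minus_cos:
  "(\<integral>\<^sup>+x. ennreal (2 * (1 - cos (blinfun_apply \<xi> x))) \<partial>\<Delta>) = ennreal (N \<xi>)"
proof -
  have "integrable \<Delta> (\<lambda>x. 2 * (1 - cos (blinfun_apply \<xi> x)))"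
    by (rule integrable_mult_right[OF one_minus_cos_integrable])
  then have "(\<integral>\<^sup>+x. ennreal (2 * (1 - cos (blinfun_apply \<xi> x))) \<partial>\<Delta>) =
      ennreal (\<integral>x. 2 * (1 - cos (blinfun_apply \<xi> x)) \<partial>\<Delta>)"
    by (rule nn_integral_eq_integral) simp
  then show ?thesis by (simp only: integral_mult_right_zero N_eq)
qed

end


section \<open>Indicators of rectangles\<close>

text \<open>The condition on the square covers an indicator as well as a difference of two
  indicators, whose square is the indicator of the symmetric difference.\<close>

lemma norm_abs_cube_L2_sq_indicator:
  fixes A :: "(real ^ 'n) set"
  assumes f: "cube_sq_integrable f" and sq: "\<And>x. (f x)\<^sup>2 = indicator A x"
    and A: "A \<in> sets borel" "A \<subseteq> cbox 0 1"
  shows "(norm (abs_cube_L2 f))\<^sup>2 = measure lborel A"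
proof -
  have "emeasure lborel A \<le> emeasure lborel (cbox 0 (1 :: real ^ 'n))"
    using A by (intro emeasure_mono) auto
  also have "\<dots> < \<infinity>" by (rule emeasure_lborel_cbox_finite)
  finally have fin: "emeasure lborel A = ennreal (measure lborel A)"
    by (simp add: emeasure_eq_ennreal_measure less_top)
  have "ennreal ((norm (abs_cube_L2 f))\<^sup>2) = (\<integral>\<^sup>+x. ennreal (indicator A x) \<partial>cube_measure)"
    unfolding norm_abs_cube_L2[OF f] sq ..
  also have "\<dots> = (\<integral>\<^sup>+x. indicator A x \<partial>(lborel :: (real ^ 'n) measure))"
    unfolding cube_measure_def using A
    by (subst nn_integral_restrict_space, simp, intro nn_integral_cong) (auto split: split_indicator)
  also have "\<dots> = ennreal (measure lborel A)"
    using A fin by simp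
  finally show ?thesis by simp
qed

lemma cube_sq_integrable_indicator:
  fixes A :: "(real ^ 'n) set"
  assumes A: "A \<in> sets borel"
  shows "cube_sq_integrable (indicator A)"
  unfolding cube_sq_integrable_def
proof
  show m: "(indicator A :: _ \<Rightarrow> real) \<in> borel_measurable (cube_measure :: (real ^ 'n) measure)"
    unfolding cube_measure_def using A by (intro measurable_restrict_space1) auto
  interpret finite_measure "cube_measure :: (real ^ 'n) measure" by (rule finite_measure_cube)
  show "integrable cube_measure (\<lambda>x. (indicator A x :: real)\<^sup>2)"
    using m by (intro integrable_const_bound[of _ 1]) (auto split: split_indicator)
qed

lemma cbox_0_subset_cube: "t \<in> cbox 0 1 \<Longrightarrow> cbox 0 t \<subseteq> cbox 0 (1 :: real ^ 'n)"
  by (auto simp: mem_box_cart) (meson order_trans)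

lemma norm_rect_ind: "t \<in> cbox 0 1 \<Longrightarrow> (norm (rect_ind t))\<^sup>2 = measure lborel (cbox 0 t)"
  unfolding rect_ind_def
  by (intro norm_abs_cube_L2_sq_indicator cube_sq_integrable_indicator cbox_0_subset_cube)
     (auto split: split_indicator)

lemma norm_rect_ind_diff:
  assumes "s \<in> cbox 0 1" "t \<in> cbox 0 1"
  shows "(norm (rect_ind s - rect_ind t))\<^sup>2 = measure lborel (sym_diff (cbox 0 s) (cbox 0 t))"
proof -
  have i: "cube_sq_integrable (indicator (cbox 0 u))" for u :: "real ^ 'n"
    by (rule cube_sq_integrable_indicator) simp
  have "rect_ind s - rect_ind t = abs_cube_L2 (\<lambda>x. indicator (cbox 0 s) x - indicator (cbox 0 t) x)"
    unfolding rect_ind_def by (rule minus_cube_L2.abs_eq) (auto simp: cube_L2_rel_def i)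
  then show ?thesis
    using cbox_0_subset_cube[OF assms(1)] cbox_0_subset_cube[OF assms(2)]
    by (simp only:) (intro norm_abs_cube_L2_sq_indicator cube_sq_integrable_diff i,
        auto split: split_indicator)
qed

lemma powr_sq: "0 \<le> x \<Longrightarrow> (x\<^sup>2) powr (2 * h) = x powr (4 * h)" for x h :: real
  by (simp add: powr_powr flip: powr_numeral)

text \<open>The consequences are stated for an arbitrary extension \<open>W\<close>, so none depends
  on the versions chosen in its construction; the existence part keeps them from being
  vacuous.\<close>

theorem theorem1:
  fixes h :: real
    and j :: "'n::finite cube_L2 \<Rightarrow> 'e::{real_inner, banach, second_countable_topology}"
    and \<mu> \<Gamma> \<Delta> :: "'e measure"
    and P :: "'w measure"
    and B :: "'e set \<Rightarrow> 'w \<Rightarrow> complex"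
  assumes h: "0 < h" "h < 1/2"
    and wiener: "abstract_wiener_space j \<mu>" "hilbert_schmidt j"
    and stable: "symmetric_measure \<Gamma>" "strictly_stable (4 * h) \<Gamma>"
    and fourier: "\<And>\<xi>. fourier_measure \<Gamma> \<xi> =
      complex_of_real (exp (- (norm (dual_to_H j \<mu> \<xi>) powr (4 * h)) / 2))"
    and levy: "levy_measure_of \<Gamma> \<Delta>"
    and noise: "prob_space P" "complex_white_noise P \<Delta> B"
  shows "(\<exists>W. L2_extension j \<mu> P (noise_process P \<Delta> B) W) \<and>
    (\<forall>W. L2_extension j \<mu> P (noise_process P \<Delta> B) W \<longrightarrow>
       (\<forall>\<phi> \<psi>. (\<integral>w. (cmod (W \<phi> w - W \<psi> w))\<^sup>2 \<partial>P) = norm (\<phi> - \<psi>) powr (4 * h)) \<and>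
       (\<forall>\<phi>. \<exists>g. paley_wiener_version j \<mu> \<Delta> \<phi> g \<and>
          norm \<phi> powr (4 * h) = 2 * (\<integral>x. 1 - cos (g x) \<partial>\<Delta>) \<and>
          has_wiener_integral P \<Delta> B (\<lambda>x. 1 - cis (g x)) (W \<phi>)) \<and>
       multiparameter_fbm h P (\<lambda>t. W (rect_ind t)))"
proof -
  let ?d = "dual_to_H j \<mu>"
  obtain b \<rho> where b: "\<And>\<xi>. fourier_measure \<Gamma> \<xi> =
      exp (\<i> * complex_of_real (blinfun_apply \<xi> b) - complex_of_real (\<integral>x. (blinfun_apply \<xi> x)\<^sup>2 \<partial>\<rho>) / 2
        + (\<integral>x. levy_kernel \<xi> x \<partial>\<Delta>))"
    using levy unfolding levy_measure_of_def levy_kernel_def by blast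
  interpret L: levy_representation \<Delta> "\<lambda>\<xi>. norm (?d \<xi>) powr (4 * h)" "4 * h" b \<rho>
  proof
    show "norm (?d (t *\<^sub>R \<xi>)) powr (4 * h) = t powr (4 * h) * norm (?d \<xi>) powr (4 * h)" if "0 < t" for t \<xi>
      using that by (simp add: linear_scale[OF linear_dual_to_H[OF wiener(1)]] powr_mult)
  qed (use levy h b fourier in \<open>auto simp: levy_measure_of_def\<close>)
  interpret white_noise P \<Delta> B
    using noise by (simp add: white_noise_def white_noise_axioms_def)
  interpret S: spherical_noise P \<Delta> B ?d \<mu> "4 * h"
  proof
    show "sets \<mu> = sets borel" "closure (range ?d) = UNIV"
      using wiener(1) by (auto simp: abstract_wiener_space_def centred_gaussian_measure_def)
  qed (use h in \<open>auto simp: L.sets_Delta linear_add[OF linear_dual_to_H[OF wiener(1)]]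
        linear_scale[OF linear_dual_to_H[OF wiener(1)]] dual_to_H_isometry[OF wiener(1)]
        L.nn_integral_one_minus_cos L.integral_sin_eq_0 simp del: right_diff_distrib_numeral\<close>)
  have ext: "L2_extension j \<mu> P (noise_process P \<Delta> B) W \<longleftrightarrow> S.extension W" for W
    by (auto simp: L2_extension_def S.extension_def L2_fun_def L2_tendsto_def)
  show ?thesis
    unfolding ext
  proof (intro conjI allI impI)
    show "\<exists>W. S.extension W" by (rule S.extension_exists)
    fix W assume W: "S.extension W"
    show "(\<integral>w. (cmod (W \<phi> w - W \<psi> w))\<^sup>2 \<partial>P) = norm (\<phi> - \<psi>) powr (4 * h)" for \<phi> \<psi>
      by (rule S.extension_dist[OF W])
    show "\<exists>g. paley_wiener_version j \<mu> \<Delta> \<phi> g \<and> norm \<phi> powr (4 * h) = 2 * (\<integral>x. 1 - cos (g x) \<partial>\<Delta>) \<and>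
        has_wiener_integral P \<Delta> B (\<lambda>x. 1 - cis (g x)) (W \<phi>)" for \<phi>
    proof -
      obtain g where g: "S.pw_version \<phi> g" using S.pw_version_exists by blast
      then have "g \<in> borel_measurable borel" by (simp add: S.pw_version_def)
      then have "paley_wiener_version j \<mu> \<Delta> \<phi> g"
        unfolding paley_wiener_version_def
        using S.pw_version_mu_tendsto[OF g] S.pw_version_Delta_tendsto[OF g] by blast
      then show ?thesis
        using S.pw_version_norm[OF W g] S.extension_has_wiener_integral[OF W g] by blast
    qed
    \<comment> \<open>Volumes are squared norms of indicators, so \<open>powr_sq\<close> turns their
      power 2h into the power 4h of the norm.\<close>
    have "S.fbm_cov (rect_ind s) (rect_ind t) = mfbm_cov h s t" if "s \<in> cbox 0 1" "t \<in> cbox 0 1" for s t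
      unfolding S.fbm_cov_def mfbm_cov_def
      by (simp add: norm_rect_ind norm_rect_ind_diff that powr_sq flip: norm_rect_ind norm_rect_ind_diff)
    then show "multiparameter_fbm h P (\<lambda>t. W (rect_ind t))"
      unfolding multiparameter_fbm_def
      using S.extension_gaussian[OF W, of "cbox 0 1" rect_ind] S.extension_inner[OF W] by simp
  qed
qed

end
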